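(* Let $\Sigma(x)$ be an $\boldsymbol{e}$-invariant partial type and suppose $\boldsymbol{e}\in\operatorname{dcl}(\Sigma)$, i.e. there is a small tuple $c$ of realizations of $\Sigma$ with $\boldsymbol{e}\in\operatorname{dcl}(c)$. Then (1) $\operatorname{Gal}^c_{\mathrm L}(\Sigma,\boldsymbol{e})=\operatorname{Autf}_{\mathrm{KP}}(\Sigma,\boldsymbol{e})/\operatorname{Autf}_{\mathrm L}(\Sigma,\boldsymbol{e})$; (2) $\operatorname{Gal}^0_{\mathrm L}(\Sigma,\boldsymbol{e})=\operatorname{Autf}_{\mathrm{S}}(\Sigma,\boldsymbol{e})/\operatorname{Autf}_{\mathrm L}(\Sigma,\boldsymbol{e})$.
   Context: Setup. $T$ is a complete first-order theory with monster model $\mathfrak{C}$; "small" means of size less than the degree of saturation and strong homogeneity of $\mathfrak{C}$. All sets, tuples, ordinals, cardinals and (elementary sub)models considered are small. A hyperimaginary is an equivalence class $a_E$ of an $\emptyset$-type-definable equivalence relation $E$ on $\mathfrak{C}^\alpha$ ($\alpha$ a small ordinal), with representative $a$. $\boldsymbol{e}=a_E$ is a fixed arbitrary hyperimaginary and $\operatorname{Aut}_{\boldsymbol{e}}(\mathfrak{C})=\{f\in\operatorname{Aut}(\mathfrak{C}): f(\boldsymbol{e})=\boldsymbol{e}\text{ setwise}\}$. For a tuple or set $c$, $\boldsymbol{e}\in\operatorname{dcl}(c)$ means every automorphism fixing $c$ pointwise fixes $\boldsymbol{e}$. Lascar, KP and Shelah strong types. $\operatorname{Autf}_{\mathrm L}(\mathfrak{C},\boldsymbol{e})$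 is the (normal) subgroup of $\operatorname{Aut}_{\boldsymbol{e}}(\mathfrak{C})$ generated by those $f\in\operatorname{Aut}_{\boldsymbol{e}}(\mathfrak{C})$ that fix pointwise some model $M\models T$ with $\boldsymbol{e}\in\operatorname{dcl}(M)$. Put $\operatorname{Gal}_{\mathrm L}(T,\boldsymbol{e})=\operatorname{Aut}_{\boldsymbol{e}}(\mathfrak{C})/\operatorname{Autf}_{\mathrm L}(\mathfrak{C},\boldsymbol{e})$ with quotient map $\pi$. Its topology is the quotient topology under the well-defined map $\{\operatorname{tp}(f(M)/M): f\in\operatorname{Aut}_{\boldsymbol{e}}(\mathfrak{C})\}\to\operatorname{Gal}_{\mathrm L}(T,\boldsymbol{e})$, $\operatorname{tp}(f(M)/M)\mapsto [f]$, for a small model $M$ with $\boldsymbol{e}\in\operatorname{dcl}(M)$ (the domain has the logic topology; the result is independent of $M$ and is a quasi-compact topological group). $\operatorname{Autf}_{\mathrm{KP}}(\mathfrak{C},\boldsymbol{e})$ is the $\pi$-preimage of the closure of the trivial subgroup, and $\operatorname{Autf}_{\mathrm{S}}(\mathfrak{C},\boldsymbol{e})$ is the $\pi$-preimage of the connected component of the identity. For $X\in\{\mathrm L,\mathrm{KP},\mathrm S\}$, $c\equiv^X_{\boldsymbol{e}} d$ means there is $f\in\operatorname{Autf}_X(\mathfrak{C},\boldsymbol{e})$ with $f(c)=d$. Relativization. $\Sigma(x)$ is a partial type, $x$ a possibly infinite tuple of variables; $\boldsymbol{e}$-invariant means that for $f\in\operatorname{Aut}_{\boldsymbol{e}}(\mathfrak{C})$,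 $b\models\Sigma$ iff $f(b)\models\Sigma$. $\Sigma(\mathfrak{C})$ is its solution set. A tuple of realizations of $\Sigma$ is a tuple $(b_i)_{i<\lambda}$ with each $b_i\models\Sigma$. $\operatorname{Aut}_{\boldsymbol{e}}(\Sigma)=\{f\upharpoonright\Sigma(\mathfrak{C}): f\in\operatorname{Aut}_{\boldsymbol{e}}(\mathfrak{C})\}$; for $X\in\{\mathrm L,\mathrm{KP},\mathrm S\}$, $\operatorname{Autf}_X(\Sigma,\boldsymbol{e})$ is the normal subgroup of all $\sigma\in\operatorname{Aut}_{\boldsymbol{e}}(\Sigma)$ with $b\equiv^X_{\boldsymbol{e}}\sigma(b)$ for every tuple $b$ (of any length) of realizations of $\Sigma$; $\operatorname{Gal}_{\mathrm L}(\Sigma,\boldsymbol{e})=\operatorname{Aut}_{\boldsymbol{e}}(\Sigma)/\operatorname{Autf}_{\mathrm L}(\Sigma,\boldsymbol{e})$. A Lascar tuple is a small tuple $b$ of realizations of $\Sigma$ with $\operatorname{Autf}_{\mathrm L}(\Sigma,\boldsymbol{e})=\{\sigma\in\operatorname{Aut}_{\boldsymbol{e}}(\Sigma): b\equiv^{\mathrm L}_{\boldsymbol{e}}\sigma(b)\}$. When $\boldsymbol{e}\in\operatorname{dcl}(\Sigma)$ there is a Lascar tuple $b$ with $\boldsymbol{e}\in\operatorname{dcl}(b)$; $\operatorname{Gal}_{\mathrm L}(\Sigma,\boldsymbol{e})$ carries the quotient topology under the well-defined surjection $\nu_b: S_b(b)=\{\operatorname{tp}(\sigma(b)/b):\sigma\in\operatorname{Aut}_{\boldsymbol{e}}(\Sigma)\}\to\operatorname{Gal}_{\mathrm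 L}(\Sigma,\boldsymbol{e})$, $\operatorname{tp}(\sigma(b)/b)\mapsto[\sigma]$, where $S_b(b)$ has the logic topology (independent of $b$; a quasi-compact topological group). $\operatorname{Gal}^c_{\mathrm L}(\Sigma,\boldsymbol{e})$ is the closure of its trivial subgroup and $\operatorname{Gal}^0_{\mathrm L}(\Sigma,\boldsymbol{e})$ its connected component containing the identity. *)

theory Defs
  imports "HOL-Analysis.Abstract_Topology_2" "HOL-Analysis.Function_Topology" "HOL-Algebra.Bij" "HOL-Algebra.Generated_Groups"
begin

unbundle cardinal_syntax

section \<open>First-order logic\<close>

datatype ('f, 'v) tm = Var 'v | App 'f "('f, 'v) tm list"

datatype ('f, 'r, 'v) fm =
    Eq "('f, 'v) tm" "('f, 'v) tm"
  | Rel 'r "('f, 'v) tm list"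
  | Neg "('f, 'r, 'v) fm"
  | Conj "('f, 'r, 'v) fm" "('f, 'r, 'v) fm"
  | Ex 'v "('f, 'r, 'v) fm"

text \<open>A language (symbols with arities) together with a structure for it; the universe
  is the whole type \<open>'m\<close>. Interpretations only matter on lists of the right length.\<close>

record ('f, 'r, 'm) struct =
  fun_arity :: "'f \<Rightarrow> nat"
  rel_arity :: "'r \<Rightarrow> nat"
  fun_int :: "'f \<Rightarrow> 'm list \<Rightarrow> 'm"
  rel_int :: "'r \<Rightarrow> 'm list \<Rightarrow> bool"

primrec wf_tm :: "('f, 'r, 'm) struct \<Rightarrow> ('f, 'v) tm \<Rightarrow> bool" where
  "wf_tm C (Var v) = True"
| "wf_tm C (App f ts) = (length ts = fun_arity C f \<and> list_all (wf_tm C) ts)"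

primrec wf_fm :: "('f, 'r, 'm) struct \<Rightarrow> ('f, 'r, 'v) fm \<Rightarrow> bool" where
  "wf_fm C (Eq s t) = (wf_tm C s \<and> wf_tm C t)"
| "wf_fm C (Rel r ts) = (length ts = rel_arity C r \<and> list_all (wf_tm C) ts)"
| "wf_fm C (Neg p) = wf_fm C p"
| "wf_fm C (Conj p q) = (wf_fm C p \<and> wf_fm C q)"
| "wf_fm C (Ex v p) = wf_fm C p"

primrec fv_tm :: "('f, 'v) tm \<Rightarrow> 'v set" where
  "fv_tm (Var v) = {v}"
| "fv_tm (App f ts) = \<Union> (set (map fv_tm ts))"

primrec fv :: "('f, 'r, 'v) fm \<Rightarrow> 'v set" where
  "fv (Eq s t) = fv_tm s \<union> fv_tm t"
| "fv (Rel r ts) = \<Union> (fv_tm ` set ts)"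
| "fv (Neg p) = fv p"
| "fv (Conj p q) = fv p \<union> fv q"
| "fv (Ex v p) = fv p - {v}"

primrec eval_tm :: "('f, 'r, 'm) struct \<Rightarrow> ('v \<Rightarrow> 'm) \<Rightarrow> ('f, 'v) tm \<Rightarrow> 'm" where
  "eval_tm C s (Var v) = s v"
| "eval_tm C s (App f ts) = fun_int C f (map (eval_tm C s) ts)"

text \<open>Satisfaction in the structure induced on a subset \<open>U\<close> of the universe.\<close>

primrec sat :: "('f, 'r, 'm) struct \<Rightarrow> 'm set \<Rightarrow> ('v \<Rightarrow> 'm) \<Rightarrow> ('f, 'r, 'v) fm \<Rightarrow> bool" where
  "sat C U s (Eq t u) = (eval_tm C s t = eval_tm C s u)"
| "sat C U s (Rel r ts) = rel_int C r (map (eval_tm C s) ts)"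
| "sat C U s (Neg p) = (\<not> sat C U s p)"
| "sat C U s (Conj p q) = (sat C U s p \<and> sat C U s q)"
| "sat C U s (Ex v p) = (\<exists>x\<in>U. sat C U (s(v := x)) p)"

definition elementary_submodel :: "('f, 'r, 'm) struct \<Rightarrow> 'm set \<Rightarrow> bool" where
  "elementary_submodel C U \<longleftrightarrow>
     U \<noteq> {} \<and>
     (\<forall>f xs. length xs = fun_arity C f \<and> set xs \<subseteq> U \<longrightarrow> fun_int C f xs \<in> U) \<and>
     (\<forall>(p :: ('f, 'r, nat) fm) s. wf_fm C p \<and> range s \<subseteq> U \<longrightarrow> sat C U s p = sat C UNIV s p)"

definition aut :: "('f, 'r, 'm) struct \<Rightarrow> ('m \<Rightarrow> 'm) set" where
  "aut C = {g. bij g \<and>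
     (\<forall>f xs. length xs = fun_arity C f \<longrightarrow> g (fun_int C f xs) = fun_int C f (map g xs)) \<and>
     (\<forall>r xs. length xs = rel_arity C r \<longrightarrow> rel_int C r (map g xs) = rel_int C r xs)}"

section \<open>Tuples, types and the monster model\<close>

text \<open>A tuple indexed by \<open>D\<close> is a partial map with domain \<open>D\<close>, its set of entries is its range.
  \<open>act\<close> applies a function to every entry.

  The degree of saturation is a cardinal \<open>\<kappa>\<close> given, as in the cardinal library, by a well-order.
  The small ordinals are the members of its field: \<open>\<alpha> \<in> Field \<kappa>\<close> stands for the order type of
  \<open>underS \<kappa> \<alpha>\<close>, and these are exactly the ordinals below \<open>\<kappa>\<close>.\<close>

definition act :: "('a \<Rightarrow> 'b) \<Rightarrow> ('i \<rightharpoonup> 'a) \<Rightarrow> ('i \<rightharpoonup> 'b)" where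
  "act f a = map_option f \<circ> a"

text \<open>Formulas over tuple variables \<open>TVar i\<close> and names \<open>Param m\<close> of elements of the structure.
  \<open>Aux\<close> supplies infinitely many further variables for quantification.\<close>

datatype ('i, 'm) var = TVar 'i | Param 'm | Aux nat

primrec val :: "('i \<rightharpoonup> 'm) \<Rightarrow> ('i, 'm) var \<Rightarrow> 'm" where
  "val c (TVar i) = the (c i)"
| "val c (Param m) = m"
| "val c (Aux n) = undefined"

definition fmls ::
  "('f, 'r, 'm) struct \<Rightarrow> 'i set \<Rightarrow> 'm set \<Rightarrow> ('f, 'r, ('i, 'm) var) fm set" where
  "fmls C D A = {p. wf_fm C p \<and> fv p \<subseteq> TVar ` D \<union> Param ` A}"

definition holds ::
  "('f, 'r, 'm) struct \<Rightarrow> ('i \<rightharpoonup> 'm) \<Rightarrow> ('f, 'r, ('i, 'm) var) fm \<Rightarrow> bool" where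
  "holds C c p \<longleftrightarrow> sat C UNIV (val c) p"

definition solutions ::
  "('f, 'r, 'm) struct \<Rightarrow> 'i set \<Rightarrow> ('f, 'r, ('i, 'm) var) fm set \<Rightarrow> ('i \<rightharpoonup> 'm) set" where
  "solutions C D S = {c. dom c = D \<and> (\<forall>p\<in>S. holds C c p)}"

text \<open>Partial types are consistent and have a small set of parameters.\<close>

definition partial_type ::
  "('f, 'r, 'm) struct \<Rightarrow> 'k rel \<Rightarrow> 'i set \<Rightarrow> ('f, 'r, ('i, 'm) var) fm set \<Rightarrow> bool" where
  "partial_type C \<kappa> D S \<longleftrightarrow>
     (\<exists>A. |A| <o \<kappa> \<and> S \<subseteq> fmls C D A) \<and>
     (\<forall>S0\<subseteq>S. finite S0 \<longrightarrow> solutions C D S0 \<noteq> {})"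

definition tp ::
  "('f, 'r, 'm) struct \<Rightarrow> 'm set \<Rightarrow> ('i \<rightharpoonup> 'm) \<Rightarrow> ('f, 'r, ('i, 'm) var) fm set" where
  "tp C A c = {p \<in> fmls C (dom c) A. holds C c p}"

text \<open>A set of elements as a tuple enumerated by itself.\<close>

definition self_tuple :: "'m set \<Rightarrow> ('m \<rightharpoonup> 'm)" where
  "self_tuple A = Some |` A"

definition saturated :: "('f, 'r, 'm) struct \<Rightarrow> 'k rel \<Rightarrow> bool" where
  "saturated C \<kappa> \<longleftrightarrow>
     (\<forall>S :: ('f, 'r, (unit, 'm) var) fm set.
        partial_type C \<kappa> UNIV S \<longrightarrow> solutions C UNIV S \<noteq> {})"

definition strongly_homogeneous :: "('f, 'r, 'm) struct \<Rightarrow> 'k rel \<Rightarrow> bool" where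
  "strongly_homogeneous C \<kappa> \<longleftrightarrow>
     (\<forall>A f. |A| <o \<kappa> \<and> tp C {} (act f (self_tuple A)) = tp C {} (self_tuple A)
        \<longrightarrow> (\<exists>g\<in>aut C. \<forall>a\<in>A. g a = f a))"

text \<open>\<open>T\<close> is complete (and closed under consequence) and \<open>C\<close> is a monster model of it.\<close>

definition monster_model ::
  "('f, 'r, nat) fm set \<Rightarrow> ('f, 'r, 'm) struct \<Rightarrow> 'k rel \<Rightarrow> bool" where
  "monster_model T C \<kappa> \<longleftrightarrow>
     (\<forall>p\<in>T. wf_fm C p \<and> fv p = {}) \<and>
     (\<forall>p. wf_fm C p \<and> fv p = {} \<longrightarrow> p \<in> T \<or> Neg p \<in> T) \<and>
     (\<forall>p\<in>T. \<forall>s. sat C UNIV s p) \<and>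
     Card_order \<kappa> \<and> natLeq <o \<kappa> \<and> |UNIV :: 'f set| <o \<kappa> \<and> |UNIV :: 'r set| <o \<kappa> \<and>
     saturated C \<kappa> \<and> strongly_homogeneous C \<kappa>"

text \<open>As usual, a small model of the complete theory is an elementary submodel of the monster.\<close>

definition small_model :: "('f, 'r, 'm) struct \<Rightarrow> 'k rel \<Rightarrow> 'm set \<Rightarrow> bool" where
  "small_model C \<kappa> M \<longleftrightarrow> elementary_submodel C M \<and> |M| <o \<kappa>"

section \<open>Hyperimaginaries\<close>

definition definable_rel ::
  "('f, 'r, 'm) struct \<Rightarrow> 'k set \<Rightarrow> ('f, 'r, ('k + 'k, 'm) var) fm set
    \<Rightarrow> ('k \<rightharpoonup> 'm) rel" where
  "definable_rel C D E =
     {(a, b). dom a = D \<and> dom b = D \<and> case_sum a b \<in> solutions C (D <+> D) E}"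

definition hyperimaginary ::
  "('f, 'r, 'm) struct \<Rightarrow> 'k rel \<Rightarrow> ('k \<rightharpoonup> 'm) set \<Rightarrow> bool" where
  "hyperimaginary C \<kappa> e \<longleftrightarrow>
     (\<exists>\<alpha>\<in>Field \<kappa>. \<exists>E \<subseteq> fmls C (underS \<kappa> \<alpha> <+> underS \<kappa> \<alpha>) {}.
        equiv {a. dom a = underS \<kappa> \<alpha>} (definable_rel C (underS \<kappa> \<alpha>) E) \<and>
        e \<in> {a. dom a = underS \<kappa> \<alpha>} // definable_rel C (underS \<kappa> \<alpha>) E)"

definition aut_over :: "('f, 'r, 'm) struct \<Rightarrow> ('k \<rightharpoonup> 'm) set \<Rightarrow> ('m \<Rightarrow> 'm) set" where
  "aut_over C e = {f \<in> aut C. act f ` e = e}"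

definition in_dcl :: "('f, 'r, 'm) struct \<Rightarrow> ('k \<rightharpoonup> 'm) set \<Rightarrow> 'm set \<Rightarrow> bool" where
  "in_dcl C e A \<longleftrightarrow> (\<forall>f\<in>aut C. (\<forall>a\<in>A. f a = a) \<longrightarrow> act f ` e = e)"

section \<open>Quotient topologies\<close>

definition quotient_topology :: "'a topology \<Rightarrow> ('a \<Rightarrow> 'b) \<Rightarrow> 'b topology" where
  "quotient_topology X q =
     topology (\<lambda>U. U \<subseteq> q ` topspace X \<and> openin X {x \<in> topspace X. q x \<in> U})"

lemma openin_quotient_topology:
  "openin (quotient_topology X q) U \<longleftrightarrow>
     U \<subseteq> q ` topspace X \<and> openin X {x \<in> topspace X. q x \<in> U}"
proof -
  have "istopology (\<lambda>U. U \<subseteq> q ` topspace X \<and> openin X {x \<in> topspace X. q x \<in> U})"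
    unfolding istopology_def
  proof (intro conjI allI impI)
    fix S T
    assume "S \<subseteq> q ` topspace X \<and> openin X {x \<in> topspace X. q x \<in> S}"
      and "T \<subseteq> q ` topspace X \<and> openin X {x \<in> topspace X. q x \<in> T}"
    moreover have "{x \<in> topspace X. q x \<in> S \<inter> T} =
        {x \<in> topspace X. q x \<in> S} \<inter> {x \<in> topspace X. q x \<in> T}" by auto
    ultimately show "S \<inter> T \<subseteq> q ` topspace X" "openin X {x \<in> topspace X. q x \<in> S \<inter> T}"
      by auto
  next
    fix K assume K: "\<forall>S\<in>K. S \<subseteq> q ` topspace X \<and> openin X {x \<in> topspace X. q x \<in> S}"
    have "{x \<in> topspace X. q x \<in> \<Union>K} = (\<Union>S\<in>K. {x \<in> topspace X. q x \<in> S})" by auto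
    with K show "\<Union>K \<subseteq> q ` topspace X" "openin X {x \<in> topspace X. q x \<in> \<Union>K}"
      by (auto intro: openin_Union)
  qed
  then show ?thesis
    by (simp add: quotient_topology_def)
qed

definition logic_topology :: "'p set set \<Rightarrow> 'p set topology" where
  "logic_topology S = topology_generated_by {{p \<in> S. \<phi> \<in> p} | \<phi>. True}"

text \<open>The quotient topology on \<open>G Mod H\<close> under the map \<open>t g \<mapsto> [g]\<close>, where \<open>t\<close> assigns types to
  the elements of \<open>G\<close>; it is used only where this map is well defined.\<close>

definition type_quotient_topology ::
  "('g, 'z) monoid_scheme \<Rightarrow> 'g set \<Rightarrow> ('g \<Rightarrow> 'p set) \<Rightarrow> 'g set topology" where
  "type_quotient_topology G H t =
     quotient_topology (logic_topology (t ` carrier G))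
       (\<lambda>p. the_elem {H #>\<^bsub>G\<^esub> g | g. g \<in> carrier G \<and> t g = p})"

section \<open>Galois groups of the theory\<close>

definition Aut_group :: "('f, 'r, 'm) struct \<Rightarrow> ('k \<rightharpoonup> 'm) set \<Rightarrow> ('m \<Rightarrow> 'm) monoid" where
  "Aut_group C e = (BijGroup UNIV)\<lparr>carrier := aut_over C e\<rparr>"

definition Autf_L ::
  "('f, 'r, 'm) struct \<Rightarrow> 'k rel \<Rightarrow> ('k \<rightharpoonup> 'm) set \<Rightarrow> ('m \<Rightarrow> 'm) set" where
  "Autf_L C \<kappa> e = generate (Aut_group C e)
     {f \<in> aut_over C e. \<exists>M. small_model C \<kappa> M \<and> in_dcl C e M \<and> (\<forall>m\<in>M. f m = m)}"

definition Gal_L ::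
  "('f, 'r, 'm) struct \<Rightarrow> 'k rel \<Rightarrow> ('k \<rightharpoonup> 'm) set \<Rightarrow> ('m \<Rightarrow> 'm) set monoid" where
  "Gal_L C \<kappa> e = Aut_group C e Mod Autf_L C \<kappa> e"

text \<open>The topology does not depend on the choice of the small model \<open>M\<close> with \<open>e\<close> in its
  definable closure, which is kept as an explicit argument here and below.\<close>

definition Gal_L_topology ::
  "('f, 'r, 'm) struct \<Rightarrow> 'k rel \<Rightarrow> ('k \<rightharpoonup> 'm) set \<Rightarrow> 'm set \<Rightarrow> ('m \<Rightarrow> 'm) set topology" where
  "Gal_L_topology C \<kappa> e M =
     type_quotient_topology (Aut_group C e) (Autf_L C \<kappa> e) (\<lambda>f. tp C M (act f (self_tuple M)))"

definition Autf_KP ::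
  "('f, 'r, 'm) struct \<Rightarrow> 'k rel \<Rightarrow> ('k \<rightharpoonup> 'm) set \<Rightarrow> 'm set \<Rightarrow> ('m \<Rightarrow> 'm) set" where
  "Autf_KP C \<kappa> e M =
     {f \<in> aut_over C e. Autf_L C \<kappa> e #>\<^bsub>Aut_group C e\<^esub> f
        \<in> Gal_L_topology C \<kappa> e M closure_of {\<one>\<^bsub>Gal_L C \<kappa> e\<^esub>}}"

definition Autf_S ::
  "('f, 'r, 'm) struct \<Rightarrow> 'k rel \<Rightarrow> ('k \<rightharpoonup> 'm) set \<Rightarrow> 'm set \<Rightarrow> ('m \<Rightarrow> 'm) set" where
  "Autf_S C \<kappa> e M =
     {f \<in> aut_over C e. Autf_L C \<kappa> e #>\<^bsub>Aut_group C e\<^esub> f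
        \<in> connected_component_of_set (Gal_L_topology C \<kappa> e M) \<one>\<^bsub>Gal_L C \<kappa> e\<^esub>}"

section \<open>Relativization to the solution set of a partial type\<close>

text \<open>Below, \<open>S\<close> is the solution set of the partial type, a set of tuples.\<close>

definition invariant_over ::
  "('f, 'r, 'm) struct \<Rightarrow> ('k \<rightharpoonup> 'm) set \<Rightarrow> 'k set \<Rightarrow> ('k \<rightharpoonup> 'm) set \<Rightarrow> bool" where
  "invariant_over C e D S \<longleftrightarrow>
     (\<forall>f\<in>aut_over C e. \<forall>b. dom b = D \<longrightarrow> (b \<in> S \<longleftrightarrow> act f b \<in> S))"

text \<open>Small tuples of realizations are tuples of tuples; \<open>flat\<close> turns them into a tuple of
  elements.\<close>

definition real_tuples :: "'k rel \<Rightarrow> ('k \<rightharpoonup> 'm) set \<Rightarrow> ('k \<rightharpoonup> ('k \<rightharpoonup> 'm)) set" where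
  "real_tuples \<kappa> S = {b. (\<exists>\<alpha>\<in>Field \<kappa>. dom b = underS \<kappa> \<alpha>) \<and> ran b \<subseteq> S}"

definition flat :: "('i \<rightharpoonup> ('k \<rightharpoonup> 'm)) \<Rightarrow> ('i \<times> 'k \<rightharpoonup> 'm)" where
  "flat b = (\<lambda>(i, j). Option.bind (b i) (\<lambda>c. c j))"

definition Aut_rel ::
  "('f, 'r, 'm) struct \<Rightarrow> ('k \<rightharpoonup> 'm) set \<Rightarrow> ('k \<rightharpoonup> 'm) set \<Rightarrow> (('k \<rightharpoonup> 'm) \<Rightarrow> ('k \<rightharpoonup> 'm)) set" where
  "Aut_rel C e S = (\<lambda>f. restrict (act f) S) ` aut_over C e"

definition Aut_rel_group ::
  "('f, 'r, 'm) struct \<Rightarrow> ('k \<rightharpoonup> 'm) set \<Rightarrow> ('k \<rightharpoonup> 'm) set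
    \<Rightarrow> (('k \<rightharpoonup> 'm) \<Rightarrow> ('k \<rightharpoonup> 'm)) monoid" where
  "Aut_rel_group C e S = (BijGroup S)\<lparr>carrier := Aut_rel C e S\<rparr>"

text \<open>Equality of strong types, for the group \<open>K\<close> of Lascar, KP or Shelah strong automorphisms.\<close>

definition strong_eq ::
  "('m \<Rightarrow> 'm) set \<Rightarrow> ('i \<rightharpoonup> ('k \<rightharpoonup> 'm)) \<Rightarrow> ('i \<rightharpoonup> ('k \<rightharpoonup> 'm)) \<Rightarrow> bool" where
  "strong_eq K c d \<longleftrightarrow> (\<exists>f\<in>K. act (act f) c = d)"

definition Autf_rel ::
  "('f, 'r, 'm) struct \<Rightarrow> 'k rel \<Rightarrow> ('k \<rightharpoonup> 'm) set \<Rightarrow> ('k \<rightharpoonup> 'm) set \<Rightarrow> ('m \<Rightarrow> 'm) set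
    \<Rightarrow> (('k \<rightharpoonup> 'm) \<Rightarrow> ('k \<rightharpoonup> 'm)) set" where
  "Autf_rel C \<kappa> e S K = {\<sigma> \<in> Aut_rel C e S. \<forall>b\<in>real_tuples \<kappa> S. strong_eq K b (act \<sigma> b)}"

abbreviation Autf_L_rel where
  "Autf_L_rel C \<kappa> e S \<equiv> Autf_rel C \<kappa> e S (Autf_L C \<kappa> e)"

abbreviation Autf_KP_rel where
  "Autf_KP_rel C \<kappa> e M S \<equiv> Autf_rel C \<kappa> e S (Autf_KP C \<kappa> e M)"

abbreviation Autf_S_rel where
  "Autf_S_rel C \<kappa> e M S \<equiv> Autf_rel C \<kappa> e S (Autf_S C \<kappa> e M)"

definition lascar_tuple ::
  "('f, 'r, 'm) struct \<Rightarrow> 'k rel \<Rightarrow> ('k \<rightharpoonup> 'm) set \<Rightarrow> ('k \<rightharpoonup> 'm) set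
    \<Rightarrow> ('k \<rightharpoonup> ('k \<rightharpoonup> 'm)) \<Rightarrow> bool" where
  "lascar_tuple C \<kappa> e S b \<longleftrightarrow> b \<in> real_tuples \<kappa> S \<and>
     Autf_L_rel C \<kappa> e S = {\<sigma> \<in> Aut_rel C e S. strong_eq (Autf_L C \<kappa> e) b (act \<sigma> b)}"

definition Gal_L_rel ::
  "('f, 'r, 'm) struct \<Rightarrow> 'k rel \<Rightarrow> ('k \<rightharpoonup> 'm) set \<Rightarrow> ('k \<rightharpoonup> 'm) set
    \<Rightarrow> (('k \<rightharpoonup> 'm) \<Rightarrow> ('k \<rightharpoonup> 'm)) set monoid" where
  "Gal_L_rel C \<kappa> e S = Aut_rel_group C e S Mod Autf_L_rel C \<kappa> e S"

text \<open>Again the topology is independent of the Lascar tuple \<open>b\<close> with \<open>e\<close> in its definable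
  closure.\<close>

definition Gal_L_rel_topology ::
  "('f, 'r, 'm) struct \<Rightarrow> 'k rel \<Rightarrow> ('k \<rightharpoonup> 'm) set \<Rightarrow> ('k \<rightharpoonup> 'm) set
    \<Rightarrow> ('k \<rightharpoonup> ('k \<rightharpoonup> 'm)) \<Rightarrow> (('k \<rightharpoonup> 'm) \<Rightarrow> ('k \<rightharpoonup> 'm)) set topology" where
  "Gal_L_rel_topology C \<kappa> e S b =
     type_quotient_topology (Aut_rel_group C e S) (Autf_L_rel C \<kappa> e S)
       (\<lambda>\<sigma>. tp C (ran (flat b)) (flat (act \<sigma> b)))"

definition Gal_c_rel ::
  "('f, 'r, 'm) struct \<Rightarrow> 'k rel \<Rightarrow> ('k \<rightharpoonup> 'm) set \<Rightarrow> ('k \<rightharpoonup> 'm) set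
    \<Rightarrow> ('k \<rightharpoonup> ('k \<rightharpoonup> 'm)) \<Rightarrow> (('k \<rightharpoonup> 'm) \<Rightarrow> ('k \<rightharpoonup> 'm)) set set" where
  "Gal_c_rel C \<kappa> e S b = Gal_L_rel_topology C \<kappa> e S b closure_of {\<one>\<^bsub>Gal_L_rel C \<kappa> e S\<^esub>}"

definition Gal_0_rel ::
  "('f, 'r, 'm) struct \<Rightarrow> 'k rel \<Rightarrow> ('k \<rightharpoonup> 'm) set \<Rightarrow> ('k \<rightharpoonup> 'm) set
    \<Rightarrow> ('k \<rightharpoonup> ('k \<rightharpoonup> 'm)) \<Rightarrow> (('k \<rightharpoonup> 'm) \<Rightarrow> ('k \<rightharpoonup> 'm)) set set" where
  "Gal_0_rel C \<kappa> e S b =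
     connected_component_of_set (Gal_L_rel_topology C \<kappa> e S b) \<one>\<^bsub>Gal_L_rel C \<kappa> e S\<^esub>"

end

theory Submission
  imports Defs "HOL-Analysis.Abstract_Topological_Spaces"
begin

text \<open>
  Write \<open>G\<close> for the group of automorphisms fixing \<open>e\<close>, \<open>N\<close> for its subgroup of Lascar strong
  automorphisms, and \<open>N'\<close> for the set of those \<open>f\<close> in \<open>G\<close> whose restriction to the solution set
  belongs to the relativized Lascar group. Restriction identifies the relativized Galois group
  with \<open>G / N'\<close>. So there are two quotients of the same group, \<open>G / N\<close> and \<open>G / N'\<close> with
  \<open>N \<subseteq> N'\<close>, and the theorem computes the closure of the identity and the connected component of
  the identity in the second quotient from those in the first.

  \<^bold>\<open>The topologies.\<close> A set of automorphisms corresponds to a closed subset of \<open>G / N\<close> iff it is a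
  union of \<open>N\<close>-cosets and is type-definable over the model \<open>M\<close>, that is, defined by a set of
  formulas about \<open>(f m)\<close>, \<open>m \<in> M\<close>, with parameters in \<open>M\<close>; for \<open>G / N'\<close> the Lascar tuple replaces
  \<open>M\<close> (lemma \<open>type_quotient_topology_pullback\<close>). By saturation and homogeneity, families of such
  conditions on one or two automorphisms obey the compactness theorem (lemma \<open>compactness\<close>).
  Consequently a union of \<open>N\<close>-cosets that is type-definable over \<^emph>\<open>any\<close> small set is type-definable
  over \<open>M\<close>: it is a compact union of fibres in a space whose points are separated by formulas
  (lemmas \<open>type_definable_projection\<close> and \<open>base_closed_projection\<close>). From this it follows that
  the closed sets of \<open>G / N'\<close> are precisely the \<open>N'\<close>-invariant closed sets of \<open>G / N\<close>, that
  translations and inversion are continuous, that the product of two closed sets is closed, and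
  that the quotients are compact and normal (lemma \<open>base_group_topology\<close>).

  \<^bold>\<open>The closure of the identity.\<close> Let \<open>H\<close> be the closure of the identity for \<open>G / N\<close>, a normal
  subgroup. For a tuple \<open>c\<close> of realizations, the automorphisms moving \<open>c\<close> in the same way as some
  element of \<open>H\<close> form the set \<open>H Stab(c)\<close>. It is closed, being a product of \<open>H\<close> with a
  type-definable set, and it is \<open>N'\<close>-invariant; hence it contains the closure of the identity for
  \<open>G / N'\<close>. Conversely, if \<open>f\<close> moves the Lascar tuple like \<open>h \<in> H\<close>, then \<open>f\<close> lies in \<open>h N'\<close>.

  \<^bold>\<open>The connected component.\<close> In a compact normal group topology the component of the identity is
  the intersection of the open subgroups (lemma \<open>component_eq\<close>). If \<open>f\<close> is in the component for
  \<open>G / N'\<close> and \<open>V\<close> is an open subgroup for \<open>G / N\<close>, then \<open>V N'\<close> is open and closed for \<open>G / N'\<close>, so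
  \<open>f \<in> V N' \<subseteq> V H Stab(c)\<close> for every tuple \<open>c\<close>. Compactness exchanges the intersection over \<open>V\<close>
  with the product by the closed set \<open>H Stab(c)\<close> (lemma \<open>component_coset\<close>), and \<open>f\<close> moves \<open>c\<close> like
  an element of the component for \<open>G / N\<close>. The converse inclusion holds because the projection from
  \<open>G / N\<close> to \<open>G / N'\<close> is continuous.
\<close>

section \<open>Substitution and quantification in formulas\<close>

lemma eval_tm_cong:
  "(\<And>v. v \<in> fv_tm t \<Longrightarrow> s v = s' v) \<Longrightarrow> eval_tm C s t = eval_tm C s' t"
proof (induction t)
  case (App f ts)
  then have "map (eval_tm C s) ts = map (eval_tm C s') ts"
    by (intro map_cong[OF refl] App.IH) auto
  then show ?case
    by (simp only: eval_tm.simps)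
qed simp

lemma sat_cong:
  "(\<And>v. v \<in> fv p \<Longrightarrow> s v = s' v) \<Longrightarrow> sat C U s p = sat C U s' p"
proof (induction p arbitrary: s s')
  case (Eq t u)
  then show ?case
    using eval_tm_cong[of t s s' C] eval_tm_cong[of u s s' C] by auto
next
  case (Rel r ts)
  then have "map (eval_tm C s) ts = map (eval_tm C s') ts"
    by (auto intro!: eval_tm_cong)
  then show ?case
    by (simp only: sat.simps)
next
  case (Ex v p)
  have "sat C U (s(v := x)) p = sat C U (s'(v := x)) p" for x
    using Ex.prems by (intro Ex.IH) auto
  then show ?case
    by simp
next
  case (Neg p)
  have "sat C U s p = sat C U s' p"
    using Neg.prems by (intro Neg.IH) auto
  then show ?case
    by simp
next
  case (Conj p1 p2)
  have "sat C U s p1 = sat C U s' p1" "sat C U s p2 = sat C U s' p2"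
    using Conj.prems by (intro Conj.IH; auto)+
  then show ?case
    by simp
qed

lemma finite_fv_tm: "finite (fv_tm t)"
  by (induction t) auto

lemma finite_fv: "finite (fv p)"
  by (induction p) (auto simp: finite_fv_tm)

primrec rename_tm :: "('v \<Rightarrow> 'w) \<Rightarrow> ('f, 'v) tm \<Rightarrow> ('f, 'w) tm" where
  "rename_tm r (Var v) = Var (r v)"
| "rename_tm r (App f ts) = App f (map (rename_tm r) ts)"

lemma rename_tm_simps:
  "wf_tm C (rename_tm r t) = wf_tm C t"
  "fv_tm (rename_tm r t) = r ` fv_tm t"
  "eval_tm C s (rename_tm r t) = eval_tm C (\<lambda>v. s (r v)) t"
proof -
  show "wf_tm C (rename_tm r t) = wf_tm C t" "fv_tm (rename_tm r t) = r ` fv_tm t"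
    by (induction t) (auto simp: list_all_iff)
  show "eval_tm C s (rename_tm r t) = eval_tm C (\<lambda>v. s (r v)) t"
    by (induction t) (auto intro!: arg_cong[where f = "fun_int C _"])
qed

text \<open>Substituting variables for free variables is capture-avoiding only if bound variables
  are renamed along the way; a fresh one exists because only finitely many are in use.\<close>

lemma rename_exists:
  fixes p :: "('f, 'r, 'v) fm" and r :: "'v \<Rightarrow> 'w"
  assumes inf: "infinite (UNIV :: 'w set)" and "wf_fm C p"
  shows "\<exists>q. wf_fm C q \<and> fv q \<subseteq> r ` fv p \<and> (\<forall>U s. sat C U s q = sat C U (\<lambda>v. s (r v)) p)"
  using assms(2)
proof (induction p arbitrary: r)
  case (Eq t u)
  then show ?case
    by (intro exI[of _ "Eq (rename_tm r t) (rename_tm r u)"]) (auto simp: rename_tm_simps comp_def)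
next
  case (Rel R ts)
  then show ?case
    by (intro exI[of _ "Rel R (map (rename_tm r) ts)"])
      (auto simp: rename_tm_simps list_all_iff comp_def)
next
  case (Neg p)
  then obtain q where "wf_fm C q" "fv q \<subseteq> r ` fv p" "\<forall>U s. sat C U s q = sat C U (\<lambda>v. s (r v)) p"
    by (metis wf_fm.simps(3))
  then show ?case
    by (intro exI[of _ "Neg q"]) auto
next
  case (Conj p1 p2)
  from Conj.prems Conj.IH(1)[of r] obtain q1 where
    "wf_fm C q1" "fv q1 \<subseteq> r ` fv p1" "\<forall>U s. sat C U s q1 = sat C U (\<lambda>v. s (r v)) p1" by auto
  moreover from Conj.prems Conj.IH(2)[of r] obtain q2 where
    "wf_fm C q2" "fv q2 \<subseteq> r ` fv p2" "\<forall>U s. sat C U s q2 = sat C U (\<lambda>v. s (r v)) p2" by auto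
  ultimately have "wf_fm C (Conj q1 q2)" "fv (Conj q1 q2) \<subseteq> r ` fv (Conj p1 p2)"
    "\<And>U s. sat C U s (Conj q1 q2) = sat C U (\<lambda>v. s (r v)) (Conj p1 p2)"
    by (simp, fastforce simp only: fv.simps image_Un, simp)
  then show ?case
    by blast
next
  case (Ex v p)
  have "finite (r ` fv p)"
    by (intro finite_imageI finite_fv)
  from ex_new_if_finite[OF inf this] obtain w where w: "w \<notin> r ` fv p" ..
  from Ex.prems Ex.IH[of "r(v := w)"] obtain q where q: "wf_fm C q"
    "fv q \<subseteq> (r(v := w)) ` fv p" "\<And>U s. sat C U s q = sat C U (\<lambda>u. s ((r(v := w)) u)) p"
    unfolding wf_fm.simps by blast
  have "sat C U (s(w := x)) q = sat C U ((\<lambda>u. s (r u))(v := x)) p" for U s x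
    unfolding q(3) by (rule sat_cong) (use w in auto)
  moreover have "fv q - {w} \<subseteq> r ` (fv p - {v})"
    using q(2) w by (auto split: if_splits)
  ultimately show ?case
    using q(1) by (intro exI[of _ "Ex w q"]) auto
qed

lemma ex_vars_exists:
  assumes "finite W" "wf_fm C p"
  shows "\<exists>q. wf_fm C q \<and> fv q = fv p - W \<and>
    (\<forall>s. sat C UNIV s q \<longleftrightarrow> (\<exists>s'. (\<forall>v. v \<notin> W \<longrightarrow> s' v = s v) \<and> sat C UNIV s' p))"
  using assms(1)
proof (induction W)
  case empty
  have "(\<exists>s'. (\<forall>v. s' v = s v) \<and> sat C UNIV s' p) = sat C UNIV s p" for s
    by (metis ext)
  then show ?case
    using assms(2) by (intro exI[of _ p]) auto
next
  case (insert w W)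
  then obtain q where q: "wf_fm C q" "fv q = fv p - W"
    "\<And>s. sat C UNIV s q \<longleftrightarrow> (\<exists>s'. (\<forall>v. v \<notin> W \<longrightarrow> s' v = s v) \<and> sat C UNIV s' p)" by blast
  have "(\<exists>x s'. (\<forall>v. v \<notin> W \<longrightarrow> s' v = (s(w := x)) v) \<and> sat C UNIV s' p) \<longleftrightarrow>
        (\<exists>s'. (\<forall>v. v \<notin> insert w W \<longrightarrow> s' v = s v) \<and> sat C UNIV s' p)" for s
  proof (intro iffI; elim exE conjE)
    fix s' assume "\<forall>v. v \<notin> insert w W \<longrightarrow> s' v = s v" "sat C UNIV s' p"
    then show "\<exists>x s'. (\<forall>v. v \<notin> W \<longrightarrow> s' v = (s(w := x)) v) \<and> sat C UNIV s' p"
      by (intro exI[of _ "s' w"] exI[of _ s']) auto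
  next
    fix x s' assume "\<forall>v. v \<notin> W \<longrightarrow> s' v = (s(w := x)) v" "sat C UNIV s' p"
    then show "\<exists>s'. (\<forall>v. v \<notin> insert w W \<longrightarrow> s' v = s v) \<and> sat C UNIV s' p"
      by (intro exI[of _ s']) simp
  qed
  moreover have "sat C UNIV s (Ex w q) \<longleftrightarrow>
      (\<exists>x s'. (\<forall>v. v \<notin> W \<longrightarrow> s' v = (s(w := x)) v) \<and> sat C UNIV s' p)" for s
    by (simp only: sat.simps q(3) bex_UNIV)
  moreover have "wf_fm C (Ex w q)" "fv (Ex w q) = fv p - insert w W"
    using q(1,2) by auto
  ultimately show ?case
    by (intro exI[of _ "Ex w q"]) (simp only: simp_thms)
qed

lemma conj_exists:
  assumes "finite \<Phi>" "\<And>p. p \<in> \<Phi> \<Longrightarrow> wf_fm C p"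
  shows "\<exists>q :: ('f, 'r, 'v) fm. wf_fm C q \<and> fv q \<subseteq> \<Union> (fv ` \<Phi>) \<and>
    (\<forall>s. sat C UNIV s q \<longleftrightarrow> (\<forall>p\<in>\<Phi>. sat C UNIV s p))"
  using assms
proof (induction \<Phi>)
  case empty
  show ?case
    by (intro exI[of _ "Ex undefined (Eq (Var undefined) (Var undefined))"]) simp
next
  case (insert p \<Phi>)
  then obtain q where q: "wf_fm C q" "fv q \<subseteq> \<Union> (fv ` \<Phi>)"
    "\<And>s. sat C UNIV s q \<longleftrightarrow> (\<forall>p\<in>\<Phi>. sat C UNIV s p)" by auto
  have "wf_fm C (Conj p q)" using q(1) insert.prems by simp
  moreover have "fv (Conj p q) \<subseteq> \<Union> (fv ` insert p \<Phi>)" using q(2) by auto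
  moreover have "sat C UNIV s (Conj p q) \<longleftrightarrow> (\<forall>p\<in>insert p \<Phi>. sat C UNIV s p)" for s
    using q(3) by simp
  ultimately show ?case
    by blast
qed

lemma sat_aut:
  fixes C :: "('f, 'r, 'm) struct" and p :: "('f, 'r, 'v) fm"
  assumes "g \<in> aut C" "wf_fm C p"
  shows "sat C (g ` U) (\<lambda>v. g (s v)) p = sat C U s p"
proof -
  have g: "inj g" using assms(1) by (auto simp: aut_def bij_def)
  have tm: "eval_tm C (\<lambda>v. g (s v)) t = g (eval_tm C s t)" if "wf_tm C t" for t :: "('f, 'v) tm" and s
    using that
  proof (induction t)
    case (App f ts)
    then have "map (eval_tm C (\<lambda>v. g (s v))) ts = map g (map (eval_tm C s) ts)"
      by (auto simp: list_all_iff)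
    moreover have "g (fun_int C f (map (eval_tm C s) ts)) = fun_int C f (map g (map (eval_tm C s) ts))"
      using App.prems assms(1) by (simp add: aut_def del: map_map)
    ultimately show ?case
      by (simp only: eval_tm.simps)
  qed simp
  show ?thesis
    using assms(2)
  proof (induction p arbitrary: s)
    case (Eq t u)
    then show ?case using g by (auto simp: tm inj_eq)
  next
    case (Rel R ts)
    then have "map (eval_tm C (\<lambda>v. g (s v))) ts = map g (map (eval_tm C s) ts)"
      by (auto simp: list_all_iff tm)
    moreover have "rel_int C R (map g (map (eval_tm C s) ts)) = rel_int C R (map (eval_tm C s) ts)"
      using Rel.prems assms(1) by (simp add: aut_def del: map_map)
    ultimately show ?case
      by (simp only: sat.simps)
  next
    case (Ex v p)
    have "(\<lambda>u. g (s u))(v := g x) = (\<lambda>u. g ((s(v := x)) u))" for x by auto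
    then have "sat C (g ` U) ((\<lambda>u. g (s u))(v := g x)) p = sat C U (s(v := x)) p" for x
      using Ex.IH[of "s(v := x)"] Ex.prems by (simp only: wf_fm.simps)
    then show ?case by simp
  qed auto
qed

lemma sat_aut_UNIV:
  assumes "g \<in> aut C" "wf_fm C p"
  shows "sat C UNIV (\<lambda>v. g (s v)) p = sat C UNIV s p"
proof -
  have "g ` UNIV = UNIV" using assms(1) by (auto simp: aut_def bij_def)
  then show ?thesis using sat_aut[OF assms, of UNIV s] by simp
qed

lemma inj_Aux: "inj Aux"
  by (simp add: inj_on_def)

lemma infinite_UNIV_var: "infinite (UNIV :: ('i, 'm) var set)"
proof
  assume "finite (UNIV :: ('i, 'm) var set)"
  then have "finite (range (Aux :: nat \<Rightarrow> ('i, 'm) var))"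
    by (rule finite_subset[rotated]) simp
  then show False
    using finite_imageD[OF _ inj_Aux] by simp
qed

section \<open>Realizing small types in many variables\<close>

lemma small_Un:
  assumes "Card_order \<kappa>" "natLeq <o \<kappa>" "|A| <o \<kappa>" "|B| <o \<kappa>"
  shows "|A \<union> B| <o \<kappa>"
proof -
  have "\<not> finite (Field \<kappa>)"
    using assms(1,2) cinfinite_def cinfinite_mono natLeq_cinfinite ordLess_imp_ordLeq by blast
  then show ?thesis using assms card_of_Un_ordLess_infinite_Field by blast
qed

lemma small_image: "|A| <o \<kappa> \<Longrightarrow> |f ` A| <o \<kappa>"
  using card_of_image ordLeq_ordLess_trans by blast

lemma small_subset: "A \<subseteq> B \<Longrightarrow> |B| <o \<kappa> \<Longrightarrow> |A| <o \<kappa>"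
  using card_of_mono1 ordLeq_ordLess_trans by blast

definition fin_sat :: "('f, 'r, 'm) struct \<Rightarrow> ('f, 'r, 'v) fm set \<Rightarrow> ('v \<rightharpoonup> 'm) \<Rightarrow> bool" where
  "fin_sat C \<Phi> c \<longleftrightarrow> (\<forall>\<Phi>0\<subseteq>\<Phi>. finite \<Phi>0 \<longrightarrow> (\<exists>s. c \<subseteq>\<^sub>m Some \<circ> s \<and> (\<forall>p\<in>\<Phi>0. sat C UNIV s p)))"

text \<open>Saturation speaks of one variable: the conditions that \<open>\<Phi>\<close> imposes on \<open>v\<close>, once the
  variables in \<open>dom c\<close> have their values, are that finitely many members of \<open>\<Phi>\<close> can be
  satisfied by choosing the values of the remaining variables.\<close>

lemma fin_sat_extend:
  fixes C :: "('f, 'r, 'm) struct" and \<Phi> :: "('f, 'r, 'v) fm set"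
  assumes sat: "saturated C \<kappa>" and wf: "\<And>p. p \<in> \<Phi> \<Longrightarrow> wf_fm C p"
    and small: "|\<Union> (fv ` \<Phi>)| <o \<kappa>"
    and c: "fin_sat C \<Phi> c" and v: "v \<notin> dom c"
  shows "\<exists>x. fin_sat C \<Phi> (c(v \<mapsto> x))"
proof -
  define r :: "'v \<Rightarrow> (unit, 'm) var" where
    "r = (\<lambda>w. if w = v then TVar () else Param (the (c w)))"
  define ok where "ok = (\<lambda>\<Phi>0 x. \<exists>s. c(v \<mapsto> x) \<subseteq>\<^sub>m Some \<circ> s \<and> (\<forall>p\<in>\<Phi>0. sat C UNIV s p))"
  let ?A = "(\<lambda>w. the (c w)) ` \<Union> (fv ` \<Phi>)"
  have ex: "\<exists>\<psi>\<in>fmls C UNIV ?A. \<forall>d. holds C d \<psi> = ok \<Phi>0 (the (d ()))"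
    if \<Phi>0: "\<Phi>0 \<subseteq> \<Phi>" "finite \<Phi>0" for \<Phi>0
  proof -
    have wf0: "\<And>p. p \<in> \<Phi>0 \<Longrightarrow> wf_fm C p"
      using wf \<Phi>0(1) by blast
    from conj_exists[OF \<Phi>0(2) wf0] obtain q where q: "wf_fm C q" "fv q \<subseteq> \<Union> (fv ` \<Phi>0)"
      "\<And>s. sat C UNIV s q \<longleftrightarrow> (\<forall>p\<in>\<Phi>0. sat C UNIV s p)"
      by blast
    let ?W = "fv q - insert v (dom c)"
    from ex_vars_exists[OF finite_Diff[OF finite_fv] q(1), of q "insert v (dom c)"] obtain q' where q': "wf_fm C q'"
      "fv q' = fv q - ?W" "\<And>s. sat C UNIV s q' \<longleftrightarrow>
         (\<exists>s'. (\<forall>v. v \<notin> ?W \<longrightarrow> s' v = s v) \<and> sat C UNIV s' q)" by blast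
    from rename_exists[OF infinite_UNIV_var q'(1), of r] obtain \<psi> where \<psi>: "wf_fm C \<psi>"
      "fv \<psi> \<subseteq> r ` fv q'" "\<And>s. sat C UNIV s \<psi> = sat C UNIV (\<lambda>v. s (r v)) q'" by blast
    have "\<psi> \<in> fmls C UNIV ?A"
    proof -
      have "fv q' \<subseteq> \<Union> (fv ` \<Phi>)" using q'(2) q(2) \<Phi>0 by auto
      then have "fv \<psi> \<subseteq> r ` \<Union> (fv ` \<Phi>)"
        by (intro order_trans[OF \<psi>(2)] image_mono)
      also have "\<dots> \<subseteq> TVar ` UNIV \<union> Param ` ?A" by (auto simp: r_def)
      finally show ?thesis
        using \<psi>(1) by (simp add: fmls_def)
    qed
    moreover have "holds C d \<psi> = ok \<Phi>0 (the (d ()))" for d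
    proof -
      define s0 where "s0 = val d \<circ> r"
      have s0: "s0 w = (if w = v then the (d ()) else the (c w))" for w
        by (simp add: s0_def r_def)
      have "holds C d \<psi> \<longleftrightarrow> (\<exists>s'. (\<forall>v. v \<notin> ?W \<longrightarrow> s' v = s0 v) \<and> sat C UNIV s' q)"
        by (simp add: holds_def \<psi>(3) q'(3) s0_def)
      also have "\<dots> \<longleftrightarrow> (\<exists>s. c(v \<mapsto> the (d ())) \<subseteq>\<^sub>m Some \<circ> s \<and> sat C UNIV s q)"
      proof (intro iffI; elim exE conjE)
        fix s' assume s': "\<forall>v. v \<notin> ?W \<longrightarrow> s' v = s0 v" "sat C UNIV s' q"
        then have "c(v \<mapsto> the (d ())) \<subseteq>\<^sub>m Some \<circ> s'"
          by (auto simp: map_le_def s0)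
        with s'(2) show "\<exists>s. c(v \<mapsto> the (d ())) \<subseteq>\<^sub>m Some \<circ> s \<and> sat C UNIV s q" by blast
      next
        fix s assume s: "c(v \<mapsto> the (d ())) \<subseteq>\<^sub>m Some \<circ> s" "sat C UNIV s q"
        let ?s = "\<lambda>w. if w \<in> ?W then s w else s0 w"
        have "s w = ?s w" if "w \<in> fv q" for w
        proof (cases "w \<in> ?W")
          case False
          then have "w \<in> dom (c(v \<mapsto> the (d ())))" using that by auto
          then have "(c(v \<mapsto> the (d ()))) w = Some (s w)"
            using s(1) unfolding map_le_def comp_apply by blast
          then have "s w = s0 w" by (cases "w = v") (simp_all add: s0)
          then show ?thesis using False by simp
        qed simp
        then have "sat C UNIV ?s q"
          using s(2) sat_cong[of q s ?s C UNIV] by blast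
        then show "\<exists>s'. (\<forall>v. v \<notin> ?W \<longrightarrow> s' v = s0 v) \<and> sat C UNIV s' q"
          by (intro exI[of _ ?s]) auto
      qed
      also have "\<dots> = ok \<Phi>0 (the (d ()))"
        by (simp add: ok_def q(3))
      finally show ?thesis .
    qed
    ultimately show ?thesis by blast
  qed
  define S where "S = {\<psi> \<in> fmls C UNIV ?A. \<exists>\<Phi>0\<subseteq>\<Phi>. finite \<Phi>0 \<and> (\<forall>d. holds C d \<psi> = ok \<Phi>0 (the (d ())))}"
  have "partial_type C \<kappa> UNIV S"
    unfolding partial_type_def
  proof (intro conjI allI impI)
    show "\<exists>A. |A| <o \<kappa> \<and> S \<subseteq> fmls C UNIV A"
      using small_image[OF small] by (intro exI[of _ ?A]) (auto simp: S_def)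
    fix S0 assume S0: "S0 \<subseteq> S" "finite S0"
    then have "\<forall>\<psi>\<in>S0. \<exists>\<Phi>0\<subseteq>\<Phi>. finite \<Phi>0 \<and> (\<forall>d. holds C d \<psi> = ok \<Phi>0 (the (d ())))"
      by (auto simp: S_def)
    then obtain F where F: "\<And>\<psi>. \<psi> \<in> S0 \<Longrightarrow> F \<psi> \<subseteq> \<Phi> \<and> finite (F \<psi>) \<and>
        (\<forall>d. holds C d \<psi> = ok (F \<psi>) (the (d ())))" by metis
    then have "\<Union> (F ` S0) \<subseteq> \<Phi>" "finite (\<Union> (F ` S0))" using S0 by blast+
    then obtain s where s: "c \<subseteq>\<^sub>m Some \<circ> s" "\<forall>p\<in>\<Union> (F ` S0). sat C UNIV s p"
      using c unfolding fin_sat_def by blast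
    have "c(v \<mapsto> s v) \<subseteq>\<^sub>m Some \<circ> s" using s(1) by (auto simp: map_le_def)
    then have "\<forall>\<psi>\<in>S0. ok (F \<psi>) (s v)" using s(2) unfolding ok_def by blast
    then have "(\<lambda>_. Some (s v)) \<in> solutions C UNIV S0"
      using F by (auto simp: solutions_def)
    then show "solutions C UNIV S0 \<noteq> {}" by blast
  qed
  then obtain d where d: "d \<in> solutions C UNIV S"
    using sat unfolding saturated_def by blast
  have "ok \<Phi>0 (the (d ()))" if \<Phi>0: "\<Phi>0 \<subseteq> \<Phi>" "finite \<Phi>0" for \<Phi>0
  proof -
    from ex[OF \<Phi>0] obtain \<psi> where \<psi>: "\<psi> \<in> fmls C UNIV ?A"
      "\<forall>d. holds C d \<psi> = ok \<Phi>0 (the (d ()))" by blast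
    then have "\<psi> \<in> S" using \<Phi>0 by (auto simp: S_def)
    then show ?thesis using d \<psi> by (auto simp: solutions_def)
  qed
  then show ?thesis unfolding fin_sat_def ok_def by blast
qed

text \<open>A partial assignment that is maximal among those keeping \<open>\<Phi>\<close> finitely satisfiable is total,
  by the previous lemma. Unions of chains are harmless because a formula has finitely many
  variables. The names of parameters are treated as variables with a prescribed value.\<close>

lemma realize:
  fixes C :: "('f, 'r, 'm) struct" and \<Phi> :: "('f, 'r, 'v) fm set"
  assumes "saturated C \<kappa>" "\<And>p. p \<in> \<Phi> \<Longrightarrow> wf_fm C p" "|\<Union> (fv ` \<Phi>)| <o \<kappa>" "fin_sat C \<Phi> c"
  shows "\<exists>s. c \<subseteq>\<^sub>m Some \<circ> s \<and> (\<forall>p\<in>\<Phi>. sat C UNIV s p)"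
proof -
  let ?P = "{d. c \<subseteq>\<^sub>m d \<and> fin_sat C \<Phi> d}"
  have "\<exists>d\<in>?P. \<forall>d'\<in>?P. d \<subseteq>\<^sub>m d' \<longrightarrow> d' = d"
  proof (rule predicate_Zorn[of ?P "(\<subseteq>\<^sub>m)", THEN bexE])
    show "partial_order_on ?P (relation_of (\<subseteq>\<^sub>m) ?P)"
      by (auto simp: partial_order_on_def preorder_on_def refl_on_def trans_def antisym_def
          relation_of_def intro: map_le_trans map_le_antisym)
    fix \<C> assume "\<C> \<in> Chains (relation_of (\<subseteq>\<^sub>m) ?P)"
    then have ch: "\<And>d. d \<in> \<C> \<Longrightarrow> c \<subseteq>\<^sub>m d \<and> fin_sat C \<Phi> d"
      "\<And>d d'. d \<in> \<C> \<Longrightarrow> d' \<in> \<C> \<Longrightarrow> d \<subseteq>\<^sub>m d' \<or> d' \<subseteq>\<^sub>m d"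
      by (auto simp: Chains_def relation_of_def)
    show "\<exists>u\<in>?P. \<forall>a\<in>\<C>. a \<subseteq>\<^sub>m u"
    proof (cases "\<C> = {}")
      case True
      then show ?thesis using assms(4) by (intro bexI[of _ c]) auto
    next
      case False
      then obtain d0 where d0: "d0 \<in> \<C>" by blast
      define u where "u = (\<lambda>w. if \<exists>d\<in>\<C>. w \<in> dom d then (SOME d. d \<in> \<C> \<and> w \<in> dom d) w else None)"
      have u: "u w = d w" if "d \<in> \<C>" "w \<in> dom d" for d w
      proof -
        define d' where "d' = (SOME d. d \<in> \<C> \<and> w \<in> dom d)"
        have d': "d' \<in> \<C> \<and> w \<in> dom d'"
          unfolding d'_def by (rule someI[of _ d]) (use that in auto)
        have "u w = d' w"
          using that unfolding u_def d'_def by (auto simp del: domIff)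
        also have "d' w = d w"
          using ch(2)[of d d'] d' that unfolding map_le_def by metis
        finally show ?thesis .
      qed
      have le: "d \<subseteq>\<^sub>m u" if "d \<in> \<C>" for d
        using u[OF that] by (auto simp: map_le_def)
      have fin: "\<exists>d\<in>\<C>. W \<inter> dom u \<subseteq> dom d" if "finite W" for W
        using that
      proof (induction W)
        case (insert w W)
        then obtain d where d: "d \<in> \<C>" "W \<inter> dom u \<subseteq> dom d" by blast
        show ?case
        proof (cases "w \<in> dom u")
          case True
          then obtain d' where d': "d' \<in> \<C>" "w \<in> dom d'"
            unfolding u_def dom_def by (auto split: if_splits)
          from ch(2)[OF d(1) d'(1)] have "dom d \<subseteq> dom d' \<or> dom d' \<subseteq> dom d"
            using map_le_implies_dom_le by blast
          then show ?thesis
            using d d' by blast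
        qed (use d in auto)
      qed (use d0 in auto)
      have "fin_sat C \<Phi> u"
        unfolding fin_sat_def
      proof (intro allI impI)
        fix \<Phi>0 assume \<Phi>0: "\<Phi>0 \<subseteq> \<Phi>" "finite \<Phi>0"
        then obtain d where d: "d \<in> \<C>" "\<Union> (fv ` \<Phi>0) \<inter> dom u \<subseteq> dom d"
          using fin[of "\<Union> (fv ` \<Phi>0)"] finite_fv by blast
        then obtain s where s: "d \<subseteq>\<^sub>m Some \<circ> s" "\<forall>p\<in>\<Phi>0. sat C UNIV s p"
          using ch(1) \<Phi>0 unfolding fin_sat_def by meson
        \<comment> \<open>\<open>s\<close> agrees with \<open>u\<close> on the variables of \<open>\<Phi>0\<close>; elsewhere it is overwritten.\<close>
        let ?s = "\<lambda>w. if w \<in> dom u then the (u w) else s w"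
        have "?s w = s w" if "w \<in> \<Union> (fv ` \<Phi>0)" for w
        proof (cases "w \<in> dom u")
          case True
          then have "w \<in> dom d" using that d by blast
          then have "u w = d w" "d w = Some (s w)"
            using u[OF d(1)] s(1) unfolding map_le_def comp_apply by blast+
          then show ?thesis using True by simp
        qed auto
        then have "sat C UNIV ?s p = sat C UNIV s p" if "p \<in> \<Phi>0" for p
          by (intro sat_cong) (use that in blast)
        then show "\<exists>s. u \<subseteq>\<^sub>m Some \<circ> s \<and> (\<forall>p\<in>\<Phi>0. sat C UNIV s p)"
          using s(2) by (intro exI[of _ ?s]) (auto simp: map_le_def)
      qed
      moreover have "c \<subseteq>\<^sub>m u" using ch(1)[OF d0] le[OF d0] map_le_trans by blast
      ultimately show ?thesis using le by auto
    qed
  qed blast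
  then obtain d where d: "c \<subseteq>\<^sub>m d" "fin_sat C \<Phi> d"
    "\<And>d'. c \<subseteq>\<^sub>m d' \<Longrightarrow> fin_sat C \<Phi> d' \<Longrightarrow> d \<subseteq>\<^sub>m d' \<Longrightarrow> d' = d" by blast
  have total: "v \<in> dom d" for v
  proof (rule ccontr)
    assume v: "v \<notin> dom d"
    from fin_sat_extend[OF assms(1-3) d(2) v] obtain x where "fin_sat C \<Phi> (d(v \<mapsto> x))" by blast
    moreover have "d \<subseteq>\<^sub>m d(v \<mapsto> x)" using v by (auto simp: map_le_def)
    ultimately have "d(v \<mapsto> x) = d" using d map_le_trans by blast
    then show False using v by (metis domIff fun_upd_same option.distinct(1))
  qed
  let ?s = "\<lambda>v. the (d v)"
  have ds: "Some \<circ> ?s = d" using total by (intro ext) (metis comp_apply domD option.sel)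
  have "sat C UNIV ?s p" if "p \<in> \<Phi>" for p
  proof -
    have "{p} \<subseteq> \<Phi>" "finite {p}" using that by auto
    with d(2) have "\<exists>s. d \<subseteq>\<^sub>m Some \<circ> s \<and> (\<forall>p\<in>{p}. sat C UNIV s p)"
      unfolding fin_sat_def by blast
    then obtain s where "d \<subseteq>\<^sub>m Some \<circ> s" "sat C UNIV s p" by blast
    moreover have "d w = Some (s w)" for w
      using calculation(1) total[of w] unfolding map_le_def comp_apply by blast
    then have "s = ?s" by simp
    ultimately show ?thesis by simp
  qed
  then show ?thesis using d(1) ds by (intro exI[of _ ?s]) auto
qed

section \<open>Type-definable relations between automorphisms\<close>

abbreviation finv :: "('a \<Rightarrow> 'b) \<Rightarrow> 'b \<Rightarrow> 'a" where
  "finv \<equiv> inv_into UNIV"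

lemma act_comp: "act (f \<circ> g) a = act f (act g a)"
  by (auto simp: act_def option.map_comp)

lemma act_id: "act id a = a"
  by (auto simp: act_def option.map_id)

lemma dom_act [simp]: "dom (act f a) = dom a"
  by (auto simp: act_def dom_def)

lemma ran_act: "ran (act f a) = f ` ran a"
  by (auto simp: act_def ran_def)

lemma aut_id: "id \<in> aut C"
  by (simp add: aut_def)

lemma aut_comp: "f \<in> aut C \<Longrightarrow> g \<in> aut C \<Longrightarrow> f \<circ> g \<in> aut C"
  unfolding aut_def by (auto simp: bij_comp simp flip: map_map)

lemma aut_inv:
  assumes f: "f \<in> aut C" shows "finv f \<in> aut C"
proof -
  have b: "bij f" using f by (simp add: aut_def)
  have fi: "map f (map (finv f) xs) = xs" for xs
    using b by (simp add: comp_def bij_is_surj surj_f_inv_f)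
  have fun_inv: "finv f (fun_int C k xs) = fun_int C k (map (finv f) xs)" if "length xs = fun_arity C k" for k xs
  proof -
    have "f (fun_int C k (map (finv f) xs)) = fun_int C k (map f (map (finv f) xs))"
      using f that by (simp add: aut_def del: map_map)
    then have "fun_int C k xs = f (fun_int C k (map (finv f) xs))"
      by (simp only: fi)
    then show ?thesis
      using b by (simp add: bij_is_inj)
  qed
  have rel_inv: "rel_int C k (map (finv f) xs) = rel_int C k xs" if "length xs = rel_arity C k" for k xs
  proof -
    have "rel_int C k (map f (map (finv f) xs)) = rel_int C k (map (finv f) xs)"
      using f that by (simp add: aut_def del: map_map)
    then show ?thesis
      by (simp only: fi)
  qed
  show ?thesis
    using fun_inv rel_inv bij_imp_bij_inv[OF b] by (simp add: aut_def)
qed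

lemma aut_inverse:
  assumes "f \<in> aut C"
  shows "f (finv f x) = x" "finv f (f x) = x" "f \<circ> finv f = id" "finv f \<circ> f = id"
  using assms by (auto simp: aut_def bij_def surj_f_inv_f fun_eq_iff)

text \<open>Formulas about a pair of automorphisms: the two families of variables stand for the images
  of elements under the first and under the second one. Two automorphisms are needed because
  conditions on \<open>f\<inverse> g\<close>, from which products and cosets are built, involve both at once.\<close>

definition env :: "('m \<Rightarrow> 'm) \<Rightarrow> ('m \<Rightarrow> 'm) \<Rightarrow> ('m + 'm, 'm) var \<Rightarrow> 'm" where
  "env f g = val (Some \<circ> case_sum f g)"

lemma env_simps [simp]:
  "env f g (TVar (Inl m)) = f m" "env f g (TVar (Inr m)) = g m" "env f g (Param m) = m"
  by (simp_all add: env_def)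

abbreviation pair_fmls :: "('f, 'r, 'm) struct \<Rightarrow> 'm set \<Rightarrow> ('f, 'r, ('m + 'm, 'm) var) fm set" where
  "pair_fmls C A \<equiv> fmls C (A <+> A) A"

lemma fmls_mono: "D \<subseteq> D' \<Longrightarrow> A \<subseteq> A' \<Longrightarrow> fmls C D A \<subseteq> fmls C D' A'"
  unfolding fmls_def by blast

lemma fmls_Neg: "Neg p \<in> fmls C D A \<longleftrightarrow> p \<in> fmls C D A"
  by (simp add: fmls_def)

lemma fmls_conj_exists:
  assumes "finite \<Phi>" "\<Phi> \<subseteq> fmls C D A"
  shows "\<exists>q\<in>fmls C D A. \<forall>s. sat C UNIV s q \<longleftrightarrow> (\<forall>p\<in>\<Phi>. sat C UNIV s p)"
proof -
  have wf: "\<And>p. p \<in> \<Phi> \<Longrightarrow> wf_fm C p" using assms(2) by (auto simp: fmls_def)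
  have "\<Union> (fv ` \<Phi>) \<subseteq> TVar ` D \<union> Param ` A" using assms(2) by (auto simp: fmls_def)
  with conj_exists[OF assms(1) wf] show ?thesis
    unfolding fmls_def by (smt (verit, best) mem_Collect_eq order_trans)
qed

lemma fmls_rename:
  fixes p :: "('f, 'r, ('i, 'm) var) fm" and r :: "('i, 'm) var \<Rightarrow> ('j, 'm) var"
  assumes p: "p \<in> fmls C D A"
    and r: "\<And>i. i \<in> D \<Longrightarrow> r (TVar i) \<in> TVar ` D' \<union> Param ` A'"
      "\<And>m. m \<in> A \<Longrightarrow> r (Param m) \<in> TVar ` D' \<union> Param ` A'"
  shows "\<exists>q\<in>fmls C D' A'. \<forall>s. sat C UNIV s q = sat C UNIV (\<lambda>v. s (r v)) p"
proof -
  from p have wf: "wf_fm C p" and fv: "fv p \<subseteq> TVar ` D \<union> Param ` A"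
    by (simp_all add: fmls_def)
  from rename_exists[OF infinite_UNIV_var wf, of r] obtain q where q: "wf_fm C q"
    "fv q \<subseteq> r ` fv p" "\<And>s. sat C UNIV s q = sat C UNIV (\<lambda>v. s (r v)) p" by blast
  have "r ` (TVar ` D \<union> Param ` A) \<subseteq> TVar ` D' \<union> Param ` A'"
    using r by auto
  then have "fv q \<subseteq> TVar ` D' \<union> Param ` A'"
    by (rule order_trans[OF order_trans[OF q(2) image_mono[OF fv]]])
  then show ?thesis
    using q(1,3) by (intro bexI[of _ q]) (simp_all add: fmls_def)
qed

locale monster =
  fixes C :: "('f, 'r, 'm) struct" and \<kappa> :: "'k rel" and e :: "('k \<rightharpoonup> 'm) set"
  assumes card: "Card_order \<kappa>" "natLeq <o \<kappa>"
    and saturated: "saturated C \<kappa>"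
    and homogeneous: "strongly_homogeneous C \<kappa>"
    and hyperimaginary: "hyperimaginary C \<kappa> e"
begin

abbreviation G :: "('m \<Rightarrow> 'm) set" where "G \<equiv> aut_over C e"

lemma G_aut: "f \<in> G \<Longrightarrow> f \<in> aut C"
  by (simp add: aut_over_def)

lemma G_id: "id \<in> G"
  by (simp add: aut_over_def aut_id act_id)

lemma G_comp: "f \<in> G \<Longrightarrow> g \<in> G \<Longrightarrow> f \<circ> g \<in> G"
  by (auto simp: aut_over_def aut_comp act_comp image_image[symmetric])

lemma G_inv: "f \<in> G \<Longrightarrow> finv f \<in> G"
proof -
  assume f: "f \<in> G"
  then have "act f ` e = e" by (simp add: aut_over_def)
  then have "act (finv f) ` e = act (finv f) ` act f ` e" by simp
  also have "\<dots> = e"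
    using aut_inverse(4)[OF G_aut[OF f]] by (simp add: image_image act_comp[symmetric] act_id)
  finally show ?thesis
    using f by (simp add: aut_over_def aut_inv)
qed

lemma dcl_fix: "in_dcl C e A \<Longrightarrow> h \<in> aut C \<Longrightarrow> (\<And>m. m \<in> A \<Longrightarrow> h m = m) \<Longrightarrow> h \<in> G"
  by (simp add: in_dcl_def aut_over_def)

text \<open>Strong homogeneity in terms of assignments: \<open>the_inv TVar\<close> sends the variable named by an
  element to that element.\<close>

lemma elementary_extends:
  assumes A: "|A| <o \<kappa>"
    and el: "\<And>p :: ('f, 'r, ('m, 'm) var) fm. p \<in> fmls C A {} \<Longrightarrow>
      sat C UNIV (\<lambda>v. F (the_inv TVar v)) p \<longleftrightarrow> sat C UNIV (\<lambda>v. the_inv TVar v) p"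
  shows "\<exists>g\<in>aut C. \<forall>a\<in>A. g a = F a"
proof -
  have "holds C (act F (self_tuple A)) p \<longleftrightarrow> holds C (self_tuple A) p" if p: "p \<in> fmls C A {}" for p :: "('f, 'r, ('m, 'm) var) fm"
  proof -
    have inv: "the_inv TVar (TVar a :: ('m, 'm) var) = a" for a
      by (rule the_inv_f_f) (simp add: inj_def)
    have fv: "fv p \<subseteq> TVar ` A" using p by (simp add: fmls_def)
    have "holds C (act F (self_tuple A)) p \<longleftrightarrow> sat C UNIV (\<lambda>v. F (the_inv TVar v)) p"
      unfolding holds_def
      by (rule sat_cong) (use fv inv in \<open>auto simp: act_def self_tuple_def\<close>)
    moreover have "holds C (self_tuple A) p \<longleftrightarrow> sat C UNIV (\<lambda>v. the_inv TVar v) p"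
      unfolding holds_def
      by (rule sat_cong) (use fv inv in \<open>auto simp: act_def self_tuple_def\<close>)
    ultimately show ?thesis
      using el[OF p] by simp
  qed
  moreover have "dom (self_tuple A) = A" by (simp add: self_tuple_def)
  ultimately have "tp C {} (act F (self_tuple A)) = tp C {} (self_tuple A)"
    by (auto simp: tp_def)
  with A homogeneous show ?thesis
    unfolding strongly_homogeneous_def by blast
qed

text \<open>The images of \<open>A\<close> under \<open>f\<close> and \<open>f'\<close> have the same type over \<open>A\<close>.\<close>

definition equivalent_over :: "'m set \<Rightarrow> ('m \<Rightarrow> 'm) \<Rightarrow> ('m \<Rightarrow> 'm) \<Rightarrow> bool" where
  "equivalent_over A f f' \<longleftrightarrow>
     (\<forall>p :: ('f, 'r, ('m + 'm, 'm) var) fm. p \<in> fmls C (A <+> {}) A \<longrightarrow>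
        sat C UNIV (env f id) p = sat C UNIV (env f' id) p)"

text \<open>The map that is the identity on \<open>A\<close> and sends \<open>f m\<close> to \<open>f' m\<close> is elementary. It is
  well defined because an equation \<open>f m = a\<close> with \<open>a \<in> A\<close> is part of the type.\<close>

lemma equivalent_over_automorphism:
  assumes A: "|A| <o \<kappa>" and f: "f \<in> aut C" and f': "f' \<in> aut C" and eq: "equivalent_over A f f'"
  shows "\<exists>h\<in>aut C. \<forall>m\<in>A. h m = m \<and> h (f m) = f' m"
proof -
  define F where "F = (\<lambda>x. if x \<in> A then x else f' (finv f x))"
  have F: "F (f m) = f' m" if m: "m \<in> A" for m
  proof (cases "f m \<in> A")
    case True
    let ?p = "Eq (Var (TVar (Inl m))) (Var (Param (f m))) :: ('f, 'r, ('m + 'm, 'm) var) fm"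
    have "?p \<in> fmls C (A <+> {}) A" using m True by (auto simp: fmls_def)
    with eq have "sat C UNIV (env f id) ?p = sat C UNIV (env f' id) ?p"
      unfolding equivalent_over_def by blast
    then show ?thesis using True by (simp add: F_def)
  qed (simp add: F_def aut_inverse(2)[OF f])
  have "\<exists>g\<in>aut C. \<forall>a\<in>A \<union> f ` A. g a = F a"
  proof (rule elementary_extends)
    show "|A \<union> f ` A| <o \<kappa>" by (intro small_Un card A small_image)
    fix p :: "('f, 'r, ('m, 'm) var) fm" assume p: "p \<in> fmls C (A \<union> f ` A) {}"
    define r :: "('m, 'm) var \<Rightarrow> ('m + 'm, 'm) var" where
      "r = (\<lambda>v. let x = the_inv TVar v in if x \<in> A then Param x else TVar (Inl (finv f x)))"
    have inv: "the_inv TVar (TVar a :: ('m, 'm) var) = a" for a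
      by (rule the_inv_f_f) (simp add: inj_def)
    have "\<exists>q\<in>fmls C (A <+> {}) A. \<forall>s. sat C UNIV s q = sat C UNIV (\<lambda>v. s (r v)) p"
      by (rule fmls_rename[OF p]) (use aut_inverse(2)[OF f] in \<open>auto simp: r_def inv Let_def\<close>)
    then obtain q where q: "q \<in> fmls C (A <+> {}) A"
      "\<And>s. sat C UNIV s q = sat C UNIV (\<lambda>v. s (r v)) p" by blast
    with eq have "sat C UNIV (env f id) q = sat C UNIV (env f' id) q"
      unfolding equivalent_over_def by blast
    moreover have "(\<lambda>v. env f id (r v)) = (\<lambda>v. the_inv TVar v)"
      using aut_inverse(1)[OF f] by (auto simp: r_def Let_def)
    moreover have "(\<lambda>v. env f' id (r v)) = (\<lambda>v. F (the_inv TVar v))"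
      by (auto simp: r_def Let_def F_def)
    ultimately show "sat C UNIV (\<lambda>v. F (the_inv TVar v)) p \<longleftrightarrow> sat C UNIV (\<lambda>v. the_inv TVar v) p"
      by (simp add: q(2))
  qed
  then obtain h where h: "h \<in> aut C" "\<forall>a\<in>A \<union> f ` A. h a = F a" by blast
  then have "\<forall>m\<in>A. h m = m \<and> h (f m) = f' m"
    using F by (simp add: F_def)
  with h(1) show ?thesis by blast
qed


section \<open>Compactness for automorphisms fixing the hyperimaginary\<close>

text \<open>An automorphism fixes the class \<open>e\<close> as soon as it moves one representative \<open>a\<close> inside it, and
  membership of \<open>x\<close> in \<open>e\<close> is a set of formulas about \<open>a\<close> and \<open>x\<close>.\<close>

lemma representative:
  obtains a where "a \<in> e" "|ran a| <o \<kappa>"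
    "\<And>f. f \<in> aut C \<Longrightarrow> f \<in> G \<longleftrightarrow> act f a \<in> e"
    "\<exists>E\<subseteq>fmls C (dom a <+> dom a) {}. \<forall>x. dom x = dom a \<longrightarrow>
       (x \<in> e \<longleftrightarrow> (\<forall>p\<in>E. holds C (case_sum a x) p))"
proof -
  from hyperimaginary obtain \<alpha> E where \<alpha>: "\<alpha> \<in> Field \<kappa>" and
    E: "E \<subseteq> fmls C (underS \<kappa> \<alpha> <+> underS \<kappa> \<alpha>) {}" and
    eq: "equiv {a. dom a = underS \<kappa> \<alpha>} (definable_rel C (underS \<kappa> \<alpha>) E)" and
    e: "e \<in> {a. dom a = underS \<kappa> \<alpha>} // definable_rel C (underS \<kappa> \<alpha>) E"
    unfolding hyperimaginary_def by blast
  define D where "D = underS \<kappa> \<alpha>"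
  define R where "R = definable_rel C D E"
  note eq = eq[folded D_def, folded R_def] and e = e[folded D_def, folded R_def] and E = E[folded D_def]
  from e obtain a where a: "dom a = D" "e = R `` {a}" by (rule quotientE) blast
  then have "a \<in> e" using eq by (auto simp: equiv_def refl_on_def)
  have dom_e: "dom x = D" if "x \<in> e" for x
    using that a(2) by (auto simp: R_def definable_rel_def)
  have R: "(x, y) \<in> R \<longleftrightarrow> (\<forall>p\<in>E. holds C (case_sum x y) p)" if "dom x = D" "dom y = D" for x y
  proof -
    have "dom (case_sum x y) = D <+> D"
    proof (rule Set.set_eqI)
      fix z
      have "z \<in> dom (case_sum x y) \<longleftrightarrow> (case z of Inl i \<Rightarrow> i \<in> dom x | Inr i \<Rightarrow> i \<in> dom y)"
        by (cases z) (simp_all add: dom_def)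
      then show "z \<in> dom (case_sum x y) \<longleftrightarrow> z \<in> D <+> D"
        unfolding that by (cases z) auto
    qed
    then show ?thesis using that by (simp add: R_def definable_rel_def solutions_def)
  qed
  have inv: "(act f x, act f y) \<in> R" if f: "f \<in> aut C" and xy: "(x, y) \<in> R" for f x y
  proof -
    have d: "dom x = D" "dom y = D" using xy by (auto simp: R_def definable_rel_def)
    have "holds C (case_sum (act f x) (act f y)) p" if p: "p \<in> E" for p
    proof -
      have fv: "fv p \<subseteq> TVar ` (D <+> D)" and wf: "wf_fm C p" using p E by (auto simp: fmls_def)
      have "holds C (case_sum (act f x) (act f y)) p \<longleftrightarrow> sat C UNIV (\<lambda>v. f (val (case_sum x y) v)) p"
        unfolding holds_def by (rule sat_cong) (use fv d in \<open>force simp: act_def dom_def\<close>)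
      also have "\<dots> \<longleftrightarrow> holds C (case_sum x y) p"
        unfolding holds_def by (rule sat_aut_UNIV[OF f wf])
      finally show ?thesis using R[OF d] xy p by blast
    qed
    then show ?thesis using R d by simp
  qed
  show ?thesis
  proof (rule that)
    show "a \<in> e" by fact
    have "ran a = (\<lambda>i. the (a i)) ` D"
      using a(1) by (force simp: ran_def dom_def image_def)
    moreover have "|D| <o \<kappa>"
      unfolding D_def by (rule card_of_underS[OF card(1) \<alpha>])
    ultimately show "|ran a| <o \<kappa>" using small_image by metis
    show "f \<in> G \<longleftrightarrow> act f a \<in> e" if f: "f \<in> aut C" for f
    proof
      assume "f \<in> G"
      then show "act f a \<in> e" using \<open>a \<in> e\<close> by (auto simp: aut_over_def)
    next
      assume fa: "act f a \<in> e"
      then have afa: "(a, act f a) \<in> R" using a by blast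
      have "act f x \<in> e \<longleftrightarrow> x \<in> e" for x
      proof
        assume "x \<in> e"
        then have "(act f a, act f x) \<in> R" using a(2) inv[OF f] by blast
        then show "act f x \<in> e" using afa a(2) eq by (auto simp: equiv_def elim: transE)
      next
        assume "act f x \<in> e"
        then have "(act f a, act f x) \<in> R" using afa a(2) eq by (meson Image_singleton_iff equiv_def symD transD)
        then have "(act (finv f) (act f a), act (finv f) (act f x)) \<in> R"
          using inv[OF aut_inv[OF f]] by blast
        then show "x \<in> e"
          using a(2) aut_inverse(4)[OF f] by (simp add: act_comp[symmetric] act_id)
      qed
      note iff = this
      have "act f ` e = e"
      proof
        show "act f ` e \<subseteq> e" using iff by blast
        show "e \<subseteq> act f ` e"
        proof
          fix x assume "x \<in> e"
          have "x = act f (act (finv f) x)"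
            using aut_inverse(3)[OF f] by (simp add: act_comp[symmetric] act_id)
          with iff[of "act (finv f) x"] \<open>x \<in> e\<close> show "x \<in> act f ` e" by auto
        qed
      qed
      then show "f \<in> G" using f by (simp add: aut_over_def)
    qed
    show "\<exists>E\<subseteq>fmls C (dom a <+> dom a) {}. \<forall>x. dom x = dom a \<longrightarrow>
       (x \<in> e \<longleftrightarrow> (\<forall>p\<in>E. holds C (case_sum a x) p))"
      using E a R by (intro exI[of _ E]) auto
  qed
qed

text \<open>To turn a realization of \<open>\<Psi>\<close> into a pair of automorphisms fixing \<open>e\<close>, add a representative \<open>a\<close>
  of \<open>e\<close> to the domain and add the set \<open>\<Theta>\<close> of all formulas that hold of every pair. Among them
  are the formulas saying that either half of the realization is an elementary map, so that
  homogeneity extends it to an automorphism, and those saying that the image of \<open>a\<close> lies in \<open>e\<close>.\<close>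

lemma compactness:
  assumes A: "|A| <o \<kappa>" and \<Psi>: "\<Psi> \<subseteq> pair_fmls C A"
    and fin: "\<And>\<Psi>0. \<Psi>0 \<subseteq> \<Psi> \<Longrightarrow> finite \<Psi>0 \<Longrightarrow> \<exists>f\<in>G. \<exists>g\<in>G. \<forall>p\<in>\<Psi>0. sat C UNIV (env f g) p"
  shows "\<exists>f\<in>G. \<exists>g\<in>G. \<forall>p\<in>\<Psi>. sat C UNIV (env f g) p"
proof -
  obtain a where a: "a \<in> e" "|ran a| <o \<kappa>" "\<And>f. f \<in> aut C \<Longrightarrow> f \<in> G \<longleftrightarrow> act f a \<in> e"
    and "\<exists>E\<subseteq>fmls C (dom a <+> dom a) {}. \<forall>x. dom x = dom a \<longrightarrow>
       (x \<in> e \<longleftrightarrow> (\<forall>p\<in>E. holds C (case_sum a x) p))"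
    by (rule representative) blast
  then obtain E where E: "E \<subseteq> fmls C (dom a <+> dom a) {}"
    "\<And>x. dom x = dom a \<Longrightarrow> x \<in> e \<longleftrightarrow> (\<forall>p\<in>E. holds C (case_sum a x) p)" by blast
  let ?A = "A \<union> ran a"
  have sA: "|?A| <o \<kappa>" by (intro small_Un card A a)
  define \<Theta> where "\<Theta> = {p \<in> pair_fmls C ?A. \<forall>f\<in>G. \<forall>g\<in>G. sat C UNIV (env f g) p}"
  have sub: "\<Psi> \<union> \<Theta> \<subseteq> pair_fmls C ?A"
    using \<Psi> fmls_mono[of "A <+> A" "?A <+> ?A" A ?A C] by (auto simp: \<Theta>_def)
  define c :: "('m + 'm, 'm) var \<rightharpoonup> 'm" where "c = (\<lambda>v. case v of Param m \<Rightarrow> Some m | _ \<Rightarrow> None)"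
  have "\<exists>s. c \<subseteq>\<^sub>m Some \<circ> s \<and> (\<forall>p\<in>\<Psi> \<union> \<Theta>. sat C UNIV s p)"
  proof (rule realize[OF saturated])
    show "wf_fm C p" if "p \<in> \<Psi> \<union> \<Theta>" for p
      using that sub by (auto simp: fmls_def)
    have "\<Union> (fv ` (\<Psi> \<union> \<Theta>)) \<subseteq> (\<lambda>m. TVar (Inl m)) ` ?A \<union> (\<lambda>m. TVar (Inr m)) ` ?A \<union> Param ` ?A"
    proof (rule UN_least)
      fix p assume "p \<in> \<Psi> \<union> \<Theta>"
      then have "p \<in> pair_fmls C ?A" by (rule subsetD[OF sub])
      then have "fv p \<subseteq> TVar ` (?A <+> ?A) \<union> Param ` ?A" by (simp add: fmls_def)
      then show "fv p \<subseteq> (\<lambda>m. TVar (Inl m)) ` ?A \<union> (\<lambda>m. TVar (Inr m)) ` ?A \<union> Param ` ?A"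
        by (simp only: Plus_def image_Un image_image)
    qed
    then show "|\<Union> (fv ` (\<Psi> \<union> \<Theta>))| <o \<kappa>"
      by (rule small_subset) (intro small_Un card small_image sA)
    show "fin_sat C (\<Psi> \<union> \<Theta>) c"
      unfolding fin_sat_def
    proof (intro allI impI)
      fix \<Phi>0 assume \<Phi>0: "\<Phi>0 \<subseteq> \<Psi> \<union> \<Theta>" "finite \<Phi>0"
      have "\<Phi>0 \<inter> \<Psi> \<subseteq> \<Psi>" "finite (\<Phi>0 \<inter> \<Psi>)" using \<Phi>0 by auto
      from fin[OF this] obtain f g where fg: "f \<in> G" "g \<in> G" "\<forall>p\<in>\<Phi>0 \<inter> \<Psi>. sat C UNIV (env f g) p" by blast
      then have "\<forall>p\<in>\<Phi>0. sat C UNIV (env f g) p"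
        using \<Phi>0(1) unfolding \<Theta>_def by blast
      moreover have "c \<subseteq>\<^sub>m Some \<circ> env f g"
        by (auto simp: map_le_def c_def split: var.splits)
      ultimately show "\<exists>s. c \<subseteq>\<^sub>m Some \<circ> s \<and> (\<forall>p\<in>\<Phi>0. sat C UNIV s p)" by blast
    qed
  qed
  then obtain s where s: "c \<subseteq>\<^sub>m Some \<circ> s" "\<forall>p\<in>\<Psi> \<union> \<Theta>. sat C UNIV s p" by blast
  have sP: "s (Param m) = m" for m
  proof -
    have "Param m \<in> dom c" by (simp add: c_def dom_def)
    then have "c (Param m) = (Some \<circ> s) (Param m)" using s(1) unfolding map_le_def by blast
    then show ?thesis by (simp add: c_def)
  qed
  have ext: "\<exists>h\<in>G. \<forall>m\<in>?A. h m = s (TVar (j m))" if j: "j = Inl \<or> j = Inr" for j :: "'m \<Rightarrow> 'm + 'm"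
  proof -
    define pr where "pr = (\<lambda>f g :: 'm \<Rightarrow> 'm. if j = Inl then f else g)"
    have inlr: "(Inl :: 'm \<Rightarrow> 'm + 'm) \<noteq> Inr" by (metis Inl_Inr_False)
    have env_j: "env f g (TVar (j m)) = pr f g m" for f g m
      using j inlr by (auto simp: pr_def)
    have pr_G: "pr f g \<in> G" if "f \<in> G" "g \<in> G" for f g
      using that by (simp add: pr_def)
    have jA: "j m \<in> ?A <+> ?A" if "m \<in> ?A" for m
      using j that by auto
    have "\<exists>h\<in>aut C. \<forall>m\<in>?A. h m = s (TVar (j m))"
    proof (rule elementary_extends[OF sA])
      fix p :: "('f, 'r, ('m, 'm) var) fm" assume p: "p \<in> fmls C ?A {}"
      have inv: "the_inv TVar (TVar a :: ('m, 'm) var) = a" for a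
        by (rule the_inv_f_f) (simp add: inj_def)
      define r :: "('m, 'm) var \<Rightarrow> ('m + 'm, 'm) var" where "r = (\<lambda>v. TVar (j (the_inv TVar v)))"
      have imp: "sat C UNIV (\<lambda>v. s (TVar (j (the_inv TVar v)))) q"
        if q: "q \<in> fmls C ?A {}" "sat C UNIV (\<lambda>v. the_inv TVar v) q" for q :: "('f, 'r, ('m, 'm) var) fm"
      proof -
        have "\<exists>q'\<in>pair_fmls C ?A. \<forall>s. sat C UNIV s q' = sat C UNIV (\<lambda>v. s (r v)) q"
          by (rule fmls_rename[OF q(1)]) (use jA in \<open>auto simp: r_def inv\<close>)
        then obtain q' where q': "q' \<in> pair_fmls C ?A" "\<And>s. sat C UNIV s q' = sat C UNIV (\<lambda>v. s (r v)) q" by blast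
        have "sat C UNIV (env f g) q'" if fg: "f \<in> G" "g \<in> G" for f g
        proof -
          have "wf_fm C q" using q(1) by (simp add: fmls_def)
          from sat_aut_UNIV[OF G_aut[OF pr_G[OF fg]] this] q(2)
          show ?thesis by (simp add: q'(2) r_def env_j)
        qed
        then have "q' \<in> \<Theta>" using q'(1) by (simp add: \<Theta>_def)
        then have "sat C UNIV s q'" using s(2) by blast
        then show ?thesis by (simp add: q'(2) r_def)
      qed
      have np: "Neg p \<in> fmls C ?A {}" using p by (simp add: fmls_Neg)
      show "sat C UNIV (\<lambda>v. s (TVar (j (the_inv TVar v)))) p \<longleftrightarrow> sat C UNIV (\<lambda>v. the_inv TVar v) p"
        using imp[OF p] imp[OF np] by auto
    qed
    then obtain h where h: "h \<in> aut C" "\<And>m. m \<in> ?A \<Longrightarrow> h m = s (TVar (j m))" by blast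
    have "holds C (case_sum a (act h a)) p" if p: "p \<in> E" for p
    proof -
      define r :: "('k + 'k, 'm) var \<Rightarrow> ('m + 'm, 'm) var" where
        "r = (\<lambda>v. case v of TVar (Inl i) \<Rightarrow> Param (the (a i)) | TVar (Inr i) \<Rightarrow> TVar (j (the (a i))) | Param m \<Rightarrow> Param m | Aux n \<Rightarrow> Aux n)"
      have pE: "p \<in> fmls C (dom a <+> dom a) {}" using p E(1) by blast
      then have fv: "fv p \<subseteq> TVar ` (dom a <+> dom a)" by (simp add: fmls_def)
      have ra: "the (a i) \<in> ran a" if "i \<in> dom a" for i
        using that by (auto simp: ran_def)
      have "\<exists>q'\<in>pair_fmls C ?A. \<forall>s. sat C UNIV s q' = sat C UNIV (\<lambda>v. s (r v)) p"
      proof (rule fmls_rename[OF pE])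
        fix i assume "i \<in> dom a <+> dom a"
        then show "r (TVar i) \<in> TVar ` (?A <+> ?A) \<union> Param ` ?A"
        proof (cases i)
          case (Inl k)
          then have "the (a k) \<in> ?A" using \<open>i \<in> dom a <+> dom a\<close> ra by blast
          then show ?thesis by (simp add: r_def Inl)
        next
          case (Inr k)
          then have "the (a k) \<in> ?A" using \<open>i \<in> dom a <+> dom a\<close> ra by blast
          then have "j (the (a k)) \<in> ?A <+> ?A" by (rule jA)
          then show ?thesis by (simp add: r_def Inr)
        qed
      qed simp
      then obtain q' where q': "q' \<in> pair_fmls C ?A" "\<And>s. sat C UNIV s q' = sat C UNIV (\<lambda>v. s (r v)) p" by blast
      have agree: "holds C (case_sum a (act k a)) p \<longleftrightarrow> sat C UNIV (\<lambda>v. t (r v)) p"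
        if t: "\<And>m. t (Param m) = m" "\<And>m. m \<in> ran a \<Longrightarrow> t (TVar (j m)) = k m" for k t
        unfolding holds_def
      proof (rule sat_cong)
        fix v assume "v \<in> fv p"
        then obtain i where i: "v = TVar i" "i \<in> dom a <+> dom a" using fv by blast
        then show "val (case_sum a (act k a)) v = t (r v)"
        proof (cases i)
          case (Inl k)
          then show ?thesis using i t by (simp add: r_def)
        next
          case (Inr l)
          then have "l \<in> dom a" using i(2) by blast
          then have "the (act k a l) = k (the (a l))" by (auto simp: act_def)
          also have "\<dots> = t (TVar (j (the (a l))))" using t(2)[OF ra[OF \<open>l \<in> dom a\<close>]] by simp
          finally show ?thesis by (simp add: i(1) Inr r_def)
        qed
      qed
      have "sat C UNIV (env f g) q'" if fg: "f \<in> G" "g \<in> G" for f g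
      proof -
        have "act (pr f g) a \<in> e" using a(3) pr_G[OF fg] G_aut by blast
        then have "holds C (case_sum a (act (pr f g) a)) p" using E(2) p by simp
        then show ?thesis using agree[of "env f g" "pr f g"] by (simp add: q'(2) env_j)
      qed
      then have "q' \<in> \<Theta>" using q'(1) by (simp add: \<Theta>_def)
      then have "sat C UNIV s q'" using s(2) by blast
      then show ?thesis using agree[of s h] sP h(2) by (simp add: q'(2))
    qed
    then have "act h a \<in> e" using E(2) by simp
    then have "h \<in> G" using a(3) h(1) by blast
    then show ?thesis using h(2) by blast
  qed
  from ext[of Inl] obtain f where f: "f \<in> G" "\<forall>m\<in>?A. f m = s (TVar (Inl m))" by blast
  from ext[of Inr] obtain g where g: "g \<in> G" "\<forall>m\<in>?A. g m = s (TVar (Inr m))" by blast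
  have "sat C UNIV (env f g) p" if "p \<in> \<Psi>" for p
  proof -
    have "fv p \<subseteq> TVar ` (A <+> A) \<union> Param ` A" using that \<Psi> by (auto simp: fmls_def)
    then have "env f g v = s v" if "v \<in> fv p" for v
      using that f g sP by (fastforce simp: Plus_def)
    then have "sat C UNIV (env f g) p = sat C UNIV s p" by (rule sat_cong)
    then show ?thesis using s(2) that by blast
  qed
  then show ?thesis using f(1) g(1) by blast
qed


section \<open>Type-definable sets of pairs\<close>

definition sat_pairs ::
  "('f, 'r, ('m + 'm, 'm) var) fm set \<Rightarrow> (('m \<Rightarrow> 'm) \<times> ('m \<Rightarrow> 'm)) set" where
  "sat_pairs \<Phi> = {(f, g). f \<in> G \<and> g \<in> G \<and> (\<forall>p\<in>\<Phi>. sat C UNIV (env f g) p)}"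

lemma sat_pairs_iff [simp]:
  "(f, g) \<in> sat_pairs \<Phi> \<longleftrightarrow> f \<in> G \<and> g \<in> G \<and> (\<forall>p\<in>\<Phi>. sat C UNIV (env f g) p)"
  by (simp add: sat_pairs_def)

text \<open>A set \<open>B\<close> of single automorphisms is treated as the set \<open>B \<times> G\<close> of pairs.\<close>

definition type_definable :: "'m set \<Rightarrow> (('m \<Rightarrow> 'm) \<times> ('m \<Rightarrow> 'm)) set \<Rightarrow> bool" where
  "type_definable A R \<longleftrightarrow> (\<exists>\<Phi>\<subseteq>pair_fmls C A.
     R = sat_pairs \<Phi>)"

lemma type_definableI: "\<Phi> \<subseteq> pair_fmls C A \<Longrightarrow> type_definable A (sat_pairs \<Phi>)"
  unfolding type_definable_def by blast

lemma type_definable_subset: "type_definable A R \<Longrightarrow> R \<subseteq> G \<times> G"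
  by (auto simp: type_definable_def sat_pairs_def)

lemma type_definable_mono:
  assumes "type_definable A R" "A \<subseteq> A'" shows "type_definable A' R"
proof -
  have "pair_fmls C A \<subseteq> pair_fmls C A'"
    using assms(2) by (intro fmls_mono) auto
  moreover obtain \<Phi> where "\<Phi> \<subseteq> pair_fmls C A" "R = sat_pairs \<Phi>"
    using assms(1) unfolding type_definable_def by blast
  ultimately show ?thesis
    using type_definableI[of \<Phi> A'] by simp
qed

lemma type_definable_Int:
  assumes "type_definable A R" "type_definable A S"
  shows "type_definable A (R \<inter> S)"
proof -
  from assms obtain \<Phi> \<Psi> where "\<Phi> \<subseteq> pair_fmls C A" "R = sat_pairs \<Phi>"
    "\<Psi> \<subseteq> pair_fmls C A" "S = sat_pairs \<Psi>"
    unfolding type_definable_def by blast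
  moreover have "sat_pairs \<Phi> \<inter> sat_pairs \<Psi> = sat_pairs (\<Phi> \<union> \<Psi>)"
    by (auto simp: sat_pairs_def)
  ultimately show ?thesis
    by (simp only: type_definableI Un_subset_iff simp_thms)
qed

lemma type_definable_finite_fmls_compl:
  assumes \<Phi>: "\<Phi> \<subseteq> pair_fmls C A" "finite \<Phi>"
  shows "type_definable A {(f, g). f \<in> G \<and> g \<in> G \<and> \<not> (\<forall>p\<in>\<Phi>. sat C UNIV (env f g) p)}"
proof -
  from fmls_conj_exists[OF \<Phi>(2,1)] obtain q where q: "q \<in> pair_fmls C A"
    "\<And>s. sat C UNIV s q \<longleftrightarrow> (\<forall>p\<in>\<Phi>. sat C UNIV s p)" by blast
  have "{Neg q} \<subseteq> pair_fmls C A" using q(1) by (simp add: fmls_Neg)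
  moreover have "{(f, g). f \<in> G \<and> g \<in> G \<and> \<not> (\<forall>p\<in>\<Phi>. sat C UNIV (env f g) p)} =
    sat_pairs {Neg q}"
    using q(2) by (auto simp: sat_pairs_def)
  ultimately show ?thesis by (simp only: type_definableI)
qed

text \<open>If the automorphism \<open>k f g\<close> carries all coordinates of the pair \<open>(F f g, H f g)\<close> and all
  parameters to coordinates of \<open>(f, g)\<close> or to parameters, then a condition on \<open>(F f g, H f g)\<close> is one
  on \<open>(f, g)\<close>, because automorphisms preserve satisfaction. The closure properties of
  type-definability that follow are instances; for the condition on \<open>f\<inverse> g\<close> the automorphism is
  \<open>f\<close>, which turns \<open>f\<inverse> (g m)\<close> into \<open>g m\<close> and the parameter \<open>m\<close> into \<open>f m\<close>.\<close>

lemma type_definable_substitute: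
  fixes r :: "('m + 'm, 'm) var \<Rightarrow> ('m + 'm, 'm) var"
  assumes R: "type_definable A R"
    and r: "\<And>m. m \<in> A \<Longrightarrow> r (TVar (Inl m)) \<in> TVar ` (A' <+> A') \<union> Param ` A'"
      "\<And>m. m \<in> A \<Longrightarrow> r (TVar (Inr m)) \<in> TVar ` (A' <+> A') \<union> Param ` A'"
      "\<And>m. m \<in> A \<Longrightarrow> r (Param m) \<in> TVar ` (A' <+> A') \<union> Param ` A'"
    and FH: "\<And>f g. f \<in> G \<Longrightarrow> g \<in> G \<Longrightarrow> F f g \<in> G" "\<And>f g. f \<in> G \<Longrightarrow> g \<in> G \<Longrightarrow> H f g \<in> G"
    and k: "\<And>f g. f \<in> G \<Longrightarrow> g \<in> G \<Longrightarrow> k f g \<in> aut C"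
    and eq: "\<And>f g m. f \<in> G \<Longrightarrow> g \<in> G \<Longrightarrow> k f g (F f g m) = env f g (r (TVar (Inl m)))"
      "\<And>f g m. f \<in> G \<Longrightarrow> g \<in> G \<Longrightarrow> k f g (H f g m) = env f g (r (TVar (Inr m)))"
      "\<And>f g m. f \<in> G \<Longrightarrow> g \<in> G \<Longrightarrow> k f g m = env f g (r (Param m))"
  shows "type_definable A' {(f, g). f \<in> G \<and> g \<in> G \<and> (F f g, H f g) \<in> R}"
proof -
  from R obtain \<Phi> where \<Phi>: "\<Phi> \<subseteq> pair_fmls C A"
    and R: "R = sat_pairs \<Phi>"
    unfolding type_definable_def by blast
  have "\<exists>q\<in>pair_fmls C A'. \<forall>f\<in>G. \<forall>g\<in>G. sat C UNIV (env f g) q = sat C UNIV (env (F f g) (H f g)) p"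
    if p: "p \<in> \<Phi>" for p
  proof -
    have pA: "p \<in> pair_fmls C A" using p \<Phi> by blast
    have "\<exists>q\<in>pair_fmls C A'. \<forall>s. sat C UNIV s q = sat C UNIV (\<lambda>v. s (r v)) p"
      by (rule fmls_rename[OF pA]) (use r in auto)
    then obtain q where q: "q \<in> pair_fmls C A'" "\<And>s. sat C UNIV s q = sat C UNIV (\<lambda>v. s (r v)) p" by blast
    have wf: "wf_fm C p" and fv: "fv p \<subseteq> TVar ` (A <+> A) \<union> Param ` A"
      using pA by (simp_all add: fmls_def)
    have "sat C UNIV (env f g) q = sat C UNIV (env (F f g) (H f g)) p" if fg: "f \<in> G" "g \<in> G" for f g
    proof -
      have "sat C UNIV (env f g) q = sat C UNIV (\<lambda>v. k f g (env (F f g) (H f g) v)) p"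
        unfolding q(2)
      proof (rule sat_cong)
        fix v assume "v \<in> fv p"
        then have "v \<in> TVar ` (A <+> A) \<union> Param ` A" using fv by (rule subsetD[rotated])
        then show "env f g (r v) = k f g (env (F f g) (H f g) v)"
          using eq[OF fg] by auto
      qed
      also have "\<dots> = sat C UNIV (env (F f g) (H f g)) p"
        by (rule sat_aut_UNIV[OF k[OF fg] wf])
      finally show ?thesis .
    qed
    with q(1) show ?thesis by blast
  qed
  then obtain Q where Q: "\<And>p. p \<in> \<Phi> \<Longrightarrow> Q p \<in> pair_fmls C A'"
    "\<And>p f g. p \<in> \<Phi> \<Longrightarrow> f \<in> G \<Longrightarrow> g \<in> G \<Longrightarrow>
      sat C UNIV (env f g) (Q p) = sat C UNIV (env (F f g) (H f g)) p"
    by metis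
  have "Q ` \<Phi> \<subseteq> pair_fmls C A'" using Q(1) by blast
  moreover have "{(f, g). f \<in> G \<and> g \<in> G \<and> (F f g, H f g) \<in> R} =
    sat_pairs (Q ` \<Phi>)"
    using Q(2) FH unfolding R by auto
  ultimately show ?thesis by (simp only: type_definableI)
qed

abbreviation type_definable_set :: "'m set \<Rightarrow> ('m \<Rightarrow> 'm) set \<Rightarrow> bool" where
  "type_definable_set A B \<equiv> type_definable A (B \<times> G)"

lemma type_definable_left:
  assumes B: "type_definable_set A B" and a: "a \<in> G"
  shows "type_definable_set (A \<union> finv a ` A) {f \<in> G. a \<circ> f \<in> B}"
proof -
  let ?A = "A \<union> finv a ` A"
  define r :: "('m + 'm, 'm) var \<Rightarrow> ('m + 'm, 'm) var" where
    "r = (\<lambda>v. case v of Param m \<Rightarrow> Param (finv a m) | _ \<Rightarrow> v)"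
  have "type_definable ?A {(f, g). f \<in> G \<and> g \<in> G \<and> (a \<circ> f, a \<circ> g) \<in> B \<times> G}"
    by (rule type_definable_substitute[OF B, where r = r and k = "\<lambda>_ _. finv a"])
      (use a in \<open>auto simp: r_def G_comp aut_inv G_aut aut_inverse(2)[OF G_aut[OF a]]\<close>)
  moreover have "{(f, g). f \<in> G \<and> g \<in> G \<and> (a \<circ> f, a \<circ> g) \<in> B \<times> G} = {f \<in> G. a \<circ> f \<in> B} \<times> G"
    using G_comp[OF a] by auto
  ultimately show ?thesis by simp
qed

lemma type_definable_right:
  assumes B: "type_definable_set A B" and a: "a \<in> G"
  shows "type_definable_set (A \<union> a ` A) {f \<in> G. f \<circ> a \<in> B}"
proof -
  let ?A = "A \<union> a ` A"
  define r :: "('m + 'm, 'm) var \<Rightarrow> ('m + 'm, 'm) var" where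
    "r = (\<lambda>v. case v of TVar (Inl m) \<Rightarrow> TVar (Inl (a m)) | TVar (Inr m) \<Rightarrow> TVar (Inr (a m)) | _ \<Rightarrow> v)"
  have "type_definable ?A {(f, g). f \<in> G \<and> g \<in> G \<and> (f \<circ> a, g \<circ> a) \<in> B \<times> G}"
    by (rule type_definable_substitute[OF B, where r = r and k = "\<lambda>_ _. id"])
      (use a in \<open>auto simp: r_def G_comp aut_id\<close>)
  moreover have "{(f, g). f \<in> G \<and> g \<in> G \<and> (f \<circ> a, g \<circ> a) \<in> B \<times> G} = {f \<in> G. f \<circ> a \<in> B} \<times> G"
    using G_comp[OF _ a] by auto
  ultimately show ?thesis by simp
qed

lemma type_definable_inverse:
  assumes B: "type_definable_set A B"
  shows "type_definable_set A {f \<in> G. finv f \<in> B}"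
proof -
  define r :: "('m + 'm, 'm) var \<Rightarrow> ('m + 'm, 'm) var" where
    "r = (\<lambda>v. case v of TVar (Inl m) \<Rightarrow> Param m | TVar (Inr m) \<Rightarrow> Param m | Param m \<Rightarrow> TVar (Inl m) | _ \<Rightarrow> v)"
  have "type_definable A {(f, g). f \<in> G \<and> g \<in> G \<and> (finv f, finv f) \<in> B \<times> G}"
    by (rule type_definable_substitute[OF B, where r = r and k = "\<lambda>f _. f"])
      (auto simp: r_def G_inv G_aut aut_inverse(1)[OF G_aut])
  moreover have "{(f, g). f \<in> G \<and> g \<in> G \<and> (finv f, finv f) \<in> B \<times> G} = {f \<in> G. finv f \<in> B} \<times> G"
    using G_inv by auto
  ultimately show ?thesis by simp
qed

lemma type_definable_quotient:
  assumes B: "type_definable_set A B"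
  shows "type_definable A {(f, g). f \<in> G \<and> g \<in> G \<and> finv f \<circ> g \<in> B}"
proof -
  define r :: "('m + 'm, 'm) var \<Rightarrow> ('m + 'm, 'm) var" where
    "r = (\<lambda>v. case v of TVar (Inl m) \<Rightarrow> TVar (Inr m) | Param m \<Rightarrow> TVar (Inl m) | _ \<Rightarrow> v)"
  have "type_definable A {(f, g). f \<in> G \<and> g \<in> G \<and> (finv f \<circ> g, finv f \<circ> g) \<in> B \<times> G}"
    by (rule type_definable_substitute[OF B, where r = r and k = "\<lambda>f _. f"])
      (auto simp: r_def G_inv G_comp G_aut aut_inverse(1)[OF G_aut])
  moreover have "{(f, g). f \<in> G \<and> g \<in> G \<and> (finv f \<circ> g, finv f \<circ> g) \<in> B \<times> G} =
      {(f, g). f \<in> G \<and> g \<in> G \<and> finv f \<circ> g \<in> B}"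
    using G_inv G_comp by auto
  ultimately show ?thesis by simp
qed

lemma type_definable_second:
  assumes B: "type_definable_set A B"
  shows "type_definable A (G \<times> B)"
proof -
  have BG: "B \<subseteq> G" using type_definable_subset[OF B] G_id by blast
  define r :: "('m + 'm, 'm) var \<Rightarrow> ('m + 'm, 'm) var" where
    "r = (\<lambda>v. case v of TVar (Inl m) \<Rightarrow> TVar (Inr m) | _ \<Rightarrow> v)"
  have "type_definable A {(f, g). f \<in> G \<and> g \<in> G \<and> (g, g) \<in> B \<times> G}"
    by (rule type_definable_substitute[OF B, where r = r and k = "\<lambda>_ _. id"])
      (auto simp: r_def aut_id)
  moreover have "{(f, g). f \<in> G \<and> g \<in> G \<and> (g, g) \<in> B \<times> G} = G \<times> B"
    using BG by auto
  ultimately show ?thesis by simp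
qed

lemma type_definable_specialize:
  assumes R: "type_definable A R"
  shows "type_definable_set A {f \<in> G. (f, id) \<in> R}"
proof -
  define r :: "('m + 'm, 'm) var \<Rightarrow> ('m + 'm, 'm) var" where
    "r = (\<lambda>v. case v of TVar (Inr m) \<Rightarrow> Param m | _ \<Rightarrow> v)"
  have "type_definable A {(f, g). f \<in> G \<and> g \<in> G \<and> (f, id) \<in> R}"
    by (rule type_definable_substitute[OF R, where r = r and k = "\<lambda>_ _. id"])
      (auto simp: r_def aut_id G_id)
  moreover have "{(f, g). f \<in> G \<and> g \<in> G \<and> (f, id) \<in> R} = {f \<in> G. (f, id) \<in> R} \<times> G"
    by auto
  ultimately show ?thesis by simp
qed

lemma type_definable_stabilizer: "type_definable_set A {f \<in> G. \<forall>m\<in>A. f m = m}"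
proof -
  let ?\<Phi> = "(\<lambda>m. Eq (Var (TVar (Inl m))) (Var (Param m))) ` A :: ('f, 'r, ('m + 'm, 'm) var) fm set"
  have "?\<Phi> \<subseteq> pair_fmls C A" by (auto simp: fmls_def)
  moreover have "{f \<in> G. \<forall>m\<in>A. f m = m} \<times> G =
      sat_pairs ?\<Phi>" by auto
  ultimately show ?thesis by (simp only: type_definableI)
qed

lemma type_definable_G: "type_definable A (G \<times> G)"
  unfolding type_definable_def by (rule exI[of _ "{}"]) auto

lemma sat_env_first:
  assumes "p \<in> fmls C (A <+> {}) B"
  shows "sat C UNIV (env f g) p = sat C UNIV (env f g') p"
proof (rule sat_cong)
  fix v assume "v \<in> fv p"
  then have "v \<in> TVar ` (A <+> {}) \<union> Param ` B"
    using assms by (auto simp: fmls_def)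
  then show "env f g v = env f g' v" by auto
qed

text \<open>The projection of a type-definable set of pairs is compact, and a compact set that is a
  union of classes is closed in a topology that separates these classes by clopen sets. In terms
  of formulas: if \<open>f'\<close> satisfies all formulas over \<open>A0\<close> that hold throughout the projection, then
  by compactness some element of the projection has the same type over \<open>A0\<close> as \<open>f'\<close>.\<close>

lemma type_definable_projection:
  assumes A: "|A| <o \<kappa>" and A0: "|A0| <o \<kappa>" and R: "type_definable A R"
    and saturated: "\<And>f f'. f \<in> fst ` R \<Longrightarrow> f' \<in> G \<Longrightarrow> equivalent_over A0 f f' \<Longrightarrow> f' \<in> fst ` R"
  shows "type_definable_set A0 (fst ` R)"
proof -
  from R obtain \<Psi> where \<Psi>: "\<Psi> \<subseteq> pair_fmls C A"
    and R: "R = sat_pairs \<Psi>"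
    unfolding type_definable_def by blast
  let ?F = "fmls C (A0 <+> {}) A0 :: ('f, 'r, ('m + 'm, 'm) var) fm set"
  have F: "?F \<subseteq> pair_fmls C A0" by (rule fmls_mono) auto
  define \<Phi> where "\<Phi> = {p \<in> ?F. \<forall>f\<in>fst ` R. sat C UNIV (env f id) p}"
  have "f' \<in> fst ` R" if f': "f' \<in> G" "\<forall>p\<in>\<Phi>. sat C UNIV (env f' id) p" for f'
  proof -
    define \<Xi> where "\<Xi> = {p \<in> ?F. sat C UNIV (env f' id) p}"
    have "\<exists>f\<in>G. \<exists>g\<in>G. \<forall>p\<in>\<Psi> \<union> \<Xi>. sat C UNIV (env f g) p"
    proof (rule compactness)
      show "|A \<union> A0| <o \<kappa>" by (intro small_Un card A A0)
      have "pair_fmls C A \<subseteq> pair_fmls C (A \<union> A0)" "pair_fmls C A0 \<subseteq> pair_fmls C (A \<union> A0)"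
        by (intro fmls_mono; auto)+
      then show "\<Psi> \<union> \<Xi> \<subseteq> pair_fmls C (A \<union> A0)"
        using \<Psi> F unfolding \<Xi>_def by blast
      fix \<Phi>0 assume \<Phi>0: "\<Phi>0 \<subseteq> \<Psi> \<union> \<Xi>" "finite \<Phi>0"
      have "\<Phi>0 \<inter> \<Xi> \<subseteq> ?F" "finite (\<Phi>0 \<inter> \<Xi>)" using \<Phi>0 by (auto simp: \<Xi>_def)
      from fmls_conj_exists[OF this(2,1)] obtain q where q: "q \<in> ?F"
        "\<And>s. sat C UNIV s q \<longleftrightarrow> (\<forall>p\<in>\<Phi>0 \<inter> \<Xi>. sat C UNIV s p)" by blast
      have "sat C UNIV (env f' id) q" unfolding q(2) by (simp add: \<Xi>_def)
      \<comment> \<open>If \<open>q\<close> failed throughout the projection, its negation would hold of \<open>f'\<close>.\<close>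
      then have "Neg q \<notin> \<Phi>" using f'(2) by auto
      then obtain f where f: "f \<in> fst ` R" "sat C UNIV (env f id) q"
        using q(1) by (auto simp: \<Phi>_def fmls_Neg)
      then obtain g where fg: "f \<in> G" "g \<in> G" "\<forall>p\<in>\<Psi>. sat C UNIV (env f g) p"
        by (auto simp: R)
      have "sat C UNIV (env f g) q" using f(2) sat_env_first[OF q(1), of f id g] by simp
      then have "\<forall>p\<in>\<Phi>0. sat C UNIV (env f g) p"
        using fg(3) \<Phi>0(1) unfolding q(2) by blast
      then show "\<exists>f\<in>G. \<exists>g\<in>G. \<forall>p\<in>\<Phi>0. sat C UNIV (env f g) p" using fg by blast
    qed
    then obtain f g where fg: "f \<in> G" "g \<in> G" "\<forall>p\<in>\<Psi> \<union> \<Xi>. sat C UNIV (env f g) p" by blast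
    then have "(f, g) \<in> R" by (simp add: R)
    then have "f \<in> fst ` R" by force
    moreover have "equivalent_over A0 f f'"
      unfolding equivalent_over_def
    proof (intro allI impI)
      fix p :: "('f, 'r, ('m + 'm, 'm) var) fm" assume p: "p \<in> ?F"
      have *: "sat C UNIV (env f id) q" if "q \<in> \<Xi>" for q
      proof -
        have "q \<in> ?F" "sat C UNIV (env f g) q" using that fg(3) by (auto simp: \<Xi>_def)
        then show ?thesis using sat_env_first[of q A0 A0 f g id] by simp
      qed
      have "p \<in> \<Xi> \<or> Neg p \<in> \<Xi>" using p by (auto simp: \<Xi>_def fmls_Neg)
      then show "sat C UNIV (env f id) p = sat C UNIV (env f' id) p"
        using *[of p] *[of "Neg p"] by (auto simp: \<Xi>_def)
    qed
    ultimately show ?thesis using saturated f'(1) by blast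
  qed
  note sat = this
  have "fst ` R \<times> G = sat_pairs \<Phi>"
  proof (intro Set.set_eqI iffI)
    fix x assume "x \<in> fst ` R \<times> G"
    then obtain f g where x: "x = (f, g)" "f \<in> fst ` R" "g \<in> G" by blast
    then have "\<forall>p\<in>\<Phi>. sat C UNIV (env f g) p"
      using sat_env_first[of _ A0 A0 f g id] unfolding \<Phi>_def by blast
    moreover have "f \<in> G" using x(2) by (auto simp: R)
    ultimately show "x \<in> sat_pairs \<Phi>"
      using x by simp
  next
    fix x assume "x \<in> sat_pairs \<Phi>"
    then obtain f g where x: "x = (f, g)" "f \<in> G" "g \<in> G" "\<forall>p\<in>\<Phi>. sat C UNIV (env f g) p"
      unfolding sat_pairs_def by blast
    then have "\<forall>p\<in>\<Phi>. sat C UNIV (env f id) p"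
      using sat_env_first[of _ A0 A0 f g id] unfolding \<Phi>_def by blast
    then show "x \<in> fst ` R \<times> G" using sat x by simp
  qed
  moreover have "\<Phi> \<subseteq> pair_fmls C A0" using F by (auto simp: \<Phi>_def)
  ultimately show ?thesis by (simp only: type_definableI)
qed

text \<open>By compactness a finite part of the definition of \<open>B\<close> already contradicts that of \<open>B'\<close>; the
  set \<open>D\<close> it defines is clopen. The second coordinate is fixed to be the identity.\<close>

lemma type_definable_separation:
  assumes A: "|A| <o \<kappa>" and B: "type_definable_set A B" "type_definable_set A B'" "B \<inter> B' = {}"
  shows "\<exists>D\<subseteq>G. type_definable_set A D \<and> type_definable_set A (G - D) \<and> B \<subseteq> D \<and> D \<inter> B' = {}"
proof -
  from B obtain \<Phi> \<Psi> where \<Phi>: "\<Phi> \<subseteq> pair_fmls C A" "\<Psi> \<subseteq> pair_fmls C A"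
    and eq: "B \<times> G = sat_pairs \<Phi>"
      "B' \<times> G = sat_pairs \<Psi>"
    unfolding type_definable_def by blast
  have "\<not> (\<exists>f\<in>G. \<exists>g\<in>G. \<forall>p\<in>\<Phi> \<union> \<Psi>. sat C UNIV (env f g) p)"
  proof
    assume "\<exists>f\<in>G. \<exists>g\<in>G. \<forall>p\<in>\<Phi> \<union> \<Psi>. sat C UNIV (env f g) p"
    then obtain f g where "f \<in> G" "g \<in> G" "\<forall>p\<in>\<Phi> \<union> \<Psi>. sat C UNIV (env f g) p" by blast
    then have "(f, g) \<in> B \<times> G" "(f, g) \<in> B' \<times> G" unfolding eq by auto
    then show False using B(3) by blast
  qed
  moreover have "\<Phi> \<union> \<Psi> \<subseteq> pair_fmls C A" using \<Phi> by blast
  ultimately obtain \<Xi> where \<Xi>: "\<Xi> \<subseteq> \<Phi> \<union> \<Psi>" "finite \<Xi>"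
    "\<not> (\<exists>f\<in>G. \<exists>g\<in>G. \<forall>p\<in>\<Xi>. sat C UNIV (env f g) p)"
    using compactness[OF A, of "\<Phi> \<union> \<Psi>"] by blast
  let ?\<Xi> = "\<Xi> \<inter> \<Phi>"
  have sub: "?\<Xi> \<subseteq> pair_fmls C A" "finite ?\<Xi>" using \<Phi> \<Xi> by auto
  let ?R = "sat_pairs ?\<Xi>"
  let ?N = "{(f, g). f \<in> G \<and> g \<in> G \<and> \<not> (\<forall>p\<in>?\<Xi>. sat C UNIV (env f g) p)}"
  let ?D = "{f \<in> G. (f, id) \<in> ?R}"
  have "type_definable A ?R" unfolding type_definable_def using sub(1) by blast
  from type_definable_specialize[OF this] have "type_definable_set A ?D" .
  moreover have "type_definable_set A (G - ?D)"
  proof -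
    have "G - ?D = {f \<in> G. (f, id) \<in> ?N}" using G_id by auto
    then show ?thesis
      using type_definable_specialize[OF type_definable_finite_fmls_compl[OF sub]] by simp
  qed
  moreover have "B \<subseteq> ?D"
  proof
    fix f assume "f \<in> B"
    then have "(f, id) \<in> B \<times> G" using G_id by simp
    then show "f \<in> ?D" unfolding eq using G_id by auto
  qed
  moreover have "?D \<inter> B' = {}"
  proof (rule ccontr)
    assume "?D \<inter> B' \<noteq> {}"
    then obtain f where f: "f \<in> ?D" "f \<in> B'" by blast
    then have "(f, id) \<in> B' \<times> G" using G_id by simp
    then have "\<forall>p\<in>\<Psi>. sat C UNIV (env f id) p" unfolding eq by auto
    moreover have "f \<in> G" "\<forall>p\<in>?\<Xi>. sat C UNIV (env f id) p" using f(1) by simp_all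
    ultimately have "\<forall>p\<in>\<Xi>. sat C UNIV (env f id) p" using \<Xi>(1) by blast
    then show False using \<Xi>(3) \<open>f \<in> G\<close> G_id by blast
  qed
  ultimately show ?thesis by (intro exI[of _ ?D]) auto
qed

end

section \<open>Compact normal group topologies\<close>

text \<open>The axiom \<open>quotient\<close> says that \<open>B A\<inverse>\<close> is closed when \<open>A\<close> and \<open>B\<close> are. It does the work of joint
  continuity of the multiplication, which makes products of compact sets compact.\<close>

locale group_topology = group \<Gamma> for \<Gamma> (structure) +
  fixes X :: "'a topology"
  assumes topspace: "topspace X = carrier \<Gamma>"
    and left: "a \<in> carrier \<Gamma> \<Longrightarrow> closedin X B \<Longrightarrow> closedin X {x \<in> carrier \<Gamma>. a \<otimes> x \<in> B}"
    and right: "a \<in> carrier \<Gamma> \<Longrightarrow> closedin X B \<Longrightarrow> closedin X {x \<in> carrier \<Gamma>. x \<otimes> a \<in> B}"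
    and inverse: "closedin X B \<Longrightarrow> closedin X {x \<in> carrier \<Gamma>. inv x \<in> B}"
    and quotient: "closedin X A \<Longrightarrow> closedin X B \<Longrightarrow>
      closedin X {x \<in> carrier \<Gamma>. \<exists>y\<in>B. inv x \<otimes> y \<in> A}"
begin

abbreviation cl_one :: "'a set" where "cl_one \<equiv> X closure_of {\<one>}"

abbreviation component :: "'a set" where "component \<equiv> connected_component_of_set X \<one>"

definition open_subgroup :: "'a set \<Rightarrow> bool" where
  "open_subgroup V \<longleftrightarrow> subgroup V \<Gamma> \<and> openin X V"

lemma closed_subset: "closedin X B \<Longrightarrow> B \<subseteq> carrier \<Gamma>"
  using closedin_subset topspace by blast

lemma cl_one_subset: "cl_one \<subseteq> carrier \<Gamma>"
  using closure_of_subset_topspace topspace by metis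

lemma one_in_cl_one: "\<one> \<in> cl_one"
  using closure_of_subset[of "{\<one>}" X] topspace by simp

lemma cl_one_minimal: "closedin X B \<Longrightarrow> \<one> \<in> B \<Longrightarrow> cl_one \<subseteq> B"
  by (intro closure_of_minimal) auto

text \<open>The set of \<open>x\<close> with \<open>x \<otimes> b \<in> B\<close> is closed and contains the identity.\<close>

lemma closed_cl_one_mult:
  assumes B: "closedin X B" and "b \<in> B" "h \<in> cl_one"
  shows "h \<otimes> b \<in> B" "b \<otimes> h \<in> B"
proof -
  have b: "b \<in> carrier \<Gamma>" using assms closed_subset by blast
  have "cl_one \<subseteq> {x \<in> carrier \<Gamma>. x \<otimes> b \<in> B}"
    using b assms(2) by (intro cl_one_minimal right B) simp_all
  moreover have "cl_one \<subseteq> {x \<in> carrier \<Gamma>. b \<otimes> x \<in> B}"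
    using b assms(2) by (intro cl_one_minimal left B) simp_all
  ultimately show "h \<otimes> b \<in> B" "b \<otimes> h \<in> B" using assms(3) by blast+
qed

lemma cl_one_inv: "h \<in> cl_one \<Longrightarrow> inv h \<in> cl_one"
proof -
  have "cl_one \<subseteq> {x \<in> carrier \<Gamma>. inv x \<in> cl_one}"
    by (intro cl_one_minimal inverse) (simp_all add: one_in_cl_one)
  then show "h \<in> cl_one \<Longrightarrow> inv h \<in> cl_one" by blast
qed

lemma cl_one_conj:
  assumes a: "a \<in> carrier \<Gamma>" and h: "h \<in> cl_one"
  shows "a \<otimes> h \<otimes> inv a \<in> cl_one"
proof -
  have "closedin X {x \<in> carrier \<Gamma>. a \<otimes> x \<in> {y \<in> carrier \<Gamma>. y \<otimes> inv a \<in> cl_one}}"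
    using a by (intro left right) simp_all
  moreover have "\<one> \<in> {x \<in> carrier \<Gamma>. a \<otimes> x \<in> {y \<in> carrier \<Gamma>. y \<otimes> inv a \<in> cl_one}}"
    using a by (simp add: one_in_cl_one)
  ultimately have "cl_one \<subseteq> {x \<in> carrier \<Gamma>. a \<otimes> x \<in> {y \<in> carrier \<Gamma>. y \<otimes> inv a \<in> cl_one}}"
    by (rule cl_one_minimal)
  then show ?thesis using h by blast
qed

lemma open_translate:
  assumes a: "a \<in> carrier \<Gamma>" and U: "openin X U"
  shows "openin X {x \<in> carrier \<Gamma>. a \<otimes> x \<in> U}" "openin X {x \<in> carrier \<Gamma>. x \<otimes> a \<in> U}"
proof -
  have c: "closedin X (carrier \<Gamma> - U)"
    using closedin_diff[OF closedin_topspace U] by (simp only: topspace)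
  have "{x \<in> carrier \<Gamma>. a \<otimes> x \<in> U} = carrier \<Gamma> - {x \<in> carrier \<Gamma>. a \<otimes> x \<in> carrier \<Gamma> - U}"
    using a by auto
  moreover have "{x \<in> carrier \<Gamma>. x \<otimes> a \<in> U} = carrier \<Gamma> - {x \<in> carrier \<Gamma>. x \<otimes> a \<in> carrier \<Gamma> - U}"
    using a by auto
  moreover have "openin X (carrier \<Gamma> - {x \<in> carrier \<Gamma>. a \<otimes> x \<in> carrier \<Gamma> - U})"
    using openin_diff[OF openin_topspace left[OF a c]] by (simp only: topspace)
  moreover have "openin X (carrier \<Gamma> - {x \<in> carrier \<Gamma>. x \<otimes> a \<in> carrier \<Gamma> - U})"
    using openin_diff[OF openin_topspace right[OF a c]] by (simp only: topspace)
  ultimately show "openin X {x \<in> carrier \<Gamma>. a \<otimes> x \<in> U}" "openin X {x \<in> carrier \<Gamma>. x \<otimes> a \<in> U}"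
    by (simp_all only:)
qed

lemma open_subgroup_closed:
  assumes V: "open_subgroup V" shows "closedin X V"
proof -
  interpret V: subgroup V \<Gamma> using V by (simp add: open_subgroup_def)
  have "carrier \<Gamma> - V = (\<Union>a\<in>carrier \<Gamma> - V. {x \<in> carrier \<Gamma>. inv a \<otimes> x \<in> V})"
  proof (intro Set.set_eqI iffI)
    fix x assume "x \<in> carrier \<Gamma> - V"
    then show "x \<in> (\<Union>a\<in>carrier \<Gamma> - V. {x \<in> carrier \<Gamma>. inv a \<otimes> x \<in> V})"
      by (intro UN_I[of x]) auto
  next
    fix x assume "x \<in> (\<Union>a\<in>carrier \<Gamma> - V. {x \<in> carrier \<Gamma>. inv a \<otimes> x \<in> V})"
    then obtain a where a: "a \<in> carrier \<Gamma>" "a \<notin> V" "x \<in> carrier \<Gamma>" "inv a \<otimes> x \<in> V" by blast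
    have "x \<notin> V"
    proof
      assume "x \<in> V"
      then have "x \<otimes> inv (inv a \<otimes> x) \<in> V" using a by blast
      then show False using a by (simp add: inv_mult_group m_assoc[symmetric])
    qed
    then show "x \<in> carrier \<Gamma> - V" using a by blast
  qed
  also have "openin X \<dots>"
    using V by (intro openin_Union) (auto simp: open_subgroup_def intro!: open_translate)
  finally show ?thesis
    using topspace V.subset by (simp add: closedin_def)
qed

text \<open>The subgroup is the stabilizer of \<open>U\<close> under left translation. It is open because the set of
  \<open>g\<close> for which \<open>g\<inverse>\<close> moves a point of \<open>U\<close> out of \<open>U\<close>, or a point of the complement into \<open>U\<close>, is a union
  of two quotients of closed sets.\<close>

lemma clopen_contains_open_subgroup:
  assumes U: "closedin X U" "openin X U" "\<one> \<in> U"
  obtains V where "open_subgroup V" "V \<subseteq> U"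
proof -
  have sub: "U \<subseteq> carrier \<Gamma>" using closed_subset U by blast
  have U': "closedin X (carrier \<Gamma> - U)"
    using closedin_diff[OF closedin_topspace U(2)] by (simp only: topspace)
  define V where "V = {g \<in> carrier \<Gamma>. \<forall>u\<in>carrier \<Gamma>. inv g \<otimes> u \<in> U \<longleftrightarrow> u \<in> U}"
  have "subgroup V \<Gamma>"
  proof
    show "V \<subseteq> carrier \<Gamma>" by (auto simp: V_def)
    show "\<one> \<in> V" by (simp add: V_def)
    fix g assume g: "g \<in> V"
    then have gc: "g \<in> carrier \<Gamma>" by (simp add: V_def)
    have "g \<otimes> u \<in> U \<longleftrightarrow> u \<in> U" if u: "u \<in> carrier \<Gamma>" for u
    proof -
      have "inv g \<otimes> (g \<otimes> u) \<in> U \<longleftrightarrow> g \<otimes> u \<in> U"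
        using g gc u by (simp add: V_def del: inv_solve_left)
      then show ?thesis using gc u by (simp add: m_assoc[symmetric])
    qed
    then show "inv g \<in> V" using gc by (simp add: V_def)
    fix h assume h: "h \<in> V"
    then have hc: "h \<in> carrier \<Gamma>" by (simp add: V_def)
    have "inv (g \<otimes> h) \<otimes> u \<in> U \<longleftrightarrow> u \<in> U" if u: "u \<in> carrier \<Gamma>" for u
    proof -
      have "inv (g \<otimes> h) \<otimes> u = inv h \<otimes> (inv g \<otimes> u)"
        using gc hc u by (simp add: inv_mult_group m_assoc)
      also have "\<dots> \<in> U \<longleftrightarrow> inv g \<otimes> u \<in> U"
        using h gc u unfolding V_def by blast
      also have "\<dots> \<longleftrightarrow> u \<in> U"
        using g u unfolding V_def by blast
      finally show ?thesis .
    qed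
    then show "g \<otimes> h \<in> V" using gc hc by (simp add: V_def)
  qed
  moreover have "openin X V"
  proof -
    let ?F = "\<lambda>A B. {x \<in> carrier \<Gamma>. \<exists>y\<in>B. inv x \<otimes> y \<in> A}"
    have "closedin X (?F (carrier \<Gamma> - U) U \<union> ?F U (carrier \<Gamma> - U))"
      by (intro closedin_Un quotient U U')
    then have "openin X (carrier \<Gamma> - (?F (carrier \<Gamma> - U) U \<union> ?F U (carrier \<Gamma> - U)))"
      unfolding topspace[symmetric] by (rule openin_diff[OF openin_topspace])
    moreover have "carrier \<Gamma> - (?F (carrier \<Gamma> - U) U \<union> ?F U (carrier \<Gamma> - U)) = V"
    proof (intro Set.set_eqI iffI)
      fix g assume g: "g \<in> carrier \<Gamma> - (?F (carrier \<Gamma> - U) U \<union> ?F U (carrier \<Gamma> - U))"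
      then have "inv g \<otimes> u \<in> U \<longleftrightarrow> u \<in> U" if "u \<in> carrier \<Gamma>" for u
        using that by auto
      then show "g \<in> V" using g by (auto simp: V_def)
    next
      fix g assume "g \<in> V"
      then show "g \<in> carrier \<Gamma> - (?F (carrier \<Gamma> - U) U \<union> ?F U (carrier \<Gamma> - U))"
        using sub by (auto simp: V_def)
    qed
    ultimately show ?thesis by (simp only:)
  qed
  moreover have "V \<subseteq> U"
  proof
    fix g assume g: "g \<in> V"
    then have "inv g \<otimes> g \<in> U \<longleftrightarrow> g \<in> U" unfolding V_def by blast
    then show "g \<in> U" using g U(3) by (simp add: V_def)
  qed
  ultimately show ?thesis using that by (simp add: open_subgroup_def)
qed

end

locale compact_group_topology = group_topology +
  assumes compact: "compact_space X" and normal: "normal_space X"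
begin

text \<open>In compact normal spaces components are intersections of clopen sets.\<close>

lemma component_eq: "component = {x \<in> carrier \<Gamma>. \<forall>V. open_subgroup V \<longrightarrow> x \<in> V}"
proof -
  have "component = {x. quasi_component_of X \<one> x}"
    using quasi_eq_connected_component_of[of X \<one>] compact normal by simp
  also have "\<dots> = {x \<in> carrier \<Gamma>. \<forall>V. open_subgroup V \<longrightarrow> x \<in> V}"
  proof (intro Set.set_eqI iffI)
    fix x assume "x \<in> {x. quasi_component_of X \<one> x}"
    then have x: "x \<in> carrier \<Gamma>" "\<And>T. \<one> \<in> T \<Longrightarrow> closedin X T \<Longrightarrow> openin X T \<Longrightarrow> x \<in> T"
      using topspace by (auto simp: quasi_component_of)
    have "x \<in> V" if "open_subgroup V" for V
      using that x(2)[of V] open_subgroup_closed[OF that] subgroup.one_closed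
      by (auto simp: open_subgroup_def)
    then show "x \<in> {x \<in> carrier \<Gamma>. \<forall>V. open_subgroup V \<longrightarrow> x \<in> V}" using x(1) by blast
  next
    fix x assume x: "x \<in> {x \<in> carrier \<Gamma>. \<forall>V. open_subgroup V \<longrightarrow> x \<in> V}"
    have "x \<in> T" if T: "\<one> \<in> T" "closedin X T" "openin X T" for T
    proof -
      obtain V where "open_subgroup V" "V \<subseteq> T"
        using clopen_contains_open_subgroup[OF T(2,3,1)] by blast
      then show ?thesis using x by blast
    qed
    then show "x \<in> {x. quasi_component_of X \<one> x}"
      using x topspace by (auto simp: quasi_component_of)
  qed
  finally show ?thesis .
qed

text \<open>The sets of \<open>l \<in> L\<close> with \<open>x l\<inverse> \<in> V\<close> are closed, nonempty and directed, since an intersection of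
  two open subgroups is one; by compactness some \<open>l\<close> works for all \<open>V\<close> simultaneously.\<close>

lemma component_coset:
  assumes L: "closedin X L" and x: "x \<in> carrier \<Gamma>"
    and V: "\<And>V. open_subgroup V \<Longrightarrow> \<exists>l\<in>L. x \<otimes> inv l \<in> V"
  shows "\<exists>l\<in>L. x \<otimes> inv l \<in> component"
proof -
  define F where "F = (\<lambda>V. {l \<in> L. x \<otimes> inv l \<in> V})"
  have Lc: "L \<subseteq> carrier \<Gamma>" using L closed_subset by blast
  have closed: "closedin X (F V)" if "open_subgroup V" for V
  proof -
    have "F V = L \<inter> {l \<in> carrier \<Gamma>. inv l \<in> {y \<in> carrier \<Gamma>. x \<otimes> y \<in> V}}"
      using Lc by (auto simp: F_def)
    also have "closedin X \<dots>"
      by (intro closedin_Int L inverse left x open_subgroup_closed that)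
    finally show ?thesis .
  qed
  have "\<Inter> (F ` Collect open_subgroup) \<noteq> {}"
  proof (rule compact[unfolded compact_space_fip, rule_format], intro conjI ballI allI impI)
    fix A assume "A \<in> F ` Collect open_subgroup"
    then show "closedin X A" using closed by blast
  next
    fix \<F> assume \<F>: "finite \<F> \<and> \<F> \<subseteq> F ` Collect open_subgroup"
    then obtain \<V> where \<V>: "\<V> \<subseteq> Collect open_subgroup" "finite \<V>" "\<F> = F ` \<V>"
      using finite_subset_image by metis
    show "\<Inter> \<F> \<noteq> {}"
    proof (cases "\<V> = {}")
      case False
      have "open_subgroup (\<Inter> \<V>)"
        using \<V> False by (auto simp: open_subgroup_def intro!: subgroups_Inter openin_Inter)
      then obtain l where "l \<in> L" "x \<otimes> inv l \<in> \<Inter> \<V>" using V by blast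
      then have "l \<in> \<Inter> \<F>" using \<V>(3) by (auto simp: F_def)
      then show ?thesis by blast
    qed (use \<V> in simp)
  qed
  moreover have "open_subgroup (carrier \<Gamma>)"
    using topspace openin_topspace[of X] by (simp add: open_subgroup_def subgroup_self)
  ultimately obtain l where "l \<in> L" "\<And>V. open_subgroup V \<Longrightarrow> x \<otimes> inv l \<in> V"
    by (auto simp: F_def)
  moreover have "x \<otimes> inv l \<in> carrier \<Gamma>" using calculation(1) Lc x by blast
  ultimately show ?thesis unfolding component_eq by blast
qed

end

section \<open>Pulling back a topology along a surjection\<close>

text \<open>The points of a Galois group are cosets. Pulling its topology back to the group of
  automorphisms gives a topology without separation, whose closures and components of points are
  the preimages of those in the Galois group. Both Galois groups thus live on the same set.\<close>

lemma pullback_closedin: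
  assumes "f ` A \<subseteq> topspace T"
  shows "closedin (pullback_topology A f T) B \<longleftrightarrow> (\<exists>D. closedin T D \<and> B = f -` D \<inter> A)"
proof
  assume B: "closedin (pullback_topology A f T) B"
  then have "openin (pullback_topology A f T) (f -` topspace T \<inter> A - B)"
    by (simp add: closedin_def topspace_pullback_topology)
  then obtain U where U: "openin T U" "f -` topspace T \<inter> A - B = f -` U \<inter> A"
    unfolding openin_pullback_topology by blast
  have "B \<subseteq> A" using closedin_subset[OF B] by (simp add: topspace_pullback_topology)
  then have "B = f -` (topspace T - U) \<inter> A" using U(2) assms by blast
  then show "\<exists>D. closedin T D \<and> B = f -` D \<inter> A" using U(1) by blast
next
  assume "\<exists>D. closedin T D \<and> B = f -` D \<inter> A"
  then obtain D where D: "closedin T D" "B = f -` D \<inter> A" by blast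
  have "f -` topspace T \<inter> A - B = f -` (topspace T - D) \<inter> A" using D(2) by blast
  moreover have "openin T (topspace T - D)" using D(1) by blast
  ultimately have "openin (pullback_topology A f T) (f -` topspace T \<inter> A - B)"
    unfolding openin_pullback_topology by blast
  then show "closedin (pullback_topology A f T) B"
    using D assms unfolding closedin_def topspace_pullback_topology by blast
qed

lemma pullback_closure_singleton:
  assumes "f ` A \<subseteq> topspace T" "a \<in> A" "x \<in> A"
  shows "x \<in> pullback_topology A f T closure_of {a} \<longleftrightarrow> f x \<in> T closure_of {f a}"
proof -
  let ?P = "pullback_topology A f T"
  have "(\<forall>E. x \<in> E \<and> openin ?P E \<longrightarrow> a \<in> E) \<longleftrightarrow> (\<forall>U. f x \<in> U \<and> openin T U \<longrightarrow> f a \<in> U)"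
  proof (intro iffI allI impI)
    fix U assume H: "\<forall>E. x \<in> E \<and> openin ?P E \<longrightarrow> a \<in> E" and U: "f x \<in> U \<and> openin T U"
    then have "openin ?P (f -` U \<inter> A)" unfolding openin_pullback_topology by blast
    moreover have "x \<in> f -` U \<inter> A" using U assms(3) by blast
    ultimately have "a \<in> f -` U \<inter> A" by (intro H[rule_format] conjI)
    then show "f a \<in> U" by simp
  next
    fix E assume H: "\<forall>U. f x \<in> U \<and> openin T U \<longrightarrow> f a \<in> U" and E: "x \<in> E \<and> openin ?P E"
    then obtain U where "openin T U" "E = f -` U \<inter> A" unfolding openin_pullback_topology by blast
    then show "a \<in> E" using H[rule_format, of U] E assms(2) by simp
  qed
  moreover have "x \<in> topspace ?P" "f x \<in> topspace T"
    using assms by (auto simp: topspace_pullback_topology)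
  ultimately show ?thesis by (simp add: in_closure_of)
qed

lemma pullback_connected_component:
  assumes f: "f ` A = topspace T" and xy: "x \<in> A" "y \<in> A"
  shows "connected_component_of (pullback_topology A f T) x y \<longleftrightarrow> connected_component_of T (f x) (f y)"
proof
  let ?P = "pullback_topology A f T"
  have "continuous_map ?P T f"
    using f by (auto simp: continuous_map_def topspace_pullback_topology openin_pullback_topology)
  then show "connected_component_of T (f x) (f y)" if "connected_component_of ?P x y"
    using that connectedin_continuous_map_image unfolding connected_component_of_def
    by (metis imageI)
  assume "connected_component_of T (f x) (f y)"
  then obtain S where S: "connectedin T S" "f x \<in> S" "f y \<in> S"
    unfolding connected_component_of_def by blast
  have St: "S \<subseteq> f ` A" using connectedin_subset_topspace[OF S(1)] f by simp
  have "connectedin ?P (f -` S \<inter> A)"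
    unfolding connectedin
  proof (intro conjI notI)
    show "f -` S \<inter> A \<subseteq> topspace ?P" using f by (auto simp: topspace_pullback_topology)
    assume "\<exists>E1 E2. openin ?P E1 \<and> openin ?P E2 \<and> f -` S \<inter> A \<subseteq> E1 \<union> E2 \<and>
      E1 \<inter> E2 \<inter> (f -` S \<inter> A) = {} \<and> E1 \<inter> (f -` S \<inter> A) \<noteq> {} \<and> E2 \<inter> (f -` S \<inter> A) \<noteq> {}"
    then obtain U1 U2 where U: "openin T U1" "openin T U2"
      and E: "f -` S \<inter> A \<subseteq> (f -` U1 \<inter> A) \<union> (f -` U2 \<inter> A)"
        "(f -` U1 \<inter> A) \<inter> (f -` U2 \<inter> A) \<inter> (f -` S \<inter> A) = {}"
        "(f -` U1 \<inter> A) \<inter> (f -` S \<inter> A) \<noteq> {}" "(f -` U2 \<inter> A) \<inter> (f -` S \<inter> A) \<noteq> {}"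
      unfolding openin_pullback_topology by blast
    have "S \<subseteq> U1 \<union> U2" "U1 \<inter> U2 \<inter> S = {}" "U1 \<inter> S \<noteq> {}" "U2 \<inter> S \<noteq> {}"
      using E St by blast+
    then show False using S(1) U unfolding connectedin by blast
  qed
  then show "connected_component_of ?P x y"
    using S xy unfolding connected_component_of_def by blast
qed

section \<open>Quotients of logic topologies\<close>

text \<open>The formulas form a base since they are closed under conjunction.\<close>

lemma openin_logic_topology:
  assumes sub: "\<And>p. p \<in> S \<Longrightarrow> p \<subseteq> F"
    and conj: "\<And>\<phi> \<psi>. \<phi> \<in> F \<Longrightarrow> \<psi> \<in> F \<Longrightarrow> \<exists>\<theta>\<in>F. \<forall>p\<in>S. \<theta> \<in> p \<longleftrightarrow> \<phi> \<in> p \<and> \<psi> \<in> p"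
  shows "openin (logic_topology S) U \<longleftrightarrow>
    U \<subseteq> S \<and> (\<forall>p\<in>U. \<exists>\<phi>\<in>F. \<phi> \<in> p \<and> (\<forall>p'\<in>S. \<phi> \<in> p' \<longrightarrow> p' \<in> U))"
proof
  assume "openin (logic_topology S) U"
  then have "generate_topology_on {{p \<in> S. \<phi> \<in> p} |\<phi>. True} U"
    unfolding logic_topology_def by (rule openin_topology_generated_by)
  then show "U \<subseteq> S \<and> (\<forall>p\<in>U. \<exists>\<phi>\<in>F. \<phi> \<in> p \<and> (\<forall>p'\<in>S. \<phi> \<in> p' \<longrightarrow> p' \<in> U))"
  proof induction
    case (Int a b)
    have "\<exists>\<theta>\<in>F. \<theta> \<in> p \<and> (\<forall>p'\<in>S. \<theta> \<in> p' \<longrightarrow> p' \<in> a \<inter> b)" if p: "p \<in> a \<inter> b" for p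
    proof -
      from p have "p \<in> a" "p \<in> b" by simp_all
      from this(1) Int.IH(1) obtain \<phi> where \<phi>: "\<phi> \<in> F" "\<phi> \<in> p" "\<forall>p'\<in>S. \<phi> \<in> p' \<longrightarrow> p' \<in> a"
        by meson
      from \<open>p \<in> b\<close> Int.IH(2) obtain \<psi> where \<psi>: "\<psi> \<in> F" "\<psi> \<in> p" "\<forall>p'\<in>S. \<psi> \<in> p' \<longrightarrow> p' \<in> b"
        by meson
      from conj[OF \<phi>(1) \<psi>(1)] obtain \<theta> where \<theta>: "\<theta> \<in> F" "\<forall>p\<in>S. \<theta> \<in> p \<longleftrightarrow> \<phi> \<in> p \<and> \<psi> \<in> p" by blast
      moreover have "p \<in> S" using p Int.IH by blast
      ultimately show ?thesis using \<phi> \<psi> by (intro bexI[of _ \<theta>]) auto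
    qed
    then show ?case using Int.IH by blast
  next
    case (UN K)
    have "\<exists>\<phi>\<in>F. \<phi> \<in> p \<and> (\<forall>p'\<in>S. \<phi> \<in> p' \<longrightarrow> p' \<in> \<Union> K)" if p: "p \<in> \<Union> K" for p
    proof -
      from p obtain k where k: "k \<in> K" "p \<in> k" by blast
      with UN.IH[OF k(1)] obtain \<phi> where "\<phi> \<in> F" "\<phi> \<in> p" "\<forall>p'\<in>S. \<phi> \<in> p' \<longrightarrow> p' \<in> k"
        by meson
      with k(1) show ?thesis by (intro bexI[of _ \<phi>]) auto
    qed
    moreover have "\<Union> K \<subseteq> S"
      by (rule Union_least) (simp add: UN.IH)
    ultimately show ?case by simp
  next
    case (Basis s)
    then obtain \<phi> where s: "s = {p \<in> S. \<phi> \<in> p}" by blast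
    have "\<phi> \<in> F" if "p \<in> s" for p
      using that sub unfolding s by (auto dest: subsetD)
    then show ?case using s by auto
  qed simp
next
  assume U: "U \<subseteq> S \<and> (\<forall>p\<in>U. \<exists>\<phi>\<in>F. \<phi> \<in> p \<and> (\<forall>p'\<in>S. \<phi> \<in> p' \<longrightarrow> p' \<in> U))"
  let ?\<B> = "{{p \<in> S. \<phi> \<in> p} |\<phi>. {p \<in> S. \<phi> \<in> p} \<subseteq> U}"
  have "openin (logic_topology S) (\<Union> ?\<B>)"
    unfolding logic_topology_def by (rule openin_Union) (auto intro: topology_generated_by_Basis)
  moreover have "\<Union> ?\<B> = U"
  proof
    show "U \<subseteq> \<Union> ?\<B>"
    proof
      fix p assume p: "p \<in> U"
      then obtain \<phi> where "\<phi> \<in> p" "\<forall>p'\<in>S. \<phi> \<in> p' \<longrightarrow> p' \<in> U" using U by blast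
      then have "{p \<in> S. \<phi> \<in> p} \<in> ?\<B>" "p \<in> {p \<in> S. \<phi> \<in> p}" using U p by auto
      then show "p \<in> \<Union> ?\<B>" by (rule UnionI)
    qed
  qed blast
  ultimately show "openin (logic_topology S) U" by simp
qed

lemma topspace_quotient_topology: "topspace (quotient_topology X q) = q ` topspace X"
proof
  show "topspace (quotient_topology X q) \<subseteq> q ` topspace X"
    using openin_topspace[of "quotient_topology X q"] unfolding openin_quotient_topology by blast
  have "{x \<in> topspace X. q x \<in> q ` topspace X} = topspace X" by blast
  then have "openin (quotient_topology X q) (q ` topspace X)"
    unfolding openin_quotient_topology by simp
  then show "q ` topspace X \<subseteq> topspace (quotient_topology X q)" by (rule openin_subset)
qed

text \<open>A set of cosets is closed iff membership of the coset of \<open>g\<close> is given by a set of formulas in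
  the type \<open>t g\<close>. The assumption \<open>wd\<close> makes the map from types to cosets well defined.\<close>

lemma type_quotient_topology_closed:
  fixes \<Gamma> :: "('g, 'z) monoid_scheme" (structure) and H :: "'g set" and t :: "'g \<Rightarrow> 'p set"
  assumes sub: "\<And>g. g \<in> carrier \<Gamma> \<Longrightarrow> t g \<subseteq> F"
    and neg: "\<And>\<phi>. \<phi> \<in> F \<Longrightarrow> \<exists>\<psi>\<in>F. \<forall>g\<in>carrier \<Gamma>. \<psi> \<in> t g \<longleftrightarrow> \<phi> \<notin> t g"
    and conj: "\<And>\<phi> \<psi>. \<phi> \<in> F \<Longrightarrow> \<psi> \<in> F \<Longrightarrow>
      \<exists>\<theta>\<in>F. \<forall>g\<in>carrier \<Gamma>. \<theta> \<in> t g \<longleftrightarrow> \<phi> \<in> t g \<and> \<psi> \<in> t g"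
    and ne: "F \<noteq> {}"
    and wd: "\<And>g h. g \<in> carrier \<Gamma> \<Longrightarrow> h \<in> carrier \<Gamma> \<Longrightarrow> t g = t h \<Longrightarrow> H #> g = H #> h"
  shows "topspace (type_quotient_topology \<Gamma> H t) = (\<lambda>g. H #> g) ` carrier \<Gamma>"
    and "closedin (type_quotient_topology \<Gamma> H t) A \<longleftrightarrow> A \<subseteq> (\<lambda>g. H #> g) ` carrier \<Gamma> \<and>
      (\<exists>\<Phi>\<subseteq>F. \<forall>g\<in>carrier \<Gamma>. H #> g \<in> A \<longleftrightarrow> (\<forall>\<phi>\<in>\<Phi>. \<phi> \<in> t g))"
proof -
  define q where "q = (\<lambda>p. the_elem {H #> g | g. g \<in> carrier \<Gamma> \<and> t g = p})"
  define Y where "Y = quotient_topology (logic_topology (t ` carrier \<Gamma>)) q"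
  have Y: "type_quotient_topology \<Gamma> H t = Y"
    by (simp add: type_quotient_topology_def Y_def q_def)
  have q: "q (t g) = H #> g" if g: "g \<in> carrier \<Gamma>" for g
  proof -
    have "{H #> h | h. h \<in> carrier \<Gamma> \<and> t h = t g} = {H #> g}"
      using wd g by blast
    then show ?thesis by (simp add: q_def)
  qed
  let ?S = "t ` carrier \<Gamma>"
  have openin_iff: "openin (logic_topology ?S) U \<longleftrightarrow>
    U \<subseteq> ?S \<and> (\<forall>p\<in>U. \<exists>\<phi>\<in>F. \<phi> \<in> p \<and> (\<forall>p'\<in>?S. \<phi> \<in> p' \<longrightarrow> p' \<in> U))" for U
  proof (rule openin_logic_topology)
    show "p \<subseteq> F" if "p \<in> ?S" for p using that sub by blast
    show "\<exists>\<theta>\<in>F. \<forall>p\<in>?S. \<theta> \<in> p \<longleftrightarrow> \<phi> \<in> p \<and> \<psi> \<in> p" if "\<phi> \<in> F" "\<psi> \<in> F" for \<phi> \<psi>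
      using conj[OF that] by simp
  qed
  have top: "topspace (logic_topology ?S) = ?S"
  proof
    show "topspace (logic_topology ?S) \<subseteq> ?S"
      using openin_iff[of "topspace (logic_topology ?S)"] by simp
    have "\<exists>\<phi>\<in>F. \<phi> \<in> p" if "p \<in> ?S" for p
    proof -
      obtain \<phi> where \<phi>: "\<phi> \<in> F" using ne by blast
      then show ?thesis using neg[OF \<phi>] that by blast
    qed
    then have "openin (logic_topology ?S) ?S" unfolding openin_iff by blast
    then show "?S \<subseteq> topspace (logic_topology ?S)" by (rule openin_subset)
  qed
  have topY: "topspace Y = (\<lambda>g. H #> g) ` carrier \<Gamma>"
    unfolding Y_def topspace_quotient_topology top image_image by (rule image_cong) (simp_all add: q)
  then show "topspace (type_quotient_topology \<Gamma> H t) = (\<lambda>g. H #> g) ` carrier \<Gamma>"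
    by (simp add: Y)
  have openY: "openin Y U \<longleftrightarrow> U \<subseteq> topspace Y \<and>
      (\<forall>g\<in>carrier \<Gamma>. H #> g \<in> U \<longrightarrow>
        (\<exists>\<phi>\<in>F. \<phi> \<in> t g \<and> (\<forall>g'\<in>carrier \<Gamma>. \<phi> \<in> t g' \<longrightarrow> H #> g' \<in> U)))" for U
  proof -
    have "topspace Y = q ` topspace (logic_topology ?S)"
      by (simp add: Y_def topspace_quotient_topology)
    then have "openin Y U \<longleftrightarrow> U \<subseteq> topspace Y \<and> openin (logic_topology ?S) {p \<in> ?S. q p \<in> U}"
      by (simp add: Y_def openin_quotient_topology top)
    also have "openin (logic_topology ?S) {p \<in> ?S. q p \<in> U} \<longleftrightarrow>
       (\<forall>g\<in>carrier \<Gamma>. q (t g) \<in> U \<longrightarrow>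
        (\<exists>\<phi>\<in>F. \<phi> \<in> t g \<and> (\<forall>g'\<in>carrier \<Gamma>. \<phi> \<in> t g' \<longrightarrow> q (t g') \<in> U)))"
      unfolding openin_iff by auto
    also have "\<dots> \<longleftrightarrow> (\<forall>g\<in>carrier \<Gamma>. H #> g \<in> U \<longrightarrow>
        (\<exists>\<phi>\<in>F. \<phi> \<in> t g \<and> (\<forall>g'\<in>carrier \<Gamma>. \<phi> \<in> t g' \<longrightarrow> H #> g' \<in> U)))"
      using q by (simp cong: ball_cong)
    finally show ?thesis .
  qed
  have "closedin Y A \<longleftrightarrow> A \<subseteq> topspace Y \<and>
      (\<exists>\<Phi>\<subseteq>F. \<forall>g\<in>carrier \<Gamma>. H #> g \<in> A \<longleftrightarrow> (\<forall>\<phi>\<in>\<Phi>. \<phi> \<in> t g))"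
  proof
    assume A: "closedin Y A"
    define \<Phi> where "\<Phi> = {\<psi> \<in> F. \<forall>g\<in>carrier \<Gamma>. H #> g \<in> A \<longrightarrow> \<psi> \<in> t g}"
    have "H #> g \<in> A" if g: "g \<in> carrier \<Gamma>" "\<forall>\<phi>\<in>\<Phi>. \<phi> \<in> t g" for g
    proof (rule ccontr)
      assume "H #> g \<notin> A"
      then have gU: "H #> g \<in> topspace Y - A" using g(1) topY by blast
      have "openin Y (topspace Y - A)" using A by blast
      with gU g(1) obtain \<phi> where \<phi>: "\<phi> \<in> F" "\<phi> \<in> t g"
        "\<And>g'. g' \<in> carrier \<Gamma> \<Longrightarrow> \<phi> \<in> t g' \<Longrightarrow> H #> g' \<in> topspace Y - A"
        unfolding openY by blast
      from neg[OF \<phi>(1)] obtain \<psi> where \<psi>: "\<psi> \<in> F"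
        "\<And>g. g \<in> carrier \<Gamma> \<Longrightarrow> \<psi> \<in> t g \<longleftrightarrow> \<phi> \<notin> t g" by blast
      have "\<psi> \<in> t g'" if "g' \<in> carrier \<Gamma>" "H #> g' \<in> A" for g'
        using \<psi>(2)[OF that(1)] \<phi>(3)[OF that(1)] that(2) by blast
      then have "\<psi> \<in> \<Phi>" using \<psi>(1) by (simp add: \<Phi>_def)
      then show False using \<psi>(2)[OF g(1)] \<phi>(2) g(2) by blast
    qed
    then have "\<forall>g\<in>carrier \<Gamma>. H #> g \<in> A \<longleftrightarrow> (\<forall>\<phi>\<in>\<Phi>. \<phi> \<in> t g)"
      by (auto simp: \<Phi>_def)
    moreover have "\<Phi> \<subseteq> F" by (auto simp: \<Phi>_def)
    ultimately show "A \<subseteq> topspace Y \<and>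
      (\<exists>\<Phi>\<subseteq>F. \<forall>g\<in>carrier \<Gamma>. H #> g \<in> A \<longleftrightarrow> (\<forall>\<phi>\<in>\<Phi>. \<phi> \<in> t g))"
      using closedin_subset[OF A] by blast
  next
    assume "A \<subseteq> topspace Y \<and>
      (\<exists>\<Phi>\<subseteq>F. \<forall>g\<in>carrier \<Gamma>. H #> g \<in> A \<longleftrightarrow> (\<forall>\<phi>\<in>\<Phi>. \<phi> \<in> t g))"
    then obtain \<Phi> where A: "A \<subseteq> topspace Y" and \<Phi>: "\<Phi> \<subseteq> F"
      "\<And>g. g \<in> carrier \<Gamma> \<Longrightarrow> H #> g \<in> A \<longleftrightarrow> (\<forall>\<phi>\<in>\<Phi>. \<phi> \<in> t g)" by blast
    have "\<exists>\<psi>\<in>F. \<psi> \<in> t g \<and> (\<forall>g'\<in>carrier \<Gamma>. \<psi> \<in> t g' \<longrightarrow> H #> g' \<in> topspace Y - A)"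
      if g: "g \<in> carrier \<Gamma>" "H #> g \<in> topspace Y - A" for g
    proof -
      obtain \<phi> where \<phi>: "\<phi> \<in> \<Phi>" "\<phi> \<notin> t g" using \<Phi>(2)[OF g(1)] g(2) by blast
      from neg[OF subsetD[OF \<Phi>(1) \<phi>(1)]] obtain \<psi>
        where \<psi>: "\<psi> \<in> F" "\<And>g. g \<in> carrier \<Gamma> \<Longrightarrow> \<psi> \<in> t g \<longleftrightarrow> \<phi> \<notin> t g"
        by blast
      have "H #> g' \<in> topspace Y - A" if "g' \<in> carrier \<Gamma>" "\<psi> \<in> t g'" for g'
        using \<Phi>(2)[OF that(1)] \<psi>(2)[OF that(1)] that topY \<phi>(1) by blast
      then show ?thesis using \<psi>(1) \<psi>(2)[OF g(1)] \<phi>(2) by blast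
    qed
    then have "openin Y (topspace Y - A)" unfolding openY by blast
    then show "closedin Y A" using A by (simp add: closedin_def)
  qed
  then show "closedin (type_quotient_topology \<Gamma> H t) A \<longleftrightarrow> A \<subseteq> (\<lambda>g. H #> g) ` carrier \<Gamma> \<and>
      (\<exists>\<Phi>\<subseteq>F. \<forall>g\<in>carrier \<Gamma>. H #> g \<in> A \<longleftrightarrow> (\<forall>\<phi>\<in>\<Phi>. \<phi> \<in> t g))"
    by (simp add: Y topY)
qed

context monster
begin

section \<open>Quotients of the automorphism group as topological groups\<close>

lemmas G_inverse = aut_inverse[OF G_aut]

lemma G_bij: "f \<in> G \<Longrightarrow> bij f"
  by (simp add: aut_over_def aut_def)

lemma finv_comp: "f \<in> G \<Longrightarrow> g \<in> G \<Longrightarrow> finv (f \<circ> g) = finv g \<circ> finv f"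
  by (simp add: o_inv_distrib G_bij)

lemma finv_finv: "f \<in> G \<Longrightarrow> finv (finv f) = f"
  by (simp add: inv_inv_eq G_bij)

lemma G_cancel: "f \<in> G \<Longrightarrow> finv f \<circ> (f \<circ> g) = g" "f \<in> G \<Longrightarrow> f \<circ> (finv f \<circ> g) = g"
  by (simp_all add: comp_assoc[symmetric] G_inverse)

lemma Aut_group_carrier [simp]: "carrier (Aut_group C e) = G"
  by (simp add: Aut_group_def)

lemma G_Bij: "f \<in> G \<Longrightarrow> f \<in> Bij UNIV"
  by (auto simp: Bij_def aut_over_def aut_def bij_def bij_betw_def)

lemma Aut_group_mult [simp]: "f \<in> G \<Longrightarrow> g \<in> G \<Longrightarrow> f \<otimes>\<^bsub>Aut_group C e\<^esub> g = f \<circ> g"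
  by (auto simp: Aut_group_def BijGroup_def G_Bij compose_def)

lemma Aut_group_one [simp]: "\<one>\<^bsub>Aut_group C e\<^esub> = id"
  by (auto simp: Aut_group_def BijGroup_def)

lemma group_Aut_group: "group (Aut_group C e)"
proof (rule groupI)
  fix f assume f: "f \<in> carrier (Aut_group C e)"
  then show "\<exists>g\<in>carrier (Aut_group C e). g \<otimes>\<^bsub>Aut_group C e\<^esub> f = \<one>\<^bsub>Aut_group C e\<^esub>"
    by (intro bexI[of _ "finv f"]) (simp_all add: G_inv G_inverse)
qed (simp_all add: G_comp G_id comp_assoc)

lemma Aut_group_inv [simp]: "f \<in> G \<Longrightarrow> inv\<^bsub>Aut_group C e\<^esub> f = finv f"
  by (rule group.inv_equality[OF group_Aut_group]) (simp_all add: G_inv G_inverse)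

lemma normal_facts:
  assumes "K \<lhd> Aut_group C e"
  shows normal_G: "\<And>k. k \<in> K \<Longrightarrow> k \<in> G" and normal_id: "id \<in> K"
    and normal_comp: "\<And>k l. k \<in> K \<Longrightarrow> l \<in> K \<Longrightarrow> k \<circ> l \<in> K"
    and normal_finv: "\<And>k. k \<in> K \<Longrightarrow> finv k \<in> K"
    and normal_conj: "\<And>f k. f \<in> G \<Longrightarrow> k \<in> K \<Longrightarrow> f \<circ> k \<circ> finv f \<in> K"
    and normal_conj': "\<And>f k. f \<in> G \<Longrightarrow> k \<in> K \<Longrightarrow> finv f \<circ> k \<circ> f \<in> K"
proof -
  interpret normal K "Aut_group C e" by fact
  show G: "\<And>k. k \<in> K \<Longrightarrow> k \<in> G" using mem_carrier by simp
  show "id \<in> K" using subgroup.one_closed[OF subgroup_axioms] by simp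
  show "\<And>k l. k \<in> K \<Longrightarrow> l \<in> K \<Longrightarrow> k \<circ> l \<in> K" using subgroup.m_closed[OF subgroup_axioms] G Aut_group_mult by metis
  show "\<And>k. k \<in> K \<Longrightarrow> finv k \<in> K" using subgroup.m_inv_closed[OF subgroup_axioms] G Aut_group_inv by metis
  show "f \<circ> k \<circ> finv f \<in> K" if "f \<in> G" "k \<in> K" for f k
    using inv_op_closed2[of f k] that by (simp add: G G_inv G_comp)
  show "finv f \<circ> k \<circ> f \<in> K" if "f \<in> G" "k \<in> K" for f k
    using inv_op_closed1[of f k] that by (simp add: G G_inv G_comp)
qed

lemma coset_eq_iff:
  assumes "K \<lhd> Aut_group C e" "f \<in> G" "g \<in> G"
  shows "K #>\<^bsub>Aut_group C e\<^esub> f = K #>\<^bsub>Aut_group C e\<^esub> g \<longleftrightarrow> f \<circ> finv g \<in> K"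
proof -
  interpret normal K "Aut_group C e" by fact
  interpret group "Aut_group C e" by (fact group_Aut_group)
  have "f \<circ> finv g \<in> K \<longleftrightarrow> f \<in> K #>\<^bsub>Aut_group C e\<^esub> g"
    using subgroup.rcos_module[OF subgroup_axioms group_Aut_group, of g f] assms(2,3)
    by (simp add: G_inv)
  also have "\<dots> \<longleftrightarrow> K #>\<^bsub>Aut_group C e\<^esub> f = K #>\<^bsub>Aut_group C e\<^esub> g"
  proof
    show "f \<in> K #>\<^bsub>Aut_group C e\<^esub> g \<Longrightarrow> K #>\<^bsub>Aut_group C e\<^esub> f = K #>\<^bsub>Aut_group C e\<^esub> g"
      using repr_independence[OF _ _ subgroup_axioms, of f g] assms(3) by simp
    show "K #>\<^bsub>Aut_group C e\<^esub> f = K #>\<^bsub>Aut_group C e\<^esub> g \<Longrightarrow> f \<in> K #>\<^bsub>Aut_group C e\<^esub> g"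
      using rcos_self[OF _ subgroup_axioms, of f] assms(2) by simp
  qed
  finally show ?thesis by simp
qed

text \<open>Under this hypothesis the type of \<open>f A\<close> over \<open>A\<close> determines the coset of \<open>f\<close> modulo \<open>K\<close>. It is met by
  a small model together with the Lascar strong automorphisms, and by the entries of a Lascar
  tuple together with the automorphisms whose restriction is Lascar strong.\<close>

definition base :: "'m set \<Rightarrow> ('m \<Rightarrow> 'm) set \<Rightarrow> bool" where
  "base A K \<longleftrightarrow> |A| <o \<kappa> \<and> in_dcl C e A \<and> K \<lhd> Aut_group C e \<and>
     (\<forall>h\<in>aut C. (\<forall>m\<in>A. h m = m) \<longrightarrow> h \<in> K)"

text \<open>The preimages of the closed subsets of \<open>G / K\<close>.\<close>

definition base_closed :: "'m set \<Rightarrow> ('m \<Rightarrow> 'm) set \<Rightarrow> ('m \<Rightarrow> 'm) set \<Rightarrow> bool" where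
  "base_closed A K B \<longleftrightarrow> B \<subseteq> G \<and> (\<forall>k\<in>K. \<forall>f\<in>B. k \<circ> f \<in> B) \<and> type_definable_set A B"

text \<open>An automorphism \<open>h\<close> fixing \<open>A\<close> pointwise takes \<open>f\<close> to \<open>f'\<close> on \<open>A\<close>, so \<open>f' = h f k\<close> where \<open>k\<close> fixes \<open>A\<close> as
  well; both \<open>h\<close> and \<open>k\<close> belong to the normal subgroup \<open>K\<close>.\<close>

lemma equivalent_over_same_coset:
  assumes b: "base A K" and f: "f \<in> G" and f': "f' \<in> G" and eq: "equivalent_over A f f'"
  shows "f' \<circ> finv f \<in> K"
proof -
  have K: "K \<lhd> Aut_group C e" and A: "|A| <o \<kappa>"
    and fixK: "\<And>h. h \<in> aut C \<Longrightarrow> (\<And>m. m \<in> A \<Longrightarrow> h m = m) \<Longrightarrow> h \<in> K"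
    using b by (auto simp: base_def)
  from equivalent_over_automorphism[OF A G_aut[OF f] G_aut[OF f'] eq] obtain h
    where h: "h \<in> aut C" "\<forall>m\<in>A. h m = m \<and> h (f m) = f' m" by blast
  have hK: "h \<in> K" using fixK h by blast
  have hG: "h \<in> G" using normal_G[OF K hK] .
  define k where "k = finv f' \<circ> (h \<circ> f)"
  have "k \<in> K"
  proof (rule fixK)
    show "k \<in> aut C" unfolding k_def by (intro G_aut G_comp G_inv hG f f')
    show "k m = m" if "m \<in> A" for m
      using h(2) that G_inverse(2)[OF f'] by (simp add: k_def)
  qed
  then have "f' \<circ> finv k \<circ> finv f' \<in> K" using normal_conj[OF K f'] normal_finv[OF K] by blast
  then have "(f' \<circ> finv k \<circ> finv f') \<circ> h \<in> K" using normal_comp[OF K] hK by blast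
  moreover have "(f' \<circ> finv k \<circ> finv f') \<circ> h = f' \<circ> finv f"
    using f f' hG G_inv by (simp add: k_def finv_comp finv_finv G_comp comp_assoc G_cancel G_inverse)
  ultimately show ?thesis by simp
qed

text \<open>As \<open>R\<close> may be defined over any small set, the topology of \<open>G / K\<close> does not depend on \<open>A0\<close>, and
  translations are continuous although they move the parameters of a definition.\<close>

lemma base_closed_projection:
  assumes b: "base A0 K" and A: "|A| <o \<kappa>" and R: "type_definable A R"
    and inv: "\<And>f k. f \<in> fst ` R \<Longrightarrow> k \<in> K \<Longrightarrow> k \<circ> f \<in> fst ` R"
  shows "base_closed A0 K (fst ` R)"
proof -
  have sub: "fst ` R \<subseteq> G" using type_definable_subset[OF R] by auto
  have "type_definable_set A0 (fst ` R)"
  proof (rule type_definable_projection[OF A _ R])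
    show "|A0| <o \<kappa>" using b by (simp add: base_def)
    fix f f' assume f: "f \<in> fst ` R" "f' \<in> G" "equivalent_over A0 f f'"
    then have "f \<in> G" using sub by blast
    then have "f' \<circ> finv f \<in> K" using equivalent_over_same_coset[OF b] f by blast
    then have "(f' \<circ> finv f) \<circ> f \<in> fst ` R" using inv f by blast
    then show "f' \<in> fst ` R" using aut_inverse(4)[OF G_aut[OF \<open>f \<in> G\<close>]] by (simp add: comp_assoc)
  qed
  then show ?thesis using sub inv by (auto simp: base_closed_def)
qed

lemma base_closedI:
  assumes b: "base A0 K" and A: "|A| <o \<kappa>" and B: "type_definable_set A B"
    and inv: "\<And>f k. f \<in> B \<Longrightarrow> k \<in> K \<Longrightarrow> k \<circ> f \<in> B"
  shows "base_closed A0 K B"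
proof -
  have "fst ` (B \<times> G) = B" using G_id by force
  then show ?thesis using base_closed_projection[OF b A B] inv by simp
qed

text \<open>The set is \<open>B A\<inverse>\<close>; it is a union of cosets because \<open>A\<close> is and \<open>K\<close> is normal. Besides a closed
  set, \<open>B\<close> will be the stabilizer of a tuple or a clopen set defined by a formula.\<close>

lemma base_closed_quotient:
  assumes b: "base A0 K" and Ac: "base_closed A0 K A" and D: "|D| <o \<kappa>" and B: "type_definable_set D B"
  shows "base_closed A0 K {f \<in> G. \<exists>g\<in>B. finv f \<circ> g \<in> A}"
proof -
  have K: "K \<lhd> Aut_group C e" and A0: "|A0| <o \<kappa>" using b by (simp_all add: base_def)
  have td: "type_definable_set A0 A" and inv: "\<And>k f. k \<in> K \<Longrightarrow> f \<in> A \<Longrightarrow> k \<circ> f \<in> A"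
    using Ac by (auto simp: base_closed_def)
  have BG: "B \<subseteq> G" using type_definable_subset[OF B] G_id by blast
  let ?R = "{(f, g). f \<in> G \<and> g \<in> G \<and> finv f \<circ> g \<in> A} \<inter> (G \<times> B)"
  have "type_definable (A0 \<union> D) {(f, g). f \<in> G \<and> g \<in> G \<and> finv f \<circ> g \<in> A}"
    by (rule type_definable_mono[OF type_definable_quotient[OF td]]) simp
  moreover have "type_definable (A0 \<union> D) (G \<times> B)"
    by (rule type_definable_mono[OF type_definable_second[OF B]]) simp
  ultimately have R: "type_definable (A0 \<union> D) ?R" by (rule type_definable_Int)
  have eq: "fst ` ?R = {f \<in> G. \<exists>g\<in>B. finv f \<circ> g \<in> A}"
    using BG by force
  have "base_closed A0 K (fst ` ?R)"
  proof (rule base_closed_projection[OF b _ R])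
    show "|A0 \<union> D| <o \<kappa>" by (intro small_Un card A0 D)
    fix f k assume "f \<in> fst ` ?R" and k: "k \<in> K"
    then obtain g where f: "f \<in> G" "g \<in> B" "finv f \<circ> g \<in> A" unfolding eq by blast
    have kG: "k \<in> G" using normal_G[OF K k] .
    have "finv f \<circ> finv k \<circ> f \<in> K" by (rule normal_conj'[OF K f(1) normal_finv[OF K k]])
    then have "(finv f \<circ> finv k \<circ> f) \<circ> (finv f \<circ> g) \<in> A" using inv f(3) by blast
    moreover have "(finv f \<circ> finv k \<circ> f) \<circ> (finv f \<circ> g) = finv (k \<circ> f) \<circ> g"
      using f(1) kG by (simp add: finv_comp comp_assoc G_cancel)
    ultimately show "k \<circ> f \<in> fst ` ?R" unfolding eq using f kG G_comp by auto
  qed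
  then show ?thesis by (simp only: eq)
qed

text \<open>For normality, separate the closed sets \<open>S\<close> and \<open>T\<close> by a definable set \<open>D\<close> and let \<open>H\<close> be the
  closure of the identity. The points whose \<open>H\<close>-coset avoids the complement of \<open>D\<close>, and those whose
  \<open>H\<close>-coset avoids \<open>D\<close>, form disjoint open sets. They contain \<open>S\<close> and \<open>T\<close> because closed sets are
  unions of \<open>H\<close>-cosets.\<close>

lemma base_group_topology:
  assumes b: "base A0 K" and X: "\<And>B. closedin X B \<longleftrightarrow> base_closed A0 K B"
  shows "compact_group_topology (Aut_group C e) X"
proof -
  have K: "K \<lhd> Aut_group C e" and A0: "|A0| <o \<kappa>" using b by (simp_all add: base_def)
  have "base_closed A0 K G"
    using G_comp normal_G[OF K] type_definable_G by (auto simp: base_closed_def)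
  then have top: "topspace X = G"
    using X[of G] X[of "topspace X"] closedin_subset[of X G] by (auto simp: base_closed_def)
  have gt: "group_topology (Aut_group C e) X"
  proof (intro group_topology.intro group_Aut_group group_topology_axioms.intro; (unfold Aut_group_carrier X)?)
    show "topspace X = G" by (fact top)
  next
    fix a B assume a: "a \<in> G" and B: "base_closed A0 K B"
    have eq: "{x \<in> G. a \<otimes>\<^bsub>Aut_group C e\<^esub> x \<in> B} = {x \<in> G. a \<circ> x \<in> B}" using a by auto
    show "base_closed A0 K {x \<in> G. a \<otimes>\<^bsub>Aut_group C e\<^esub> x \<in> B}"
      unfolding eq
    proof (rule base_closedI[OF b])
      show "|A0 \<union> finv a ` A0| <o \<kappa>" by (intro small_Un card A0 small_image)
      show "type_definable_set (A0 \<union> finv a ` A0) {x \<in> G. a \<circ> x \<in> B}"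
        using B a by (intro type_definable_left) (simp_all add: base_closed_def)
      fix f k assume f: "f \<in> {x \<in> G. a \<circ> x \<in> B}" and k: "k \<in> K"
      have "(a \<circ> k \<circ> finv a) \<circ> (a \<circ> f) \<in> B"
        using f B normal_conj[OF K a k] by (simp add: base_closed_def)
      moreover have "(a \<circ> k \<circ> finv a) \<circ> (a \<circ> f) = a \<circ> (k \<circ> f)"
        by (simp add: fun_eq_iff aut_inverse[OF G_aut[OF a]])
      ultimately show "k \<circ> f \<in> {x \<in> G. a \<circ> x \<in> B}"
        using f k normal_G[OF K] G_comp by simp
    qed
    have eq: "{x \<in> G. x \<otimes>\<^bsub>Aut_group C e\<^esub> a \<in> B} = {x \<in> G. x \<circ> a \<in> B}" using a by auto
    show "base_closed A0 K {x \<in> G. x \<otimes>\<^bsub>Aut_group C e\<^esub> a \<in> B}"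
      unfolding eq
    proof (rule base_closedI[OF b])
      show "|A0 \<union> a ` A0| <o \<kappa>" by (intro small_Un card A0 small_image)
      show "type_definable_set (A0 \<union> a ` A0) {x \<in> G. x \<circ> a \<in> B}"
        using B a by (intro type_definable_right) (simp_all add: base_closed_def)
      fix f k assume f: "f \<in> {x \<in> G. x \<circ> a \<in> B}" and k: "k \<in> K"
      then show "k \<circ> f \<in> {x \<in> G. x \<circ> a \<in> B}"
        using B normal_G[OF K] G_comp by (simp add: base_closed_def comp_assoc)
    qed
  next
    fix B assume B: "base_closed A0 K B"
    have eq: "{x \<in> G. inv\<^bsub>Aut_group C e\<^esub> x \<in> B} = {x \<in> G. finv x \<in> B}" by auto
    show "base_closed A0 K {x \<in> G. inv\<^bsub>Aut_group C e\<^esub> x \<in> B}"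
      unfolding eq
    proof (rule base_closedI[OF b A0])
      show "type_definable_set A0 {x \<in> G. finv x \<in> B}"
        using B by (intro type_definable_inverse) (simp add: base_closed_def)
      fix f k assume f: "f \<in> {x \<in> G. finv x \<in> B}" and k: "k \<in> K"
      have "(finv f \<circ> finv k \<circ> f) \<circ> finv f \<in> B"
        using f B normal_conj'[OF K _ normal_finv[OF K k]] by (simp add: base_closed_def)
      moreover have "(finv f \<circ> finv k \<circ> f) \<circ> finv f = finv (k \<circ> f)"
        using f normal_G[OF K k] by (simp add: finv_comp comp_assoc G_inverse)
      ultimately show "k \<circ> f \<in> {x \<in> G. finv x \<in> B}"
        using f k normal_G[OF K] G_comp by simp
    qed
  next
    fix A B assume A: "base_closed A0 K A" and B: "base_closed A0 K B"
    then have BG: "B \<subseteq> G" by (simp add: base_closed_def)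
    have "inv\<^bsub>Aut_group C e\<^esub> x \<otimes>\<^bsub>Aut_group C e\<^esub> y = finv x \<circ> y" if "x \<in> G" "y \<in> B" for x y
      using that BG by (simp add: G_inv subset_iff)
    then have eq: "{x \<in> G. \<exists>y\<in>B. inv\<^bsub>Aut_group C e\<^esub> x \<otimes>\<^bsub>Aut_group C e\<^esub> y \<in> A} =
        {x \<in> G. \<exists>y\<in>B. finv x \<circ> y \<in> A}" by auto
    show "base_closed A0 K {x \<in> G. \<exists>y\<in>B. inv\<^bsub>Aut_group C e\<^esub> x \<otimes>\<^bsub>Aut_group C e\<^esub> y \<in> A}"
      unfolding eq using B by (intro base_closed_quotient[OF b A A0]) (simp add: base_closed_def)
  qed
  interpret gt: group_topology "Aut_group C e" X by (fact gt)
  have compact: "compact_space X"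
    unfolding compact_space_fip
  proof (intro allI impI)
    fix \<U> assume \<U>: "(\<forall>B\<in>\<U>. closedin X B) \<and> (\<forall>\<F>. finite \<F> \<and> \<F> \<subseteq> \<U> \<longrightarrow> \<Inter> \<F> \<noteq> {})"
    then have "\<forall>B\<in>\<U>. \<exists>\<Phi>\<subseteq>pair_fmls C A0. B \<times> G = sat_pairs \<Phi>"
      by (simp add: X base_closed_def type_definable_def)
    then obtain \<Phi> where \<Phi>: "\<And>B. B \<in> \<U> \<Longrightarrow> \<Phi> B \<subseteq> pair_fmls C A0"
      "\<And>B. B \<in> \<U> \<Longrightarrow> B \<times> G = sat_pairs (\<Phi> B)" by metis
    show "\<Inter> \<U> \<noteq> {}"
    proof -
      have "\<exists>f\<in>G. \<exists>g\<in>G. \<forall>p\<in>\<Union> (\<Phi> ` \<U>). sat C UNIV (env f g) p"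
      proof (rule compactness[OF A0])
        show "\<Union> (\<Phi> ` \<U>) \<subseteq> pair_fmls C A0" using \<Phi>(1) by (rule UN_least)
        fix \<Psi> assume \<Psi>: "\<Psi> \<subseteq> \<Union> (\<Phi> ` \<U>)" "finite \<Psi>"
        from finite_subset_Union[OF \<Psi>(2,1)] obtain \<G> where \<G>: "finite \<G>" "\<G> \<subseteq> \<Phi> ` \<U>" "\<Psi> \<subseteq> \<Union> \<G>"
          by blast
        from finite_subset_image[OF \<G>(1,2)] obtain \<F> where \<F>: "\<F> \<subseteq> \<U>" "finite \<F>" "\<G> = \<Phi> ` \<F>" by blast
        show "\<exists>f\<in>G. \<exists>g\<in>G. \<forall>p\<in>\<Psi>. sat C UNIV (env f g) p"
        proof (cases "\<F> = {}")
          case True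
          then have "\<Psi> = {}" using \<G>(3) \<F>(3) by simp
          then show ?thesis using G_id by blast
        next
          case False
          have "\<Inter> \<F> \<noteq> {}" using \<U> \<F> by simp
          then obtain f where f: "\<And>B. B \<in> \<F> \<Longrightarrow> f \<in> B" by blast
          have "(f, id) \<in> sat_pairs (\<Phi> B)" if "B \<in> \<F>" for B
          proof -
            have "(f, id) \<in> B \<times> G" using f that G_id by simp
            then show ?thesis using \<Phi>(2)[of B] that \<F>(1) by blast
          qed
          note * = this
          then have "f \<in> G" using False by auto
          moreover have "\<forall>p\<in>\<Psi>. sat C UNIV (env f id) p"
          proof
            fix p assume "p \<in> \<Psi>"
            then obtain B where "B \<in> \<F>" "p \<in> \<Phi> B" using \<G>(3) \<F>(3) by blast
            then show "sat C UNIV (env f id) p" using *[of B] by simp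
          qed
          ultimately show ?thesis using G_id by blast
        qed
      qed
      then obtain f g where fg: "f \<in> G" "g \<in> G" "\<forall>p\<in>\<Union> (\<Phi> ` \<U>). sat C UNIV (env f g) p" by blast
      have "f \<in> B" if "B \<in> \<U>" for B
      proof -
        have "(f, g) \<in> sat_pairs (\<Phi> B)" using fg that by auto
        then show ?thesis using \<Phi>(2)[OF that] by blast
      qed
      then show ?thesis by blast
    qed
  qed
  have normal: "normal_space X"
    unfolding normal_space_def
  proof (intro allI impI)
    fix S T assume ST: "closedin X S \<and> closedin X T \<and> disjnt S T"
    then have "type_definable_set A0 S" "type_definable_set A0 T" "S \<inter> T = {}"
      by (auto simp: X base_closed_def disjnt_def)
    from type_definable_separation[OF A0 this] obtain D where D: "D \<subseteq> G"
      "type_definable_set A0 D" "type_definable_set A0 (G - D)" "S \<subseteq> D" "D \<inter> T = {}" by blast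
    let ?H = "X closure_of {id}"
    let ?c = "\<lambda>B. {f \<in> G. \<exists>g\<in>B. finv f \<circ> g \<in> ?H}"
    have H: "base_closed A0 K ?H" using X[of ?H] by simp
    have id: "id \<in> ?H" using gt.one_in_cl_one by simp
    have avoid: "B \<inter> ?c E = {}" if B: "closedin X B" "B \<inter> E = {}" for B E
    proof (rule ccontr)
      assume "B \<inter> ?c E \<noteq> {}"
      then obtain f g where f: "f \<in> B" "f \<in> G" "g \<in> E" "finv f \<circ> g \<in> ?H" by blast
      have hG: "finv f \<circ> g \<in> G" using gt.cl_one_subset f(4) by auto
      have "f \<otimes>\<^bsub>Aut_group C e\<^esub> (finv f \<circ> g) \<in> B"
        using gt.closed_cl_one_mult(2)[OF B(1) f(1)] f(4) by simp
      moreover have "f \<otimes>\<^bsub>Aut_group C e\<^esub> (finv f \<circ> g) = g"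
        unfolding Aut_group_mult[OF f(2) hG] by (rule ext) (simp add: G_inverse[OF f(2)])
      ultimately show False using f(3) B(2) by auto
    qed
    have subset_Diff: "S \<subseteq> Z - Y \<longleftrightarrow> S \<subseteq> Z \<and> S \<inter> Y = {}" for S Y Z :: "('m \<Rightarrow> 'm) set" by blast
    show "\<exists>U V. openin X U \<and> openin X V \<and> S \<subseteq> U \<and> T \<subseteq> V \<and> disjnt U V"
    proof (intro exI conjI)
      show "openin X (topspace X - ?c (G - D))" "openin X (topspace X - ?c D)"
        by (intro openin_diff openin_topspace; unfold X, intro base_closed_quotient[OF b H A0] D)+
      have "S \<inter> (G - D) = {}" "T \<inter> D = {}" using D by auto
      then have "S \<inter> ?c (G - D) = {}" "T \<inter> ?c D = {}"
        using avoid[of S "G - D"] avoid[of T D] ST by simp_all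
      moreover have "S \<subseteq> topspace X" "T \<subseteq> topspace X"
        using ST closedin_subset[of X S] closedin_subset[of X T] by simp_all
      ultimately show "S \<subseteq> topspace X - ?c (G - D)" "T \<subseteq> topspace X - ?c D"
        by (simp_all only: subset_Diff)
      show "disjnt (topspace X - ?c (G - D)) (topspace X - ?c D)"
      proof -
        have "x \<in> ?c (G - D) \<or> x \<in> ?c D" if x: "x \<in> G" for x
        proof -
          have "finv x \<circ> x \<in> ?H" unfolding G_inverse(4)[OF x] by (fact id)
          then show ?thesis using x by blast
        qed
        then show ?thesis unfolding top disjnt_def by blast
      qed
    qed
  qed
  show ?thesis
    by (intro compact_group_topology.intro gt compact_group_topology_axioms.intro compact normal)
qed


text \<open>The variables of the types in the definition of the topologies are the indices of a tuple
  \<open>c\<close>, whereas here they are the elements of its range. The next two lemmas translate.\<close>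

lemma tuple_fmls_of_pair_fmls:
  fixes c :: "'i \<rightharpoonup> 'm"
  assumes c: "ran c = A" and p: "p \<in> pair_fmls C A"
  shows "\<exists>q\<in>fmls C (dom c) A. \<forall>f. holds C (act f c) q \<longleftrightarrow> sat C UNIV (env f id) p"
proof -
  define ix where "ix = (\<lambda>m. SOME i. c i = Some m)"
  have ix: "c (ix m) = Some m" if "m \<in> A" for m
    using that c unfolding ix_def ran_def by (metis (mono_tags, lifting) mem_Collect_eq someI_ex)
  define r :: "('m + 'm, 'm) var \<Rightarrow> ('i, 'm) var" where
    "r = (\<lambda>v. case v of TVar (Inl m) \<Rightarrow> TVar (ix m) | TVar (Inr m) \<Rightarrow> Param m
    | Param m \<Rightarrow> Param m | Aux n \<Rightarrow> Aux n)"
  have "\<exists>q\<in>fmls C (dom c) A. \<forall>s. sat C UNIV s q = sat C UNIV (\<lambda>v. s (r v)) p"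
  proof (rule fmls_rename[OF p])
    fix i assume "i \<in> A <+> A"
    then show "r (TVar i) \<in> TVar ` dom c \<union> Param ` A"
      by (cases i) (use ix in \<open>auto simp: r_def dom_def\<close>)
  qed (simp add: r_def)
  then obtain q where q: "q \<in> fmls C (dom c) A" "\<And>s. sat C UNIV s q = sat C UNIV (\<lambda>v. s (r v)) p" by blast
  have fv: "fv p \<subseteq> TVar ` (A <+> A) \<union> Param ` A" using p by (simp add: fmls_def)
  have "sat C UNIV (\<lambda>v. val (act f c) (r v)) p = sat C UNIV (env f id) p" for f
  proof (rule sat_cong)
    fix v assume "v \<in> fv p"
    then have "v \<in> TVar ` (A <+> A) \<union> Param ` A" using fv by (rule subsetD[rotated])
    then show "val (act f c) (r v) = env f id v"
      using ix by (auto simp: r_def act_def)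
  qed
  then show ?thesis using q unfolding holds_def by auto
qed

lemma pair_fmls_of_tuple_fmls:
  fixes c :: "'i \<rightharpoonup> 'm"
  assumes c: "ran c = A" and q: "q \<in> fmls C (dom c) A"
  shows "\<exists>p\<in>pair_fmls C A. \<forall>f g. sat C UNIV (env f g) p \<longleftrightarrow> holds C (act f c) q"
proof -
  define r :: "('i, 'm) var \<Rightarrow> ('m + 'm, 'm) var" where
    "r = (\<lambda>v. case v of TVar i \<Rightarrow> TVar (Inl (the (c i))) | Param m \<Rightarrow> Param m | Aux n \<Rightarrow> Aux n)"
  have "\<exists>p\<in>pair_fmls C A. \<forall>s. sat C UNIV s p = sat C UNIV (\<lambda>v. s (r v)) q"
  proof (rule fmls_rename[OF q])
    fix i assume "i \<in> dom c"
    then have "the (c i) \<in> A" using c by (auto simp: ran_def)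
    then show "r (TVar i) \<in> TVar ` (A <+> A) \<union> Param ` A" by (auto simp: r_def)
  qed (simp add: r_def)
  then obtain p where p: "p \<in> pair_fmls C A" "\<And>s. sat C UNIV s p = sat C UNIV (\<lambda>v. s (r v)) q" by blast
  have fv: "fv q \<subseteq> TVar ` dom c \<union> Param ` A" using q by (simp add: fmls_def)
  have "sat C UNIV (\<lambda>v. env f g (r v)) q = sat C UNIV (val (act f c)) q" for f g
  proof (rule sat_cong)
    fix v assume "v \<in> fv q"
    then have "v \<in> TVar ` dom c \<union> Param ` A" using fv by (rule subsetD[rotated])
    then show "env f g (r v) = val (act f c) v"
      by (auto simp: r_def act_def)
  qed
  then show ?thesis using p unfolding holds_def by auto
qed

text \<open>The map \<open>\<rho>\<close> allows the group to be the automorphism group itself or the group of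
  restrictions to the solution set.\<close>

lemma type_quotient_topology_pullback:
  fixes \<Gamma> :: "('g, 'z) monoid_scheme" (structure) and H :: "'g set"
  assumes b: "base A K" and c: "ran c = A" and \<rho>: "\<rho> ` G = carrier \<Gamma>"
    and t: "\<And>f. f \<in> G \<Longrightarrow> t (\<rho> f) = tp C A (act f c)"
    and coset: "\<And>f g. f \<in> G \<Longrightarrow> g \<in> G \<Longrightarrow> H #> \<rho> f = H #> \<rho> g \<longleftrightarrow> f \<circ> finv g \<in> K"
  shows "topspace (type_quotient_topology \<Gamma> H t) = (\<lambda>f. H #> \<rho> f) ` G"
    and "closedin (pullback_topology G (\<lambda>f. H #> \<rho> f) (type_quotient_topology \<Gamma> H t)) B \<longleftrightarrow>
      base_closed A K B"
proof -
  let ?F = "fmls C (dom c) A"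
  let ?Y = "type_quotient_topology \<Gamma> H t"
  have K: "K \<lhd> Aut_group C e" using b by (simp add: base_def)
  have tp: "\<phi> \<in> t (\<rho> f) \<longleftrightarrow> \<phi> \<in> ?F \<and> holds C (act f c) \<phi>" if "f \<in> G" for f \<phi>
    using t[OF that] by (simp add: tp_def)
  have all: "(\<forall>g\<in>carrier \<Gamma>. P g) \<longleftrightarrow> (\<forall>f\<in>G. P (\<rho> f))" for P
    by (simp add: \<rho>[symmetric])
  have sub: "t g \<subseteq> ?F" if "g \<in> carrier \<Gamma>" for g
    using that unfolding \<rho>[symmetric] by (auto simp: tp)
  have neg: "\<exists>\<psi>\<in>?F. \<forall>g\<in>carrier \<Gamma>. \<psi> \<in> t g \<longleftrightarrow> \<phi> \<notin> t g" if "\<phi> \<in> ?F" for \<phi>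
    unfolding all using that by (intro bexI[of _ "Neg \<phi>"]) (auto simp: tp fmls_Neg holds_def)
  have conj: "\<exists>\<theta>\<in>?F. \<forall>g\<in>carrier \<Gamma>. \<theta> \<in> t g \<longleftrightarrow> \<phi> \<in> t g \<and> \<psi> \<in> t g" if "\<phi> \<in> ?F" "\<psi> \<in> ?F" for \<phi> \<psi>
    unfolding all using that by (intro bexI[of _ "Conj \<phi> \<psi>"]) (auto simp: tp fmls_def holds_def)
  have ne: "?F \<noteq> {}"
    using fmls_conj_exists[of "{}" C "dom c" A] by blast
  have wd: "H #> g = H #> h" if gh: "g \<in> carrier \<Gamma>" "h \<in> carrier \<Gamma>" "t g = t h" for g h
  proof -
    obtain f f' where f: "f \<in> G" "g = \<rho> f" and f': "f' \<in> G" "h = \<rho> f'"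
      using gh(1,2) unfolding \<rho>[symmetric] by blast
    have "equivalent_over A f' f"
      unfolding equivalent_over_def
    proof (intro allI impI)
      fix p :: "('f, 'r, ('m + 'm, 'm) var) fm" assume "p \<in> fmls C (A <+> {}) A"
      then have "p \<in> pair_fmls C A" using fmls_mono[of "A <+> {}" "A <+> A" A A C] by blast
      from tuple_fmls_of_pair_fmls[OF c this] obtain q where q: "q \<in> ?F"
        "\<And>f. holds C (act f c) q \<longleftrightarrow> sat C UNIV (env f id) p" by blast
      have "q \<in> t (\<rho> f) \<longleftrightarrow> q \<in> t (\<rho> f')" using gh(3) f f' by simp
      then show "sat C UNIV (env f' id) p = sat C UNIV (env f id) p"
        using q tp f f' by simp
    qed
    from equivalent_over_same_coset[OF b f'(1) f(1) this] show ?thesis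
      using coset[OF f(1) f'(1)] f f' by simp
  qed
  have closed: "topspace ?Y = (\<lambda>g. H #> g) ` carrier \<Gamma>"
    "closedin ?Y D \<longleftrightarrow> D \<subseteq> (\<lambda>g. H #> g) ` carrier \<Gamma> \<and>
      (\<exists>\<Phi>\<subseteq>?F. \<forall>g\<in>carrier \<Gamma>. H #> g \<in> D \<longleftrightarrow> (\<forall>\<phi>\<in>\<Phi>. \<phi> \<in> t g))" for D
    by (rule type_quotient_topology_closed[where F = ?F]; fact)+
  have top: "topspace ?Y = (\<lambda>f. H #> \<rho> f) ` G"
    using closed(1) by (simp add: \<rho>[symmetric] image_image)
  then show "topspace ?Y = (\<lambda>f. H #> \<rho> f) ` G" .
  have closedY: "closedin ?Y D \<longleftrightarrow> D \<subseteq> topspace ?Y \<and>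
      (\<exists>\<Phi>\<subseteq>?F. \<forall>f\<in>G. H #> \<rho> f \<in> D \<longleftrightarrow> (\<forall>\<phi>\<in>\<Phi>. holds C (act f c) \<phi>))" for D
  proof -
    have "(\<forall>\<phi>\<in>\<Phi>. \<phi> \<in> t (\<rho> f)) \<longleftrightarrow> (\<forall>\<phi>\<in>\<Phi>. holds C (act f c) \<phi>)" if "\<Phi> \<subseteq> ?F" "f \<in> G" for \<Phi> f
      using that tp by blast
    note eq = this
    show ?thesis
      unfolding closed all by (intro conj_cong refl ex_cong1 ball_cong) (simp only: eq)
  qed
  show "closedin (pullback_topology G (\<lambda>f. H #> \<rho> f) ?Y) B \<longleftrightarrow> base_closed A K B"
    unfolding pullback_closedin[OF equalityD1[OF top[symmetric]]]
  proof
    assume "\<exists>D. closedin ?Y D \<and> B = (\<lambda>f. H #> \<rho> f) -` D \<inter> G"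
    then obtain D where D: "closedin ?Y D" and B: "\<And>f. f \<in> B \<longleftrightarrow> f \<in> G \<and> H #> \<rho> f \<in> D" by blast
    from D obtain \<Phi> where \<Phi>: "\<Phi> \<subseteq> ?F"
      "\<And>f. f \<in> G \<Longrightarrow> H #> \<rho> f \<in> D \<longleftrightarrow> (\<forall>\<phi>\<in>\<Phi>. holds C (act f c) \<phi>)" unfolding closedY by blast
    have "\<forall>\<phi>\<in>\<Phi>. \<exists>p\<in>pair_fmls C A. \<forall>f g. sat C UNIV (env f g) p \<longleftrightarrow> holds C (act f c) \<phi>"
      using \<Phi>(1) pair_fmls_of_tuple_fmls[OF c] by blast
    then obtain P where P: "\<And>\<phi>. \<phi> \<in> \<Phi> \<Longrightarrow> P \<phi> \<in> pair_fmls C A"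
      "\<And>\<phi> f g. \<phi> \<in> \<Phi> \<Longrightarrow> sat C UNIV (env f g) (P \<phi>) \<longleftrightarrow> holds C (act f c) \<phi>" by metis
    have "B \<times> G = sat_pairs (P ` \<Phi>)"
      by (auto simp: B \<Phi>(2) P(2) sat_pairs_def)
    moreover have "P ` \<Phi> \<subseteq> pair_fmls C A" using P(1) by (rule image_subsetI)
    ultimately have "type_definable_set A B" by (simp only: type_definableI)
    moreover have "k \<circ> f \<in> B" if k: "k \<in> K" and f: "f \<in> B" for k f
    proof -
      have fG: "f \<in> G" and kf: "k \<circ> f \<in> G" using f B normal_G[OF K k] G_comp by simp_all
      have "(k \<circ> f) \<circ> finv f = k" by (simp add: comp_assoc G_inverse[OF fG])
      then have "H #> \<rho> (k \<circ> f) = H #> \<rho> f" using coset[OF kf fG] k by simp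
      then show ?thesis using B kf f by simp
    qed
    ultimately show "base_closed A K B" using B by (auto simp: base_closed_def)
  next
    assume B: "base_closed A K B"
    then have BG: "B \<subseteq> G" and inv: "\<And>k f. k \<in> K \<Longrightarrow> f \<in> B \<Longrightarrow> k \<circ> f \<in> B"
      by (auto simp: base_closed_def)
    from B obtain \<Psi> where \<Psi>: "\<Psi> \<subseteq> pair_fmls C A" "B \<times> G = sat_pairs \<Psi>"
      by (auto simp: base_closed_def type_definable_def)
    define D where "D = (\<lambda>f. H #> \<rho> f) ` B"
    have fD: "H #> \<rho> f \<in> D \<longleftrightarrow> f \<in> B" if f: "f \<in> G" for f
    proof
      assume "H #> \<rho> f \<in> D"
      then obtain f' where f': "f' \<in> B" "H #> \<rho> f = H #> \<rho> f'" by (auto simp: D_def)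
      then have "f' \<in> G" using BG by blast
      then have "(f \<circ> finv f') \<circ> f' \<in> B" using coset[OF f] f' inv by blast
      then show "f \<in> B" by (simp add: comp_assoc G_inverse[OF \<open>f' \<in> G\<close>])
    qed (simp add: D_def)
    have "\<forall>p\<in>\<Psi>. \<exists>q\<in>?F. \<forall>f. holds C (act f c) q \<longleftrightarrow> sat C UNIV (env f id) p"
      using \<Psi>(1) tuple_fmls_of_pair_fmls[OF c] by blast
    then obtain Q where Q: "\<And>p. p \<in> \<Psi> \<Longrightarrow> Q p \<in> ?F"
      "\<And>p f. p \<in> \<Psi> \<Longrightarrow> holds C (act f c) (Q p) \<longleftrightarrow> sat C UNIV (env f id) p" by metis
    have "f \<in> B \<longleftrightarrow> (\<forall>\<phi>\<in>Q ` \<Psi>. holds C (act f c) \<phi>)" if f: "f \<in> G" for f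
    proof -
      have "f \<in> B \<longleftrightarrow> (f, id) \<in> B \<times> G" using G_id by simp
      also have "\<dots> \<longleftrightarrow> (\<forall>p\<in>\<Psi>. sat C UNIV (env f id) p)"
        unfolding \<Psi>(2) using f G_id by simp
      finally show ?thesis using Q(2) by simp
    qed
    moreover have "Q ` \<Psi> \<subseteq> ?F" using Q(1) by (rule image_subsetI)
    moreover have "D \<subseteq> topspace ?Y" using BG unfolding top D_def by (rule image_mono)
    ultimately have "closedin ?Y D" unfolding closedY using fD by (intro conjI exI[of _ "Q ` \<Psi>"]) simp_all
    moreover have "B = (\<lambda>f. H #> \<rho> f) -` D \<inter> G" using fD BG by auto
    ultimately show "\<exists>D. closedin ?Y D \<and> B = (\<lambda>f. H #> \<rho> f) -` D \<inter> G" by blast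
  qed
qed

section \<open>Lascar strong automorphisms\<close>

lemma elementary_submodel_image:
  assumes g: "g \<in> aut C" and M: "elementary_submodel C M"
  shows "elementary_submodel C (g ` M)"
proof -
  have "fun_int C f xs \<in> g ` M" if xs: "length xs = fun_arity C f" "set xs \<subseteq> g ` M" for f xs
  proof -
    let ?ys = "map (finv g) xs"
    have "set ?ys \<subseteq> M" using xs(2) aut_inverse(2)[OF g] by auto
    then have "fun_int C f ?ys \<in> M" using M xs(1) by (simp add: elementary_submodel_def)
    moreover have "g (fun_int C f ?ys) = fun_int C f (map g ?ys)"
      using g xs(1) by (simp add: aut_def del: map_map)
    moreover have "map g ?ys = xs" using aut_inverse(1)[OF g] by (simp add: comp_def)
    ultimately show ?thesis by (metis imageI)
  qed
  moreover have "sat C (g ` M) s p = sat C UNIV s p" if p: "wf_fm C p" and s: "range s \<subseteq> g ` M"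
    for p :: "('f, 'r, nat) fm" and s
  proof -
    let ?s = "\<lambda>v. finv g (s v)"
    have "?s v \<in> M" for v
    proof -
      have "s v \<in> g ` M" using s by blast
      then show ?thesis using aut_inverse(2)[OF g] by auto
    qed
    then have "range ?s \<subseteq> M" by blast
    then have "sat C M ?s p = sat C UNIV ?s p" using M p by (simp add: elementary_submodel_def)
    moreover have "(\<lambda>v. g (?s v)) = s" using aut_inverse(1)[OF g] by simp
    ultimately show ?thesis using sat_aut[OF g p, of M ?s] sat_aut_UNIV[OF g p, of ?s] by simp
  qed
  moreover have "g ` M \<noteq> {}" using M by (simp add: elementary_submodel_def)
  ultimately show ?thesis by (simp add: elementary_submodel_def)
qed

text \<open>A conjugate \<open>g h g\<inverse>\<close> of an automorphism fixing the model \<open>M\<close> fixes the model \<open>g M\<close>.\<close>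

lemma Autf_L_normal: "Autf_L C \<kappa> e \<lhd> Aut_group C e"
  unfolding Autf_L_def
proof (rule group.normal_generateI[OF group_Aut_group])
  let ?S = "{f \<in> G. \<exists>M. small_model C \<kappa> M \<and> in_dcl C e M \<and> (\<forall>m\<in>M. f m = m)}"
  show "?S \<subseteq> carrier (Aut_group C e)" by auto
  fix h g assume h: "h \<in> ?S" and "g \<in> carrier (Aut_group C e)"
  then have g: "g \<in> G" and hG: "h \<in> G" by simp_all
  from h obtain M where M: "small_model C \<kappa> M" "in_dcl C e M" "\<forall>m\<in>M. h m = m" by blast
  have "small_model C \<kappa> (g ` M)"
    using M(1) elementary_submodel_image[OF G_aut[OF g]] small_image by (auto simp: small_model_def)
  moreover have "in_dcl C e (g ` M)"
    unfolding in_dcl_def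
  proof (intro ballI impI)
    fix k assume k: "k \<in> aut C" "\<forall>a\<in>g ` M. k a = a"
    have "finv g \<circ> (k \<circ> g) \<in> G"
    proof (rule dcl_fix[OF M(2)])
      show "finv g \<circ> (k \<circ> g) \<in> aut C" by (intro aut_comp aut_inv k(1) G_aut[OF g])
      show "(finv g \<circ> (k \<circ> g)) m = m" if "m \<in> M" for m
        using k(2) that G_inverse(2)[OF g] by simp
    qed
    then have "g \<circ> (finv g \<circ> (k \<circ> g)) \<circ> finv g \<in> G" using g G_inv G_comp by blast
    moreover have "g \<circ> (finv g \<circ> (k \<circ> g)) \<circ> finv g = k"
      by (rule ext) (simp add: G_inverse[OF g])
    ultimately show "act k ` e = e" by (simp add: aut_over_def)
  qed
  moreover have "\<forall>m\<in>g ` M. (g \<circ> h \<circ> finv g) m = m"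
    using M(3) G_inverse(2)[OF g] by simp
  moreover have "g \<circ> h \<circ> finv g \<in> G" using g hG G_inv G_comp by blast
  ultimately have "g \<circ> h \<circ> finv g \<in> ?S" by blast
  then show "g \<otimes>\<^bsub>Aut_group C e\<^esub> h \<otimes>\<^bsub>Aut_group C e\<^esub> inv\<^bsub>Aut_group C e\<^esub> g \<in> ?S"
    using g hG by (simp add: G_inv G_comp)
qed

lemma base_Autf_L:
  assumes "small_model C \<kappa> M" "in_dcl C e M"
  shows "base M (Autf_L C \<kappa> e)"
proof -
  have "h \<in> Autf_L C \<kappa> e" if h: "h \<in> aut C" "\<forall>m\<in>M. h m = m" for h
  proof -
    have "h \<in> G" using dcl_fix[OF assms(2)] h by blast
    then show ?thesis unfolding Autf_L_def using h assms by (intro generate.incl) blast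
  qed
  then show ?thesis using assms Autf_L_normal by (simp add: base_def small_model_def)
qed

end

section \<open>Automorphisms of the solution set\<close>

lemma small_Times:
  assumes \<kappa>: "Card_order \<kappa>" "natLeq <o \<kappa>" and A: "|A :: 'a set| <o \<kappa>" and B: "|B :: 'a set| <o \<kappa>"
  shows "|A \<times> B| <o \<kappa>"
proof -
  let ?X = "A \<union> B"
  have X: "|?X| <o \<kappa>" by (rule small_Un[OF \<kappa> A B])
  have "|?X \<times> ?X| <o \<kappa>"
  proof (cases "finite ?X")
    case True
    then have "|?X \<times> ?X| <o natLeq" by (simp only: finite_iff_ordLess_natLeq[symmetric] finite_cartesian_product)
    then show ?thesis using \<kappa>(2) ordLess_transitive by blast
  next
    case False
    then have "|?X \<times> ?X| =o |?X|" by (rule card_of_Times_same_infinite)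
    then show ?thesis using X ordIso_ordLess_trans by blast
  qed
  moreover have "A \<times> B \<subseteq> ?X \<times> ?X" by blast
  ultimately show ?thesis using small_subset by blast
qed

text \<open>\<open>S\<close> is the solution set of an invariant partial type.\<close>

locale relative = monster C \<kappa> e
  for C :: "('f, 'r, 'm) struct" and \<kappa> :: "'k rel" and e :: "('k \<rightharpoonup> 'm) set" +
  fixes \<beta> :: 'k and S :: "('k \<rightharpoonup> 'm) set"
  assumes \<beta>: "\<beta> \<in> Field \<kappa>" and dom_S: "b \<in> S \<Longrightarrow> dom b = underS \<kappa> \<beta>"
    and invariant: "invariant_over C e (underS \<kappa> \<beta>) S"
begin

definition rel :: "('m \<Rightarrow> 'm) \<Rightarrow> ('k \<rightharpoonup> 'm) \<Rightarrow> ('k \<rightharpoonup> 'm)" where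
  "rel f = restrict (act f) S"

lemma act_S: "f \<in> G \<Longrightarrow> c \<in> S \<Longrightarrow> act f c \<in> S"
  using invariant dom_S unfolding invariant_over_def by blast

lemma rel_Bij: assumes f: "f \<in> G" shows "rel f \<in> Bij S"
proof -
  have "bij_betw (act f) S S"
  proof (rule bij_betw_byWitness[where f' = "act (finv f)"])
    show "\<forall>a\<in>S. act (finv f) (act f a) = a" "\<forall>a\<in>S. act f (act (finv f) a) = a"
      by (simp_all add: act_comp[symmetric] G_inverse[OF f] act_id)
    show "act f ` S \<subseteq> S" "act (finv f) ` S \<subseteq> S" using act_S f G_inv by blast+
  qed
  then show ?thesis by (simp add: Bij_def rel_def bij_betw_restrict_eq)
qed

lemma rel_comp:
  assumes "f \<in> G" "g \<in> G"
  shows "rel f \<otimes>\<^bsub>Aut_rel_group C e S\<^esub> rel g = rel (f \<circ> g)"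
proof -
  have "rel f \<otimes>\<^bsub>Aut_rel_group C e S\<^esub> rel g = compose S (rel f) (rel g)"
    using assms by (simp add: Aut_rel_group_def BijGroup_def rel_Bij)
  also have "\<dots> = rel (f \<circ> g)"
    using act_S[OF assms(2)] by (auto simp: compose_def rel_def act_comp restrict_def)
  finally show ?thesis .
qed

lemma Aut_rel_eq: "Aut_rel C e S = rel ` G"
  by (simp add: Aut_rel_def rel_def)

abbreviation tuples :: "('k \<rightharpoonup> ('k \<rightharpoonup> 'm)) set" where "tuples \<equiv> real_tuples \<kappa> S"

lemma act_tuple: "f \<in> G \<Longrightarrow> b \<in> tuples \<Longrightarrow> act (act f) b \<in> tuples"
  using act_S by (auto simp: real_tuples_def ran_act)

lemma act_rel_tuple: assumes "b \<in> tuples" shows "act (rel f) b = act (act f) b"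
proof
  fix i
  have "c \<in> S" if "b i = Some c" for c
    using assms that by (auto simp: real_tuples_def ran_def)
  then show "act (rel f) b i = act (act f) b i"
    by (cases "b i") (simp_all add: act_def rel_def)
qed

lemma act_act_comp:
  fixes f g :: "'m \<Rightarrow> 'm" and b :: "'i \<rightharpoonup> ('k \<rightharpoonup> 'm)"
  shows "act (act (f \<circ> g)) b = act (act f) (act (act g) b)"
proof -
  have "act (f \<circ> g) = (act f \<circ> act g :: ('k \<rightharpoonup> 'm) \<Rightarrow> _)" by (rule ext) (simp add: act_comp)
  then show ?thesis by (simp add: act_comp)
qed

lemma act_act_id:
  fixes b :: "'i \<rightharpoonup> ('k \<rightharpoonup> 'm)"
  shows "act (act id) b = b"
proof -
  have "act id = (id :: ('k \<rightharpoonup> 'm) \<Rightarrow> _)" by (rule ext) (simp add: act_id)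
  then show ?thesis by (simp add: act_id)
qed

lemma act_act_finv:
  fixes b :: "'i \<rightharpoonup> ('k \<rightharpoonup> 'm)"
  shows "f \<in> G \<Longrightarrow> act (act (finv f)) (act (act f) b) = b"
  by (simp add: act_act_comp[symmetric] G_inverse act_act_id)

lemma flat_act:
  fixes b :: "'i \<rightharpoonup> ('k \<rightharpoonup> 'a)"
  shows "flat (act (act f) b) = act f (flat b)"
proof
  fix x :: "'i \<times> 'k"
  obtain i j where "x = (i, j)" by (cases x)
  then show "flat (act (act f) b) x = act f (flat b) x"
    by (cases "b i") (simp_all add: flat_def act_def)
qed

lemma act_act_fixes:
  fixes b :: "'i \<rightharpoonup> ('k \<rightharpoonup> 'm)"
  shows "act (act f) b = b \<longleftrightarrow> (\<forall>m\<in>ran (flat b). f m = m)"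
proof
  assume b: "act (act f) b = b"
  show "\<forall>m\<in>ran (flat b). f m = m"
  proof
    fix m assume "m \<in> ran (flat b)"
    then obtain x where x: "flat b x = Some m" by (auto simp: ran_def)
    have "act f (flat b) x = flat b x" unfolding flat_act[symmetric] b ..
    then show "f m = m" using x by (simp add: act_def)
  qed
next
  assume f: "\<forall>m\<in>ran (flat b). f m = m"
  show "act (act f) b = b"
  proof
    fix i show "act (act f) b i = b i"
    proof (cases "b i")
      case (Some c)
      have "act f c = c"
      proof
        fix j show "act f c j = c j"
        proof (cases "c j")
          case (Some m)
          then have "flat b (i, j) = Some m" using \<open>b i = Some c\<close> by (simp add: flat_def)
          then have "f m = m" using f by (auto simp: ran_def)
          then show ?thesis using Some by (simp add: act_def)
        qed (simp add: act_def)
      qed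
      then show ?thesis using Some by (simp add: act_def)
    qed (simp add: act_def)
  qed
qed

lemma small_tuple: assumes b: "b \<in> tuples" shows "|ran (flat b)| <o \<kappa>"
proof -
  obtain \<alpha> where \<alpha>: "\<alpha> \<in> Field \<kappa>" "dom b = underS \<kappa> \<alpha>" and ran: "ran b \<subseteq> S"
    using b by (auto simp: real_tuples_def)
  have "m \<in> (\<lambda>x. the (flat b x)) ` (underS \<kappa> \<alpha> \<times> underS \<kappa> \<beta>)" if "m \<in> ran (flat b)" for m
  proof -
    from that obtain i j where ij: "flat b (i, j) = Some m" by (auto simp: ran_def)
    then obtain c where c: "b i = Some c" "c j = Some m" by (auto simp: flat_def bind_eq_Some_conv)
    then have "i \<in> underS \<kappa> \<alpha>" "c \<in> S" using \<alpha>(2) ran by (auto simp: ran_def)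
    then have "j \<in> underS \<kappa> \<beta>" using dom_S c(2) by blast
    then show ?thesis using ij \<open>i \<in> underS \<kappa> \<alpha>\<close> by (intro image_eqI[of _ _ "(i, j)"]) auto
  qed
  then have "ran (flat b) \<subseteq> (\<lambda>x. the (flat b x)) ` (underS \<kappa> \<alpha> \<times> underS \<kappa> \<beta>)" by blast
  moreover have "|underS \<kappa> \<alpha> \<times> underS \<kappa> \<beta>| <o \<kappa>"
    by (intro small_Times card card_of_underS \<alpha>(1) \<beta>)
  ultimately show ?thesis using small_image small_subset by blast
qed

text \<open>The preimage under restriction of the relativized strong automorphism group given by \<open>K\<close>.\<close>

definition rel_kernel :: "('m \<Rightarrow> 'm) set \<Rightarrow> ('m \<Rightarrow> 'm) set" where
  "rel_kernel K = {f \<in> G. \<forall>b\<in>tuples. \<exists>k\<in>K. act (act k) b = act (act f) b}"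

lemma Autf_rel_eq: "Autf_rel C \<kappa> e S K = rel ` rel_kernel K"
  by (auto simp: Autf_rel_def Aut_rel_eq rel_kernel_def strong_eq_def act_rel_tuple)

lemma rel_in_Autf_rel: "f \<in> G \<Longrightarrow> rel f \<in> Autf_rel C \<kappa> e S K \<longleftrightarrow> f \<in> rel_kernel K"
  by (simp add: Autf_rel_def Aut_rel_eq rel_kernel_def strong_eq_def act_rel_tuple)

lemma rel_kernel_normal:
  assumes K: "K \<lhd> Aut_group C e"
  shows "rel_kernel K \<lhd> Aut_group C e"
proof -
  have moves: "\<exists>k\<in>K. act (act k) b = act (act f) b" if "f \<in> rel_kernel K" "b \<in> tuples" for f b
    using that by (simp add: rel_kernel_def)
  have G: "f \<in> G" if "f \<in> rel_kernel K" for f using that by (simp add: rel_kernel_def)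
  have "subgroup (rel_kernel K) (Aut_group C e)"
  proof (rule group.subgroupI[OF group_Aut_group])
    show "rel_kernel K \<subseteq> carrier (Aut_group C e)" using G by auto
    show "rel_kernel K \<noteq> {}"
      using normal_id[OF K] G_id by (auto simp: rel_kernel_def)
    fix f assume f: "f \<in> rel_kernel K"
    have "finv f \<in> rel_kernel K"
      unfolding rel_kernel_def
    proof (intro CollectI conjI ballI G_inv G f)
      fix b assume b: "b \<in> tuples"
      from moves[OF f act_tuple[OF G_inv[OF G[OF f]] b]] obtain k where k: "k \<in> K"
        "act (act k) (act (act (finv f)) b) = act (act f) (act (act (finv f)) b)" by blast
      have "act (act (finv k)) b = act (act (finv f)) b"
      proof -
        have "act (act f) (act (act (finv f)) b) = b"
          by (simp add: act_act_comp[symmetric] G_inverse[OF G[OF f]] act_act_id)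
        then show ?thesis
          using k(2) act_act_finv[OF normal_G[OF K k(1)], of "act (act (finv f)) b"] by simp
      qed
      then show "\<exists>k\<in>K. act (act k) b = act (act (finv f)) b"
        using normal_finv[OF K k(1)] by blast
    qed
    then show "inv\<^bsub>Aut_group C e\<^esub> f \<in> rel_kernel K" using G[OF f] by simp
    fix g assume g: "g \<in> rel_kernel K"
    have "f \<circ> g \<in> rel_kernel K"
      unfolding rel_kernel_def
    proof (intro CollectI conjI ballI G_comp G f g)
      fix b assume b: "b \<in> tuples"
      from moves[OF g b] obtain k where k: "k \<in> K" "act (act k) b = act (act g) b" by blast
      from moves[OF f act_tuple[OF G[OF g] b]] obtain l where l: "l \<in> K"
        "act (act l) (act (act g) b) = act (act f) (act (act g) b)" by blast
      have "act (act (l \<circ> k)) b = act (act (f \<circ> g)) b"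
        unfolding act_act_comp k(2) l(2) ..
      then show "\<exists>k\<in>K. act (act k) b = act (act (f \<circ> g)) b"
        using normal_comp[OF K l(1) k(1)] by blast
    qed
    then show "f \<otimes>\<^bsub>Aut_group C e\<^esub> g \<in> rel_kernel K" using G f g by simp
  qed
  then show ?thesis
  proof (rule group.normal_invI[OF group_Aut_group])
    fix g f assume g: "g \<in> carrier (Aut_group C e)" and f: "f \<in> rel_kernel K"
    then have gG: "g \<in> G" by simp
    have "g \<circ> f \<circ> finv g \<in> rel_kernel K"
      unfolding rel_kernel_def
    proof (intro CollectI conjI ballI)
      show "g \<circ> f \<circ> finv g \<in> G" by (simp add: G_comp G_inv G[OF f] gG)
      fix b assume b: "b \<in> tuples"
      from moves[OF f act_tuple[OF G_inv[OF gG] b]] obtain k where k: "k \<in> K"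
        "act (act k) (act (act (finv g)) b) = act (act f) (act (act (finv g)) b)" by blast
      have "act (act (g \<circ> k \<circ> finv g)) b = act (act (g \<circ> f \<circ> finv g)) b"
        unfolding act_act_comp k(2) ..
      then show "\<exists>k\<in>K. act (act k) b = act (act (g \<circ> f \<circ> finv g)) b"
        using normal_conj[OF K gG k(1)] by blast
    qed
    then show "g \<otimes>\<^bsub>Aut_group C e\<^esub> f \<otimes>\<^bsub>Aut_group C e\<^esub> inv\<^bsub>Aut_group C e\<^esub> g \<in> rel_kernel K"
      using gG G f by (simp add: G_comp G_inv)
  qed
qed

lemma rel_coset:
  assumes f: "f \<in> G" and K: "K \<lhd> Aut_group C e"
  shows "Autf_rel C \<kappa> e S K #>\<^bsub>Aut_rel_group C e S\<^esub> rel f = (\<lambda>n. rel (n \<circ> f)) ` rel_kernel K"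
proof -
  have "rel n \<otimes>\<^bsub>Aut_rel_group C e S\<^esub> rel f = rel (n \<circ> f)" if "n \<in> rel_kernel K" for n
    using that f by (intro rel_comp) (simp_all add: rel_kernel_def)
  then show ?thesis by (auto simp: r_coset_def Autf_rel_eq)
qed

text \<open>Restriction is a homomorphism, so it identifies the cosets of the relativized group with those
  of its preimage.\<close>

lemma rel_coset_eq_iff:
  assumes f: "f \<in> G" and g: "g \<in> G" and K: "K \<lhd> Aut_group C e"
  shows "Autf_rel C \<kappa> e S K #>\<^bsub>Aut_rel_group C e S\<^esub> rel f =
      Autf_rel C \<kappa> e S K #>\<^bsub>Aut_rel_group C e S\<^esub> rel g \<longleftrightarrow> f \<circ> finv g \<in> rel_kernel K"
proof
  note N = rel_kernel_normal[OF K]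
  assume "Autf_rel C \<kappa> e S K #>\<^bsub>Aut_rel_group C e S\<^esub> rel f =
      Autf_rel C \<kappa> e S K #>\<^bsub>Aut_rel_group C e S\<^esub> rel g"
  then have "rel (id \<circ> f) \<in> (\<lambda>n. rel (n \<circ> g)) ` rel_kernel K"
    unfolding rel_coset[OF f K] rel_coset[OF g K] using normal_id[OF N] by blast
  then obtain n where n: "n \<in> rel_kernel K" "rel f = rel (n \<circ> g)" by auto
  have nG: "n \<in> G" using normal_G[OF N n(1)] .
  have "rel (f \<circ> finv g) = rel n"
  proof -
    have "rel (f \<circ> finv g) = rel f \<otimes>\<^bsub>Aut_rel_group C e S\<^esub> rel (finv g)"
      using f g G_inv by (simp add: rel_comp)
    also have "\<dots> = rel ((n \<circ> g) \<circ> finv g)"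
      unfolding n(2) using nG g G_inv G_comp by (intro rel_comp) auto
    also have "\<dots> = rel n" by (simp add: comp_assoc G_inverse[OF g])
    finally show ?thesis .
  qed
  then have "rel (f \<circ> finv g) \<in> Autf_rel C \<kappa> e S K" using n(1) by (simp add: Autf_rel_eq)
  then show "f \<circ> finv g \<in> rel_kernel K" using rel_in_Autf_rel f g G_comp G_inv by blast
next
  note N = rel_kernel_normal[OF K]
  have sub: "(\<lambda>n. rel (n \<circ> f)) ` rel_kernel K \<subseteq> (\<lambda>n. rel (n \<circ> g)) ` rel_kernel K"
    if g: "g \<in> G" and fg: "f \<circ> finv g \<in> rel_kernel K" for f g
  proof
    fix x assume "x \<in> (\<lambda>n. rel (n \<circ> f)) ` rel_kernel K"
    then obtain n where n: "n \<in> rel_kernel K" "x = rel (n \<circ> f)" by blast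
    have "n \<circ> f = (n \<circ> (f \<circ> finv g)) \<circ> g" by (simp add: comp_assoc G_inverse[OF g])
    moreover have "n \<circ> (f \<circ> finv g) \<in> rel_kernel K" by (rule normal_comp[OF N n(1) fg])
    ultimately show "x \<in> (\<lambda>n. rel (n \<circ> g)) ` rel_kernel K" using n(2) by (intro image_eqI) simp_all
  qed
  assume fg: "f \<circ> finv g \<in> rel_kernel K"
  have "finv (f \<circ> finv g) = g \<circ> finv f"
    using f g G_inv by (simp add: finv_comp finv_finv)
  then have gf: "g \<circ> finv f \<in> rel_kernel K" using normal_finv[OF N fg] by simp
  show "Autf_rel C \<kappa> e S K #>\<^bsub>Aut_rel_group C e S\<^esub> rel f =
      Autf_rel C \<kappa> e S K #>\<^bsub>Aut_rel_group C e S\<^esub> rel g"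
    unfolding rel_coset[OF f K] rel_coset[OF g K] using sub[OF g fg] sub[OF f gf] by (rule equalityI)
qed

lemma carrier_Autf_rel_Mod:
  "carrier ((Aut_rel_group C e S)\<lparr>carrier := Autf_rel C \<kappa> e S K\<rparr> Mod N) =
     (\<lambda>f. N #>\<^bsub>Aut_rel_group C e S\<^esub> rel f) ` rel_kernel K"
  by (auto simp: FactGroup_def RCOSETS_def r_coset_def Autf_rel_eq)

end

section \<open>Comparing the two Galois groups\<close>

text \<open>\<open>X\<close> and \<open>Y\<close> are the pulled-back topologies of the Galois group of the theory and of the
  relativized one. The set \<open>A\<close> will consist of the entries of the Lascar tuple.\<close>

context relative
begin

context
  fixes M :: "'m set" and A :: "'m set" and N :: "('m \<Rightarrow> 'm) set"
    and X Y :: "('m \<Rightarrow> 'm) topology"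
  assumes base_M: "base M N" and base_A: "base A (rel_kernel N)"
    and X: "\<And>B. closedin X B \<longleftrightarrow> base_closed M N B"
    and Y: "\<And>B. closedin Y B \<longleftrightarrow> base_closed A (rel_kernel N) B"
begin

interpretation X: compact_group_topology "Aut_group C e" X
  by (rule base_group_topology[OF base_M X])

interpretation Y: compact_group_topology "Aut_group C e" Y
  by (rule base_group_topology[OF base_A Y])

lemma N_normal: "N \<lhd> Aut_group C e"
  using base_M by (simp add: base_def)

lemma kernel_normal: "rel_kernel N \<lhd> Aut_group C e"
  using base_A by (simp add: base_def)

lemma N_subset_kernel: "N \<subseteq> rel_kernel N"
  using normal_G[OF N_normal] by (auto simp: rel_kernel_def)

lemma closedin_X_of_Y: "closedin Y B \<Longrightarrow> closedin X B"
proof -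
  assume "closedin Y B"
  then have B: "base_closed A (rel_kernel N) B" by (simp add: Y)
  have "base_closed M N B"
  proof (rule base_closedI[OF base_M])
    show "|A| <o \<kappa>" using base_A by (simp add: base_def)
    show "type_definable_set A B" using B by (simp add: base_closed_def)
    show "k \<circ> f \<in> B" if "f \<in> B" "k \<in> N" for f k
      using B that N_subset_kernel by (auto simp: base_closed_def)
  qed
  then show "closedin X B" by (simp add: X)
qed

lemma closedin_Y_of_X:
  assumes B: "closedin X B" and inv: "\<And>f n. f \<in> B \<Longrightarrow> n \<in> rel_kernel N \<Longrightarrow> n \<circ> f \<in> B"
  shows "closedin Y B"
proof -
  have "base_closed A (rel_kernel N) B"
  proof (rule base_closedI[OF base_A])
    show "|M| <o \<kappa>" using base_M by (simp add: base_def)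
    show "type_definable_set M B" using B by (simp add: X base_closed_def)
  qed (fact inv)
  then show ?thesis by (simp add: Y)
qed

text \<open>If \<open>N\<close> is the group of Lascar strong automorphisms, this is the Kim-Pillay group.\<close>

abbreviation H :: "('m \<Rightarrow> 'm) set" where "H \<equiv> X closure_of {id}"

lemma H_G: "h \<in> H \<Longrightarrow> h \<in> G"
  using X.cl_one_subset by auto

lemma closed_H_mult:
  assumes "closedin X B" "f \<in> B" "h \<in> H"
  shows "h \<circ> f \<in> B" "f \<circ> h \<in> B"
proof -
  have fG: "f \<in> G" using X.closed_subset assms by auto
  have "h \<in> X.cl_one" using assms(3) by simp
  from X.closed_cl_one_mult[OF assms(1,2) this] show "h \<circ> f \<in> B" "f \<circ> h \<in> B"
    using H_G[OF assms(3)] fG by simp_all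
qed

lemma H_finv: "h \<in> H \<Longrightarrow> finv h \<in> H"
  using X.cl_one_inv[of h] H_G[of h] by simp

lemma H_conj: "f \<in> G \<Longrightarrow> h \<in> H \<Longrightarrow> f \<circ> h \<circ> finv f \<in> H"
  using X.cl_one_conj[of f h] H_G[of h] by (simp add: G_comp G_inv)

lemma N_subset_H: "N \<subseteq> H"
proof
  fix n assume n: "n \<in> N"
  have "closedin X H" by simp
  moreover have "id \<in> H" using X.one_in_cl_one by simp
  ultimately have "n \<circ> id \<in> H" using n unfolding X base_closed_def by blast
  then show "n \<in> H" by simp
qed

text \<open>This is the product of \<open>H\<close> and the stabilizer of \<open>c\<close>.\<close>

definition moved_by_H :: "('k \<rightharpoonup> ('k \<rightharpoonup> 'm)) \<Rightarrow> ('m \<Rightarrow> 'm) set" where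
  "moved_by_H c = {f \<in> G. \<exists>h\<in>H. act (act h) c = act (act f) c}"

lemma closedin_moved_by_H:
  assumes c: "c \<in> tuples"
  shows "closedin X (moved_by_H c)"
proof -
  let ?St = "{g \<in> G. \<forall>m\<in>ran (flat c). g m = m}"
  have "base_closed M N {f \<in> G. \<exists>g\<in>?St. finv f \<circ> g \<in> H}"
    by (rule base_closed_quotient[OF base_M _ small_tuple[OF c] type_definable_stabilizer])
      (simp add: X[symmetric])
  moreover have "{f \<in> G. \<exists>g\<in>?St. finv f \<circ> g \<in> H} = moved_by_H c"
  proof (intro Set.set_eqI iffI)
    fix f assume "f \<in> {f \<in> G. \<exists>g\<in>?St. finv f \<circ> g \<in> H}"
    then obtain g where f: "f \<in> G" and g: "g \<in> G" "\<forall>m\<in>ran (flat c). g m = m" "finv f \<circ> g \<in> H" by blast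
    have gc: "act (act g) c = c" using g(2) by (simp add: act_act_fixes)
    have "f \<circ> (finv f \<circ> g) \<circ> finv f \<in> H" by (rule H_conj[OF f g(3)])
    then have h: "finv (f \<circ> (finv f \<circ> g) \<circ> finv f) \<in> H" by (rule H_finv)
    have "finv (f \<circ> (finv f \<circ> g) \<circ> finv f) = f \<circ> finv g"
      using f g(1) G_inv by (simp add: G_cancel finv_comp finv_finv)
    then have "f \<circ> finv g \<in> H" using h by simp
    moreover have "act (act (f \<circ> finv g)) c = act (act f) c"
      using act_act_finv[OF g(1), of c] by (simp add: act_act_comp gc)
    ultimately show "f \<in> moved_by_H c" using f by (auto simp: moved_by_H_def)
  next
    fix f assume "f \<in> moved_by_H c"
    then obtain h where f: "f \<in> G" and h: "h \<in> H" "act (act h) c = act (act f) c"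
      by (auto simp: moved_by_H_def)
    have "act (act (finv h \<circ> f)) c = c"
      using act_act_finv[OF H_G[OF h(1)], of c] by (simp add: act_act_comp h(2))
    then have "finv h \<circ> f \<in> ?St" using f G_inv[OF H_G[OF h(1)]] G_comp by (simp add: act_act_fixes)
    moreover have "finv f \<circ> (finv h \<circ> f) \<in> H"
    proof -
      have "finv f \<circ> finv h \<circ> finv (finv f) \<in> H" by (rule H_conj[OF G_inv[OF f] H_finv[OF h(1)]])
      then show ?thesis by (simp add: comp_assoc finv_finv[OF f])
    qed
    ultimately show "f \<in> {f \<in> G. \<exists>g\<in>?St. finv f \<circ> g \<in> H}" using f by blast
  qed
  ultimately show ?thesis by (simp add: X)
qed

lemma kernel_moved:
  assumes c: "c \<in> tuples" and n: "n \<in> rel_kernel N"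
  shows "n \<in> moved_by_H c"
  using assms N_subset_H unfolding rel_kernel_def moved_by_H_def by blast

lemma closedin_Y_moved_by_H:
  assumes c: "c \<in> tuples"
  shows "closedin Y (moved_by_H c)"
proof (rule closedin_Y_of_X[OF closedin_moved_by_H[OF c]])
  fix f n assume "f \<in> moved_by_H c" and n: "n \<in> rel_kernel N"
  then obtain h where f: "f \<in> G" and h: "h \<in> H" "act (act h) c = act (act f) c"
    by (auto simp: moved_by_H_def)
  obtain n0 where n0: "n0 \<in> N" "act (act n0) (act (act f) c) = act (act n) (act (act f) c)"
    using n act_tuple[OF f c] by (auto simp: rel_kernel_def)
  have "n0 \<circ> h \<in> H"
    using closed_H_mult(1)[OF closedin_closure_of h(1)] n0(1) N_subset_H by blast
  moreover have "act (act (n0 \<circ> h)) c = act (act (n \<circ> f)) c"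
    by (simp add: act_act_comp h(2) n0(2))
  moreover have "n \<circ> f \<in> G" using normal_G[OF kernel_normal n] f G_comp by blast
  ultimately show "n \<circ> f \<in> moved_by_H c" unfolding moved_by_H_def by blast
qed

text \<open>If \<open>f\<close> agrees with \<open>k\<close> on \<open>b\<close>, then \<open>k\<inverse> f\<close> stabilizes \<open>b\<close>. For a Lascar tuple \<open>b\<close> the stabilizer
  consists of automorphisms whose restriction is Lascar strong.\<close>

lemma rel_kernel_factor:
  assumes A: "\<And>s. s \<in> G \<Longrightarrow> act (act s) b = b \<Longrightarrow> s \<in> rel_kernel N"
    and b: "b \<in> tuples" and f: "f \<in> rel_kernel K" and K: "K \<subseteq> G"
  shows "\<exists>k\<in>K. \<exists>s\<in>rel_kernel N. f = k \<circ> s"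
proof -
  from f b obtain k where fG: "f \<in> G" and k: "k \<in> K" "act (act k) b = act (act f) b"
    by (auto simp: rel_kernel_def)
  have kG: "k \<in> G" using k(1) K by blast
  have "act (act (finv k \<circ> f)) b = b"
    using act_act_finv[OF kG, of b] by (simp add: act_act_comp k(2))
  then have "finv k \<circ> f \<in> rel_kernel N" using A fG kG G_inv G_comp by blast
  moreover have "f = k \<circ> (finv k \<circ> f)" by (rule ext) (simp add: G_inverse[OF kG])
  ultimately show ?thesis using k(1) by blast
qed

text \<open>The closure is contained in each of the closed sets \<open>H Stab(c)\<close>. Conversely it contains \<open>N'\<close> and
  is invariant under \<open>H\<close>, as is every closed set.\<close>

theorem closure_eq_rel_kernel:
  assumes A: "\<And>s. s \<in> G \<Longrightarrow> act (act s) b = b \<Longrightarrow> s \<in> rel_kernel N" and b: "b \<in> tuples"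
  shows "Y closure_of {id} = rel_kernel H"
proof
  show "Y closure_of {id} \<subseteq> rel_kernel H"
  proof
    fix f assume f: "f \<in> Y closure_of {id}"
    have "f \<in> moved_by_H c" if c: "c \<in> tuples" for c
    proof -
      have "id \<in> moved_by_H c" using kernel_moved[OF c normal_id[OF kernel_normal]] .
      then have "Y closure_of {id} \<subseteq> moved_by_H c"
        using Y.cl_one_minimal[OF closedin_Y_moved_by_H[OF c]] by simp
      then show ?thesis using f by blast
    qed
    moreover have "f \<in> G" using f Y.cl_one_subset by auto
    ultimately show "f \<in> rel_kernel H" by (simp add: rel_kernel_def moved_by_H_def)
  qed
  show "rel_kernel H \<subseteq> Y closure_of {id}"
  proof
    let ?Q = "Y closure_of {id}"
    fix f assume f: "f \<in> rel_kernel H"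
    have "H \<subseteq> G" using H_G by blast
    from rel_kernel_factor[OF A b f this] obtain h s where h: "h \<in> H" and s: "s \<in> rel_kernel N" "f = h \<circ> s" by blast
    have "id \<in> ?Q" using Y.one_in_cl_one by simp
    moreover have "base_closed A (rel_kernel N) ?Q" by (simp add: Y[symmetric])
    ultimately have "s \<circ> id \<in> ?Q" using s(1) unfolding base_closed_def by blast
    then have "h \<circ> s \<in> ?Q"
      using closed_H_mult(1)[OF closedin_X_of_Y[OF closedin_closure_of] _ h] by simp
    then show "f \<in> ?Q" using s by simp
  qed
qed

text \<open>\<open>W = V N'\<close>, with \<open>N'\<close> normal, is a subgroup and a union of translates of \<open>V\<close>, thus an open and hence
  closed subgroup; being \<open>N'\<close>-invariant, it is clopen for the coarser topology too.\<close>

lemma open_subgroup_kernel_clopen: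
  assumes V: "X.open_subgroup V"
  defines "W \<equiv> {g \<in> G. \<exists>n\<in>rel_kernel N. g \<circ> n \<in> V}"
  shows "closedin Y W" "openin Y W"
proof -
  note K = kernel_normal
  interpret V: subgroup V "Aut_group C e" using V by (simp add: X.open_subgroup_def)
  have VG: "V \<subseteq> G" using V.subset by simp
  have Vcomp: "f \<circ> g \<in> V" if "f \<in> V" "g \<in> V" for f g
    using V.m_closed[OF that] subsetD[OF VG that(1)] subsetD[OF VG that(2)] by simp
  have Vfinv: "finv f \<in> V" if "f \<in> V" for f
    using V.m_inv_closed[OF that] subsetD[OF VG that] by simp
  have Vid: "id \<in> V" using V.one_closed by simp
  have W_left: "n \<circ> g \<in> W" if g: "g \<in> W" and n: "n \<in> rel_kernel N" for g n
  proof -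
    from g obtain m where m: "g \<in> G" "m \<in> rel_kernel N" "g \<circ> m \<in> V" by (auto simp: W_def)
    have nG: "n \<in> G" using normal_G[OF K n] .
    have "finv g \<circ> finv n \<circ> g \<circ> m \<in> rel_kernel N"
      using normal_comp[OF K normal_conj'[OF K m(1) normal_finv[OF K n]] m(2)] .
    moreover have "(n \<circ> g) \<circ> (finv g \<circ> finv n \<circ> g \<circ> m) = g \<circ> m"
      by (rule ext) (simp add: G_inverse[OF m(1)] G_inverse[OF nG])
    ultimately show ?thesis unfolding W_def using m nG G_comp by force
  qed
  have "subgroup W (Aut_group C e)"
  proof (rule group.subgroupI[OF group_Aut_group])
    show "W \<subseteq> carrier (Aut_group C e)" by (auto simp: W_def)
    have "id \<in> W" unfolding W_def using Vid G_id normal_id[OF K] by (intro CollectI conjI bexI[of _ id]) auto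
    then show "W \<noteq> {}" by blast
    fix f assume "f \<in> W"
    then obtain m where m: "f \<in> G" "m \<in> rel_kernel N" "f \<circ> m \<in> V" by (auto simp: W_def)
    have mG: "m \<in> G" using normal_G[OF K m(2)] .
    have eq: "finv f \<circ> (f \<circ> finv m \<circ> finv f) = finv (f \<circ> m)"
      using m(1) mG by (simp add: finv_comp comp_assoc G_cancel)
    have "finv f \<in> W"
      unfolding W_def using normal_conj[OF K m(1) normal_finv[OF K m(2)]] eq Vfinv[OF m(3)] G_inv[OF m(1)]
      by (intro CollectI conjI bexI[of _ "f \<circ> finv m \<circ> finv f"]) simp_all
    then show "inv\<^bsub>Aut_group C e\<^esub> f \<in> W" using m(1) by simp
    fix g assume "g \<in> W"
    then obtain l where l: "g \<in> G" "l \<in> rel_kernel N" "g \<circ> l \<in> V" by (auto simp: W_def)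
    have "finv g \<circ> m \<circ> g \<circ> l \<in> rel_kernel N"
      using normal_comp[OF K normal_conj'[OF K l(1) m(2)] l(2)] .
    moreover have "(f \<circ> g) \<circ> (finv g \<circ> m \<circ> g \<circ> l) = (f \<circ> m) \<circ> (g \<circ> l)"
      by (rule ext) (simp add: G_inverse[OF l(1)])
    ultimately have "f \<circ> g \<in> W"
      unfolding W_def using Vcomp[OF m(3) l(3)] G_comp[OF m(1) l(1)]
      by (intro CollectI conjI bexI[of _ "finv g \<circ> m \<circ> g \<circ> l"]) simp_all
    then show "f \<otimes>\<^bsub>Aut_group C e\<^esub> g \<in> W" using m(1) l(1) by simp
  qed
  moreover have "openin X W"
  proof -
    have "W = (\<Union>n\<in>rel_kernel N. {g \<in> carrier (Aut_group C e). g \<otimes>\<^bsub>Aut_group C e\<^esub> n \<in> V})"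
      unfolding W_def using normal_G[OF K] by auto
    also have "openin X \<dots>"
      using V normal_G[OF K] by (intro openin_Union) (auto simp: X.open_subgroup_def intro!: X.open_translate(2)[simplified])
    finally show ?thesis .
  qed
  ultimately have W: "X.open_subgroup W" by (simp add: X.open_subgroup_def)
  show "closedin Y W"
    by (rule closedin_Y_of_X[OF X.open_subgroup_closed[OF W] W_left])
  have "closedin Y (G - W)"
  proof (rule closedin_Y_of_X)
    show "closedin X (G - W)"
      using closedin_diff[OF closedin_topspace] W X.topspace by (metis Aut_group_carrier X.open_subgroup_def)
    fix f n assume f: "f \<in> G - W" and n: "n \<in> rel_kernel N"
    have nG: "n \<in> G" using normal_G[OF K n] .
    have "n \<circ> f \<notin> W"
    proof
      assume "n \<circ> f \<in> W"
      then have "finv n \<circ> (n \<circ> f) \<in> W" using W_left normal_finv[OF K n] by blast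
      then have "f \<in> W" by (simp add: comp_assoc[symmetric] G_inverse[OF nG])
      then show False using f by blast
    qed
    then show "n \<circ> f \<in> G - W" using f nG G_comp by blast
  qed
  then have "openin Y (topspace Y - (G - W))" by blast
  moreover have "topspace Y - (G - W) = W" using Y.topspace by (auto simp: W_def)
  ultimately show "openin Y W" by simp
qed

text \<open>For the first inclusion, \<open>f\<close> belongs to \<open>V N'\<close> for every open subgroup \<open>V\<close>, and \<open>N'\<close> is contained
  in the closed set \<open>H Stab(c)\<close>; so the compactness argument of \<open>component_coset\<close> applies. The factor
  from \<open>H\<close> is absorbed by the component, which is closed.\<close>

theorem component_eq_rel_kernel:
  assumes A: "\<And>s. s \<in> G \<Longrightarrow> act (act s) b = b \<Longrightarrow> s \<in> rel_kernel N" and b: "b \<in> tuples"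
  shows "connected_component_of_set Y id = rel_kernel (connected_component_of_set X id)"
proof
  let ?X0 = "connected_component_of_set X id" and ?Y0 = "connected_component_of_set Y id"
  have X0: "closedin X ?X0" "?X0 \<subseteq> G"
    using closedin_connected_component_of[of X id] X.closed_subset by auto
  show "?Y0 \<subseteq> rel_kernel ?X0"
  proof
    fix f assume f: "f \<in> ?Y0"
    then have fG: "f \<in> G" using connected_component_of_subset_topspace[of Y id] Y.topspace by auto
    have "\<exists>k\<in>?X0. act (act k) c = act (act f) c" if c: "c \<in> tuples" for c
    proof -
      let ?L = "moved_by_H c"
      have "\<exists>l\<in>?L. f \<otimes>\<^bsub>Aut_group C e\<^esub> inv\<^bsub>Aut_group C e\<^esub> l \<in> X.component"
      proof (rule X.component_coset[OF closedin_moved_by_H[OF c]])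
        show "f \<in> carrier (Aut_group C e)" using fG by simp
        fix V assume V: "X.open_subgroup V"
        let ?W = "{g \<in> G. \<exists>n\<in>rel_kernel N. g \<circ> n \<in> V}"
        have "id \<in> V" using V by (auto simp: X.open_subgroup_def dest: subgroup.one_closed)
        then have "id \<in> ?W" using G_id normal_id[OF kernel_normal] by (intro CollectI conjI bexI[of _ id]) auto
        moreover have "quasi_component_of Y id f"
          using f by (simp add: connected_imp_quasi_component_of)
        ultimately have "f \<in> ?W"
          using open_subgroup_kernel_clopen[OF V] unfolding quasi_component_of_def by blast
        then obtain n where n: "n \<in> rel_kernel N" "f \<circ> n \<in> V" by blast
        have nG: "n \<in> G" using normal_G[OF kernel_normal n(1)] .
        have "f \<otimes>\<^bsub>Aut_group C e\<^esub> inv\<^bsub>Aut_group C e\<^esub> (finv n) = f \<circ> n"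
          using fG nG G_inv finv_finv by simp
        moreover have "finv n \<in> ?L" using kernel_moved[OF c normal_finv[OF kernel_normal n(1)]] .
        ultimately show "\<exists>l\<in>?L. f \<otimes>\<^bsub>Aut_group C e\<^esub> inv\<^bsub>Aut_group C e\<^esub> l \<in> V"
          using n(2) by (intro bexI[of _ "finv n"]) simp_all
      qed
      then obtain l where l: "l \<in> ?L" "f \<otimes>\<^bsub>Aut_group C e\<^esub> inv\<^bsub>Aut_group C e\<^esub> l \<in> ?X0" by auto
      from l(1) obtain h where h: "l \<in> G" "h \<in> H" "act (act h) c = act (act l) c"
        by (auto simp: moved_by_H_def)
      have "f \<circ> finv l \<in> ?X0" using l(2) fG h(1) G_inv by simp
      then have "(f \<circ> finv l) \<circ> h \<in> ?X0" by (rule closed_H_mult(2)[OF X0(1) _ h(2)])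
      moreover have "act (act ((f \<circ> finv l) \<circ> h)) c = act (act f) c"
        using act_act_finv[OF h(1), of c] by (simp add: act_act_comp h(3))
      ultimately show ?thesis by blast
    qed
    then show "f \<in> rel_kernel ?X0" using fG by (simp add: rel_kernel_def)
  qed
  show "rel_kernel ?X0 \<subseteq> ?Y0"
  proof
    fix f assume f: "f \<in> rel_kernel ?X0"
    from rel_kernel_factor[OF A b f X0(2)] obtain k s where k: "k \<in> ?X0" and s: "s \<in> rel_kernel N" "f = k \<circ> s" by blast
    have kG: "k \<in> G" using k X0(2) by blast
    have "continuous_map X Y id"
      unfolding continuous_map_closedin
    proof (intro conjI allI impI)
      show "id \<in> topspace X \<rightarrow> topspace Y" using X.topspace Y.topspace by simp
      fix B assume B: "closedin Y B"
      have "{x \<in> topspace X. id x \<in> B} = B"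
        using closedin_subset[OF closedin_X_of_Y[OF B]] by auto
      then show "closedin X {x \<in> topspace X. id x \<in> B}" using closedin_X_of_Y[OF B] by simp
    qed
    from connectedin_continuous_map_image[OF this connectedin_connected_component_of[of X id]]
    have "connectedin Y ?X0" by simp
    moreover have "id \<in> ?X0"
      using X.topspace G_id by (simp add: connected_component_of_refl)
    ultimately have "k \<in> ?Y0" using k unfolding connected_component_of_def by blast
    moreover have "base_closed A (rel_kernel N) ?Y0"
      using closedin_connected_component_of[of Y id] by (simp add: Y)
    moreover have "k \<circ> s \<circ> finv k \<in> rel_kernel N" by (rule normal_conj[OF kernel_normal kG s(1)])
    ultimately have "(k \<circ> s \<circ> finv k) \<circ> k \<in> ?Y0" unfolding base_closed_def by blast
    moreover have "(k \<circ> s \<circ> finv k) \<circ> k = f"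
      unfolding s(2) by (rule ext) (simp add: G_inverse[OF kG])
    ultimately show "f \<in> ?Y0" by simp
  qed
qed

end

end

theorem theorem2p19:
  fixes T :: "('f, 'r, nat) fm set"
    and C :: "('f, 'r, 'm) struct"
    and \<kappa> :: "'k rel"
    and e :: "('k \<rightharpoonup> 'm) set"
    and \<beta> :: 'k
    and \<Sigma> :: "('f, 'r, ('k, 'm) var) fm set"
    and S :: "('k \<rightharpoonup> 'm) set"
    and M :: "'m set"
    and b :: "'k \<rightharpoonup> ('k \<rightharpoonup> 'm)"
  assumes "monster_model T C \<kappa>"
    and "hyperimaginary C \<kappa> e"
    and "\<beta> \<in> Field \<kappa>"
    and "partial_type C \<kappa> (underS \<kappa> \<beta>) \<Sigma>"
    and S: "S = solutions C (underS \<kappa> \<beta>) \<Sigma>"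
    and "invariant_over C e (underS \<kappa> \<beta>) S"
    and "\<exists>c\<in>real_tuples \<kappa> S. in_dcl C e (ran (flat c))"
    \<comment> \<open>any model and any Lascar tuple through which the two topologies are defined\<close>
    and "small_model C \<kappa> M" "in_dcl C e M"
    and "lascar_tuple C \<kappa> e S b" "in_dcl C e (ran (flat b))"
  shows "Gal_c_rel C \<kappa> e S b =
           carrier ((Aut_rel_group C e S)\<lparr>carrier := Autf_KP_rel C \<kappa> e M S\<rparr> Mod Autf_L_rel C \<kappa> e S) \<and>
         Gal_0_rel C \<kappa> e S b =
           carrier ((Aut_rel_group C e S)\<lparr>carrier := Autf_S_rel C \<kappa> e M S\<rparr> Mod Autf_L_rel C \<kappa> e S)"
proof -
  interpret relative C \<kappa> e \<beta> S
    using assms by unfold_locales (auto simp: monster_model_def solutions_def)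
  define N where "N = Autf_L C \<kappa> e"
  define N' where "N' = Autf_L_rel C \<kappa> e S"
  have base_M: "base M N" unfolding N_def using assms by (intro base_Autf_L)
  have N: "N \<lhd> Aut_group C e" using base_M by (simp add: base_def)
  have b: "b \<in> tuples"
    and lascar: "Autf_L_rel C \<kappa> e S = {\<sigma> \<in> Aut_rel C e S. strong_eq N b (act \<sigma> b)}"
    using assms(10) unfolding lascar_tuple_def N_def by blast+
  \<comment> \<open>The defining property of a Lascar tuple: it alone decides membership in the kernel.\<close>
  have Nb: "f \<in> rel_kernel N \<longleftrightarrow> f \<in> G \<and> (\<exists>n\<in>N. act (act n) b = act (act f) b)" for f
  proof (cases "f \<in> G")
    case True
    have "f \<in> rel_kernel N \<longleftrightarrow> rel f \<in> Autf_L_rel C \<kappa> e S"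
      using rel_in_Autf_rel[OF True] by (simp add: N_def)
    also have "\<dots> \<longleftrightarrow> strong_eq N b (act (rel f) b)"
      unfolding lascar using True by (simp add: Aut_rel_eq)
    finally show ?thesis using True by (simp add: strong_eq_def act_rel_tuple[OF b])
  qed (simp add: rel_kernel_def)
  have stab: "s \<in> rel_kernel N" if "s \<in> G" "act (act s) b = b" for s
    unfolding Nb that(2) by (intro conjI that(1) bexI[of _ id] act_act_id normal_id[OF N])
  have base_b: "base (ran (flat b)) (rel_kernel N)"
  proof -
    have "h \<in> rel_kernel N" if "h \<in> aut C" "\<forall>m\<in>ran (flat b). h m = m" for h
      using that dcl_fix[of "ran (flat b)" h] assms by (intro stab) (simp_all add: act_act_fixes)
    then show ?thesis
      using small_tuple[OF b] rel_kernel_normal[OF N] assms by (simp add: base_def)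
  qed
  \<comment> \<open>The coset maps from \<open>G\<close> onto the two Galois groups, and the topologies they pull back.\<close>
  define cosetL where "cosetL = (\<lambda>f. N #>\<^bsub>Aut_group C e\<^esub> f)"
  define cosetR where "cosetR = (\<lambda>f. N' #>\<^bsub>Aut_rel_group C e S\<^esub> rel f)"
  define TL where "TL = Gal_L_topology C \<kappa> e M"
  define TR where "TR = Gal_L_rel_topology C \<kappa> e S b"
  define X where "X = pullback_topology G cosetL TL"
  define Y where "Y = pullback_topology G cosetR TR"
  have ran_M: "ran (self_tuple M) = M" by (auto simp: self_tuple_def ran_def restrict_map_def)
  have L: "topspace TL = cosetL ` G" "closedin X B \<longleftrightarrow> base_closed M N B" for B
    unfolding X_def TL_def cosetL_def Gal_L_topology_def N_def[symmetric]
    by (rule type_quotient_topology_pullback[OF base_M ran_M, where \<rho> = "\<lambda>f. f"];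
        simp add: coset_eq_iff[OF N])+
  have carrier_rel: "carrier (Aut_rel_group C e S) = rel ` G"
    by (simp add: Aut_rel_group_def Aut_rel_eq)
  have coset_rel: "N' #>\<^bsub>Aut_rel_group C e S\<^esub> rel f = N' #>\<^bsub>Aut_rel_group C e S\<^esub> rel g \<longleftrightarrow>
      f \<circ> finv g \<in> rel_kernel N" if "f \<in> G" "g \<in> G" for f g
    using rel_coset_eq_iff[OF that N] by (simp add: N'_def N_def)
  have R: "topspace TR = cosetR ` G" "closedin Y B \<longleftrightarrow> base_closed (ran (flat b)) (rel_kernel N) B" for B
    unfolding Y_def TR_def cosetR_def Gal_L_rel_topology_def N'_def[symmetric]
    by (rule type_quotient_topology_pullback[OF base_b refl, where \<rho> = rel];
        simp add: carrier_rel coset_rel act_rel_tuple[OF b] flat_act)+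
  have oneL: "\<one>\<^bsub>Gal_L C \<kappa> e\<^esub> = cosetL id"
  proof -
    interpret normal N "Aut_group C e" by (fact N)
    have "N #>\<^bsub>Aut_group C e\<^esub> \<one>\<^bsub>Aut_group C e\<^esub> = N"
      using subset by (rule group.coset_mult_one[OF group_Aut_group])
    then show ?thesis by (simp add: Gal_L_def FactGroup_def cosetL_def N_def)
  qed
  have oneR: "\<one>\<^bsub>Gal_L_rel C \<kappa> e S\<^esub> = cosetR id"
    using rel_coset[OF G_id N] by (simp add: Gal_L_rel_def FactGroup_def cosetR_def N'_def N_def Autf_rel_eq)
  have KP: "Autf_KP C \<kappa> e M = X closure_of {id}"
  proof -
    have "f \<in> X closure_of {id} \<longleftrightarrow> cosetL f \<in> TL closure_of {cosetL id}" if "f \<in> G" for f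
      unfolding X_def by (rule pullback_closure_singleton) (use L(1) G_id that in auto)
    moreover have "X closure_of {id} \<subseteq> G"
      using closure_of_subset_topspace[of X "{id}"] unfolding X_def topspace_pullback_topology by blast
    ultimately show ?thesis
      unfolding Autf_KP_def oneL TL_def[symmetric] N_def[symmetric]
      by (fold cosetL_def) blast
  qed
  have Sh: "Autf_S C \<kappa> e M = connected_component_of_set X id"
  proof -
    have "connected_component_of X id f \<longleftrightarrow> connected_component_of TL (cosetL id) (cosetL f)" if "f \<in> G" for f
      unfolding X_def by (rule pullback_connected_component) (use L(1) G_id that in auto)
    moreover have "connected_component_of_set X id \<subseteq> G"
      using connected_component_of_subset_topspace[of X id] unfolding X_def topspace_pullback_topology by blast
    ultimately show ?thesis
      unfolding Autf_S_def oneL TL_def[symmetric] N_def[symmetric]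
      by (auto simp: cosetL_def)
  qed
  have "Gal_c_rel C \<kappa> e S b = cosetR ` (Y closure_of {id})"
  proof -
    have "f \<in> Y closure_of {id} \<longleftrightarrow> cosetR f \<in> TR closure_of {cosetR id}" if "f \<in> G" for f
      unfolding Y_def by (rule pullback_closure_singleton) (use R(1) G_id that in auto)
    moreover have "Y closure_of {id} \<subseteq> G"
      using closure_of_subset_topspace[of Y "{id}"] unfolding Y_def topspace_pullback_topology by blast
    moreover have "TR closure_of {cosetR id} \<subseteq> cosetR ` G"
      using closure_of_subset_topspace[of TR] R(1) by metis
    ultimately show ?thesis unfolding Gal_c_rel_def oneR TR_def[symmetric] by blast
  qed
  moreover have "Gal_0_rel C \<kappa> e S b = cosetR ` connected_component_of_set Y id"
  proof -
    have "connected_component_of Y id f \<longleftrightarrow> connected_component_of TR (cosetR id) (cosetR f)" if "f \<in> G" for f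
      unfolding Y_def by (rule pullback_connected_component) (use R(1) G_id that in auto)
    moreover have "connected_component_of_set Y id \<subseteq> G"
      using connected_component_of_subset_topspace[of Y id] unfolding Y_def topspace_pullback_topology by blast
    moreover have "connected_component_of_set TR (cosetR id) \<subseteq> cosetR ` G"
      using connected_component_of_subset_topspace[of TR] R(1) by metis
    ultimately show ?thesis unfolding Gal_0_rel_def oneR TR_def[symmetric] by blast
  qed
  moreover note closure_eq_rel_kernel[OF base_M base_b L(2) R(2) stab b]
    component_eq_rel_kernel[OF base_M base_b L(2) R(2) stab b]
  ultimately show ?thesis
    unfolding carrier_Autf_rel_Mod KP Sh by (simp add: cosetR_def N'_def)
qed

end
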